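(* For every $n\geq1$, the plactic monoid $\mathbf{P}_n(C)$ of type C is of homological type $\mathrm{FP}_\infty$: writing $M=\mathbf{P}_n(C)$, the trivial $\mathbb{Z}M$-module $\mathbb{Z}$ admits a resolution by finitely generated projective $\mathbb{Z}M$-modules.
   Context: **Plactic monoid of type C.** Let $\mathcal{C}_n=\{1<2<\dots<n<\overline{n}<\dots<\overline{2}<\overline{1}\}$ and $\mathcal{C}_n^{*}$ the free monoid on it. For $i\in\{1,\dots,n\}$ and a word $w$, the operators $\widetilde e_i,\widetilde f_i:\mathcal{C}_n^{*}\to\mathcal{C}_n^{*}\cup\{0\}$ are defined as follows. Keep only the letters $i,i+1,\overline{i+1},\overline{i}$ of $w$ (only $n,\overline n$ if $i=n$); mark $i$ and $\overline{i+1}$ by $+$, and $i+1$ and $\overline{i}$ by $-$ (for $i=n$: $n$ by $+$, $\overline n$ by $-$). Repeatedly delete adjacent pairs marked $+-$ (in this order) until none is left; the remaining letters are marked $-^r+^s$. If $r>0$, $\widetilde e_i(w)$ is obtained from $w$ by changing the letter of the rightmost remaining $-$ ($i+1\mapsto i$, $\overline i\mapsto\overline{i+1}$, and for $i=n$: $\overline n\mapsto n$); if $r=0$, $\widetilde e_i(w)=0$. If $s>0$, $\widetilde f_i(w)$ is obtained from $w$ by changing the letter of the leftmost remaining $+$ ($i\mapsto i+1$, $\overline{i+1}\mapsto\overline i$, and for $i=n$: $n\mapsto\overline n$); if $s=0$, $\widetilde f_i(w)=0$. The crystal graph $G_n$ has vertex set $\mathcal{C}_n^{*}$ and an arrow $a\xrightarrow{i}b$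 whenever $\widetilde f_i(a)=b$. Let $B(w)$ be the connected component of $w$; it contains a unique vertex $w^0$ with $\widetilde e_i(w^0)=0$ for all $i$. The weight of a word is determined by $(d_1,\dots,d_n)$, where $d_i$ is its number of letters $i$ minus its number of letters $\overline i$. For words $u,v$, $u\sim v$ means that $B(u)$ and $B(v)$ are isomorphic by a weight-preserving isomorphism of labelled directed graphs and that $u$ and $v$ correspond under it, i.e. $u^0$ and $v^0$ have the same weight and there are $i_1,\dots,i_r$ with $u=\widetilde f_{i_1}\cdots\widetilde f_{i_r}(u^0)$ and $v=\widetilde f_{i_1}\cdots\widetilde f_{i_r}(v^0)$. The plactic monoid of type C is $\mathbf{P}_n(C)=\mathcal{C}_n^{*}/\sim$. $\mathbb{Z}M$ denotes the integral monoid ring of a monoid $M$; modules are left modules; the trivial module $\mathbb{Z}$ is $\mathbb{Z}$ with every element of $M$ acting as the identity. *)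

theory Defs
  imports "HOL-Algebra.AbelCoset" "HOL-Algebra.Module"
begin

section \<open>The plactic monoid of type C\<close>

datatype letter = Plain nat | Bar nat

definition alphabet :: "nat \<Rightarrow> letter set" where
  "alphabet n = Plain ` {1..n} \<union> Bar ` {1..n}"

definition "words n = lists (alphabet n)"

datatype mark = Plus_mark | Minus_mark

definition mark_of :: "nat \<Rightarrow> nat \<Rightarrow> letter \<Rightarrow> mark option" where
  "mark_of n i x =
    (if x = Plain i \<or> (i < n \<and> x = Bar (i + 1)) then Some Plus_mark
     else if x = Bar i \<or> (i < n \<and> x = Plain (i + 1)) then Some Minus_mark
     else None)"

text \<open>The marked letters of a word, each given by its position in the word and its mark.\<close>

definition signature :: "nat \<Rightarrow> nat \<Rightarrow> letter list \<Rightarrow> (nat \<times> mark) list" where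
  "signature n i w =
    List.map_filter (\<lambda>p. map_option (Pair p) (mark_of n i (w ! p))) [0..<length w]"

inductive cancel :: "(nat \<times> mark) list \<Rightarrow> (nat \<times> mark) list \<Rightarrow> bool" where
  "cancel (s @ (p, Plus_mark) # (q, Minus_mark) # t) (s @ t)"

fun reduce_step :: "nat \<times> mark \<Rightarrow> (nat \<times> mark) list \<Rightarrow> (nat \<times> mark) list" where
  "reduce_step (p, Plus_mark) ((q, Minus_mark) # t) = t"
| "reduce_step x t = x # t"

definition reduce :: "(nat \<times> mark) list \<Rightarrow> (nat \<times> mark) list" where
  "reduce s = foldr reduce_step s []"

text \<open>\<^const>\<open>reduce\<close> computes the unique result of deleting adjacent pairs marked
  \<open>+-\<close> as long as possible.\<close>

lemma cancel_Cons: "cancel s t \<Longrightarrow> cancel (x # s) (x # t)"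
  by (auto elim!: cancel.cases) (metis append_Cons cancel.intros)

lemma cancel_reduce: "cancel\<^sup>*\<^sup>* s (reduce s)"
proof (induction s)
  case Nil
  then show ?case by (simp add: reduce_def)
next
  case (Cons x s)
  have "cancel\<^sup>*\<^sup>* (x # s) (x # reduce s)"
    using Cons by (induction rule: rtranclp_induct) (auto intro: cancel_Cons rtranclp.intros)
  moreover have "cancel\<^sup>*\<^sup>* (x # t) (reduce_step x t)" for t
    by (cases "(x, t)" rule: reduce_step.cases)
      (use cancel.intros[of "[]"] in \<open>auto intro: r_into_rtranclp\<close>)
  ultimately show ?case
    by (metis (no_types, lifting) foldr.simps(2) comp_apply reduce_def rtranclp_trans)
qed

lemma reduce_unique:
  assumes "cancel\<^sup>*\<^sup>* s t"
  shows "reduce t = reduce s"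
  using assms by (induction rule: rtranclp_induct) (auto simp: reduce_def elim!: cancel.cases)

lemma reduce_irreducible: "\<not> cancel (reduce s) t"
proof -
  have "\<exists>a b. reduce s = a @ b \<and> (\<forall>x\<in>set a. snd x = Minus_mark) \<and> (\<forall>x\<in>set b. snd x = Plus_mark)"
  proof (induction s)
    case Nil
    then show ?case by (simp add: reduce_def)
  next
    case (Cons x s)
    then obtain a b where ab: "reduce s = a @ b" "\<forall>x\<in>set a. snd x = Minus_mark"
      "\<forall>x\<in>set b. snd x = Plus_mark" by blast
    have r: "reduce (x # s) = reduce_step x (a @ b)"
      by (simp add: reduce_def ab(1)[unfolded reduce_def, symmetric])
    obtain p m where x: "x = (p, m)" by force
    show ?case
    proof (cases m)
      case Minus_mark
      then show ?thesis using r x ab by (intro exI[of _ "x # a"] exI[of _ b]) auto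
    next
      case Plus_mark
      show ?thesis
      proof (cases a)
        case Nil
        then show ?thesis using r x ab Plus_mark
          by (intro exI[of _ "[]"] exI[of _ "x # b"]) (cases b; auto)
      next
        case (Cons y a')
        then show ?thesis using r x ab Plus_mark
          by (intro exI[of _ "a'"] exI[of _ b]) (cases y; auto)
      qed
    qed
  qed
  then show ?thesis
    by (auto elim!: cancel.cases simp: append_eq_append_conv2 Cons_eq_append_conv append_eq_Cons_conv)
qed

text \<open>Only applied to letters marked \<open>+\<close>, that is, to \<open>Plain i\<close> and, for
  \<open>i < n\<close>, to \<open>Bar (i + 1)\<close>.\<close>

definition lower :: "nat \<Rightarrow> nat \<Rightarrow> letter \<Rightarrow> letter" where
  "lower n i x = (if x = Plain i then (if i = n then Bar n else Plain (i + 1)) else Bar i)"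

text \<open>The Kashiwara operator \<open>f\<^sub>i\<close>, with \<open>None\<close> for the value \<open>0\<close>.\<close>

definition kashiwara_f :: "nat \<Rightarrow> nat \<Rightarrow> letter list \<Rightarrow> letter list option" where
  "kashiwara_f n i w =
    (case filter (\<lambda>x. snd x = Plus_mark) (reduce (signature n i w)) of
       [] \<Rightarrow> None
     | (p, _) # _ \<Rightarrow> Some (w[p := lower n i (w ! p)]))"

definition crystal_edges :: "nat \<Rightarrow> (letter list \<times> nat \<times> letter list) set" where
  "crystal_edges n =
    {(a, i, b). a \<in> words n \<and> b \<in> words n \<and> i \<in> {1..n} \<and> kashiwara_f n i a = Some b}"

definition crystal_component :: "nat \<Rightarrow> letter list \<Rightarrow> letter list set" where
  "crystal_component n w =
    (let E = {(a, b). \<exists>i. (a, i, b) \<in> crystal_edges n} in {x. (w, x) \<in> (E \<union> E\<inverse>)\<^sup>*})"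

definition weight :: "nat \<Rightarrow> letter list \<Rightarrow> int list" where
  "weight n w = map (\<lambda>i. int (count_list w (Plain i)) - int (count_list w (Bar i))) [1..<n + 1]"

definition crystal_iso ::
  "nat \<Rightarrow> letter list set \<Rightarrow> letter list set \<Rightarrow> (letter list \<Rightarrow> letter list) \<Rightarrow> bool" where
  "crystal_iso n X Y \<phi> \<longleftrightarrow>
    bij_betw \<phi> X Y \<and>
    (\<forall>a\<in>X. weight n (\<phi> a) = weight n a) \<and>
    (\<forall>a\<in>X. \<forall>b\<in>X. \<forall>i. (a, i, b) \<in> crystal_edges n \<longleftrightarrow> (\<phi> a, i, \<phi> b) \<in> crystal_edges n)"

definition plactic_rel :: "nat \<Rightarrow> (letter list \<times> letter list) set" where
  "plactic_rel n =
    {(u, v). u \<in> words n \<and> v \<in> words n \<and>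
       (\<exists>\<phi>. crystal_iso n (crystal_component n u) (crystal_component n v) \<phi> \<and> \<phi> u = v)}"

text \<open>As \<^const>\<open>plactic_rel\<close> is a congruence, the union in the product
  is a single congruence class.\<close>

definition plactic_monoid_C :: "nat \<Rightarrow> letter list set monoid" where
  "plactic_monoid_C n =
    \<lparr>carrier = words n // plactic_rel n,
     monoid.mult = (\<lambda>A B. \<Union>u\<in>A. \<Union>v\<in>B. plactic_rel n `` {u @ v}),
     one = plactic_rel n `` {[]}\<rparr>"


section \<open>Left modules over a not necessarily commutative ring\<close>

text \<open>The records for modules have (irrelevant) fields for a multiplication and a unit.\<close>

locale left_module = R?: ring R + M?: abelian_group M for R (structure) and M (structure) +
  assumes smult_closed [simp, intro]:
      "\<lbrakk>a \<in> carrier R; x \<in> carrier M\<rbrakk> \<Longrightarrow> a \<odot>\<^bsub>M\<^esub> x \<in> carrier M"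
    and smult_l_distr:
      "\<lbrakk>a \<in> carrier R; b \<in> carrier R; x \<in> carrier M\<rbrakk> \<Longrightarrow>
        (a \<oplus> b) \<odot>\<^bsub>M\<^esub> x = a \<odot>\<^bsub>M\<^esub> x \<oplus>\<^bsub>M\<^esub> b \<odot>\<^bsub>M\<^esub> x"
    and smult_r_distr:
      "\<lbrakk>a \<in> carrier R; x \<in> carrier M; y \<in> carrier M\<rbrakk> \<Longrightarrow>
        a \<odot>\<^bsub>M\<^esub> (x \<oplus>\<^bsub>M\<^esub> y) = a \<odot>\<^bsub>M\<^esub> x \<oplus>\<^bsub>M\<^esub> a \<odot>\<^bsub>M\<^esub> y"
    and smult_assoc1:
      "\<lbrakk>a \<in> carrier R; b \<in> carrier R; x \<in> carrier M\<rbrakk> \<Longrightarrow>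
        (a \<otimes> b) \<odot>\<^bsub>M\<^esub> x = a \<odot>\<^bsub>M\<^esub> (b \<odot>\<^bsub>M\<^esub> x)"
    and smult_one [simp]:
      "x \<in> carrier M \<Longrightarrow> \<one> \<odot>\<^bsub>M\<^esub> x = x"

definition left_module_hom ::
  "('a, 'r) ring_scheme \<Rightarrow> ('a, 'b, 'm) module_scheme \<Rightarrow> ('a, 'c, 'n) module_scheme \<Rightarrow>
    ('b \<Rightarrow> 'c) set" where
  "left_module_hom R M N =
    {h \<in> carrier M \<rightarrow> carrier N.
       (\<forall>x\<in>carrier M. \<forall>y\<in>carrier M. h (x \<oplus>\<^bsub>M\<^esub> y) = h x \<oplus>\<^bsub>N\<^esub> h y) \<and>
       (\<forall>a\<in>carrier R. \<forall>x\<in>carrier M. h (a \<odot>\<^bsub>M\<^esub> x) = a \<odot>\<^bsub>N\<^esub> h x)}"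

definition fin_gen_module :: "'a ring \<Rightarrow> ('a, 'b) module \<Rightarrow> bool" where
  "fin_gen_module R M \<longleftrightarrow>
    (\<exists>S. finite S \<and> S \<subseteq> carrier M \<and> (\<forall>N. submodule N R M \<and> S \<subseteq> N \<longrightarrow> N = carrier M))"

definition has_lifting ::
  "'a ring \<Rightarrow> ('a, 'b) module \<Rightarrow> ('a, 'c) module \<Rightarrow> ('a, 'd) module \<Rightarrow> bool" where
  "has_lifting R P A B \<longleftrightarrow>
    (\<forall>g\<in>left_module_hom R A B. \<forall>f\<in>left_module_hom R P B.
       g ` carrier A = carrier B \<longrightarrow>
       (\<exists>h\<in>left_module_hom R P A. \<forall>x\<in>carrier P. g (h x) = f x))"

text \<open>A definition cannot quantify over types. The types of the test modules \<open>A\<close>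
  and \<open>B\<close> below are large enough to give the lifting property for modules of arbitrary types:
  see \<open>projective_module_lifting\<close>.\<close>

definition projective_module :: "'a ring \<Rightarrow> ('a, 'b) module \<Rightarrow> bool" where
  "projective_module R P \<longleftrightarrow>
    left_module R P \<and>
    (\<forall>(A :: ('a, 'b \<Rightarrow> 'a) module) (B :: ('a, 'b) module).
       left_module R A \<and> left_module R B \<longrightarrow> has_lifting R P A B)"

lemma (in left_module) smult_l_null:
  assumes "x \<in> carrier M" shows "\<zero> \<odot>\<^bsub>M\<^esub> x = \<zero>\<^bsub>M\<^esub>"
proof -
  have "\<zero> \<odot>\<^bsub>M\<^esub> x \<oplus>\<^bsub>M\<^esub> \<zero> \<odot>\<^bsub>M\<^esub> x = \<zero> \<odot>\<^bsub>M\<^esub> x"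
    using smult_l_distr[of \<zero> \<zero> x] assms by simp
  then show ?thesis
    using assms by (metis M.add.r_cancel_one' R.zero_closed smult_closed)
qed

lemma (in left_module) smult_r_null:
  assumes "a \<in> carrier R" shows "a \<odot>\<^bsub>M\<^esub> \<zero>\<^bsub>M\<^esub> = \<zero>\<^bsub>M\<^esub>"
proof -
  have "a \<odot>\<^bsub>M\<^esub> \<zero>\<^bsub>M\<^esub> \<oplus>\<^bsub>M\<^esub> a \<odot>\<^bsub>M\<^esub> \<zero>\<^bsub>M\<^esub> = a \<odot>\<^bsub>M\<^esub> \<zero>\<^bsub>M\<^esub>"
    using smult_r_distr[of a "\<zero>\<^bsub>M\<^esub>" "\<zero>\<^bsub>M\<^esub>"] assms by simp
  then show ?thesis
    using assms by (metis M.add.r_cancel_one' M.zero_closed smult_closed)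
qed

definition free_module :: "('a, 'r) ring_scheme \<Rightarrow> 'x set \<Rightarrow> ('a, 'x \<Rightarrow> 'a) module" where
  "free_module R X =
    \<lparr>carrier = {\<phi>. range \<phi> \<subseteq> carrier R \<and> finite {x. \<phi> x \<noteq> \<zero>\<^bsub>R\<^esub>} \<and> {x. \<phi> x \<noteq> \<zero>\<^bsub>R\<^esub>} \<subseteq> X},
     monoid.mult = undefined, one = undefined, zero = (\<lambda>_. \<zero>\<^bsub>R\<^esub>),
     add = (\<lambda>\<phi> \<psi> x. \<phi> x \<oplus>\<^bsub>R\<^esub> \<psi> x), smult = (\<lambda>a \<phi> x. a \<otimes>\<^bsub>R\<^esub> \<phi> x)\<rparr>"

lemma left_module_free_module:
  fixes R (structure)
  assumes "ring R"
  shows "left_module R (free_module R X)"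
proof -
  interpret ring R by fact
  let ?F = "free_module R X"
  have C: "\<phi> \<in> carrier ?F \<longleftrightarrow>
      (\<forall>x. \<phi> x \<in> carrier R) \<and> finite {x. \<phi> x \<noteq> \<zero>} \<and> (\<forall>x. x \<notin> X \<longrightarrow> \<phi> x = \<zero>)" for \<phi>
    by (auto simp: free_module_def)
  have A: "\<phi> \<oplus>\<^bsub>?F\<^esub> \<psi> = (\<lambda>x. \<phi> x \<oplus> \<psi> x)" for \<phi> \<psi> by (simp add: free_module_def)
  have Z: "\<zero>\<^bsub>?F\<^esub> = (\<lambda>_. \<zero>)" by (simp add: free_module_def)
  have S: "a \<odot>\<^bsub>?F\<^esub> \<phi> = (\<lambda>x. a \<otimes> \<phi> x)" for a \<phi> by (simp add: free_module_def)
  have "abelian_group ?F"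
  proof (rule abelian_groupI)
    fix \<phi> \<psi> assume "\<phi> \<in> carrier ?F" "\<psi> \<in> carrier ?F"
    then show "\<phi> \<oplus>\<^bsub>?F\<^esub> \<psi> \<in> carrier ?F"
      unfolding C A
      by (auto intro: finite_subset[of _ "{x. \<phi> x \<noteq> \<zero>} \<union> {x. \<psi> x \<noteq> \<zero>}"])
  next
    fix \<phi> assume p: "\<phi> \<in> carrier ?F"
    have "(\<lambda>x. \<ominus> \<phi> x) \<in> carrier ?F"
      using p unfolding C by (auto intro: finite_subset[of _ "{x. \<phi> x \<noteq> \<zero>}"])
    then show "\<exists>\<psi>\<in>carrier ?F. \<psi> \<oplus>\<^bsub>?F\<^esub> \<phi> = \<zero>\<^bsub>?F\<^esub>"
      using p by (intro bexI[of _ "\<lambda>x. \<ominus> \<phi> x"]) (auto simp: C A Z l_neg)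
  qed (auto simp: C A Z a_assoc intro: a_comm)
  moreover have "a \<odot>\<^bsub>?F\<^esub> \<phi> \<in> carrier ?F" if "a \<in> carrier R" "\<phi> \<in> carrier ?F" for a \<phi>
    using that unfolding C S by (auto intro: finite_subset[of _ "{x. \<phi> x \<noteq> \<zero>}"])
  ultimately show ?thesis
    by (intro left_module.intro left_module_axioms.intro)
      (auto simp: assms C A S l_distr r_distr m_assoc)
qed

text \<open>The extension of a map \<open>c\<close> on the basis to a homomorphism on the free module.\<close>

definition free_ext ::
  "('a, 'r) ring_scheme \<Rightarrow> ('a, 'b, 'm) module_scheme \<Rightarrow> ('x \<Rightarrow> 'b) \<Rightarrow> ('x \<Rightarrow> 'a) \<Rightarrow> 'b" where
  "free_ext R M c \<phi> = finsum M (\<lambda>x. \<phi> x \<odot>\<^bsub>M\<^esub> c x) {x. \<phi> x \<noteq> \<zero>\<^bsub>R\<^esub>}"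

context left_module
begin

lemma finsum_smult_distr:
  assumes "finite A" "a \<in> carrier R" "f \<in> A \<rightarrow> carrier M"
  shows "a \<odot>\<^bsub>M\<^esub> finsum M f A = finsum M (\<lambda>i. a \<odot>\<^bsub>M\<^esub> f i) A"
  using assms
proof (induction A rule: finite_induct)
  case empty
  then show ?case by (simp add: smult_r_null M.finsum_empty)
next
  case (insert x F)
  then have "f \<in> F \<rightarrow> carrier M" "f x \<in> carrier M" by auto
  with insert show ?case
    by (auto simp: M.finsum_insert smult_r_distr M.finsum_closed Pi_iff)
qed

lemma free_ext_superset:
  assumes c: "c \<in> X \<rightarrow> carrier M" and p: "\<phi> \<in> carrier (free_module R X)"
    and S: "finite S" "{x. \<phi> x \<noteq> \<zero>} \<subseteq> S" "S \<subseteq> X"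
  shows "free_ext R M c \<phi> = finsum M (\<lambda>x. \<phi> x \<odot>\<^bsub>M\<^esub> c x) S"
proof -
  have P: "\<phi> x \<in> carrier R" for x using p by (auto simp: free_module_def)
  have cS: "c x \<in> carrier M" if "x \<in> S" for x using that S c by auto
  show ?thesis
    unfolding free_ext_def using P cS S
    by (intro M.add.finprod_mono_neutral_cong_left) (auto simp: smult_l_null)
qed

lemma free_ext_hom:
  assumes c: "c \<in> X \<rightarrow> carrier M"
  shows "free_ext R M c \<in> left_module_hom R (free_module R X) M"
proof -
  let ?F = "free_module R X"
  interpret F: left_module R ?F by (rule left_module_free_module) (rule R.ring_axioms)
  have C: "\<phi> x \<in> carrier R" "finite {x. \<phi> x \<noteq> \<zero>}" "{x. \<phi> x \<noteq> \<zero>} \<subseteq> X"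
    if "\<phi> \<in> carrier ?F" for \<phi> x
    using that by (auto simp: free_module_def)
  have A: "\<phi> \<oplus>\<^bsub>?F\<^esub> \<psi> = (\<lambda>x. \<phi> x \<oplus> \<psi> x)" for \<phi> \<psi> by (simp add: free_module_def)
  have S: "a \<odot>\<^bsub>?F\<^esub> \<phi> = (\<lambda>x. a \<otimes> \<phi> x)" for a \<phi> by (simp add: free_module_def)
  have closed: "free_ext R M c \<phi> \<in> carrier M" if "\<phi> \<in> carrier ?F" for \<phi>
    unfolding free_ext_def using C[OF that] c by (intro M.finsum_closed) auto
  moreover have "free_ext R M c (\<phi> \<oplus>\<^bsub>?F\<^esub> \<psi>) = free_ext R M c \<phi> \<oplus>\<^bsub>M\<^esub> free_ext R M c \<psi>"
    if p: "\<phi> \<in> carrier ?F" and q: "\<psi> \<in> carrier ?F" for \<phi> \<psi>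
  proof -
    define T where "T = {x. \<phi> x \<noteq> \<zero>} \<union> {x. \<psi> x \<noteq> \<zero>}"
    have T: "finite T" "T \<subseteq> X" using C[OF p] C[OF q] by (auto simp: T_def)
    have cT: "c x \<in> carrier M" if "x \<in> T" for x using that T c by auto
    have "free_ext R M c (\<phi> \<oplus>\<^bsub>?F\<^esub> \<psi>) = finsum M (\<lambda>x. (\<phi> x \<oplus> \<psi> x) \<odot>\<^bsub>M\<^esub> c x) T"
      by (subst free_ext_superset[OF c F.a_closed[OF p q] T(1) _ T(2)]) (auto simp: A T_def)
    also have "\<dots> = finsum M (\<lambda>x. \<phi> x \<odot>\<^bsub>M\<^esub> c x \<oplus>\<^bsub>M\<^esub> \<psi> x \<odot>\<^bsub>M\<^esub> c x) T"
      using cT C[OF p] C[OF q] by (intro M.finsum_cong') (auto simp: smult_l_distr)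
    also have "\<dots> = finsum M (\<lambda>x. \<phi> x \<odot>\<^bsub>M\<^esub> c x) T \<oplus>\<^bsub>M\<^esub> finsum M (\<lambda>x. \<psi> x \<odot>\<^bsub>M\<^esub> c x) T"
      using cT C[OF p] C[OF q] by (intro M.finsum_addf) auto
    also have "\<dots> = free_ext R M c \<phi> \<oplus>\<^bsub>M\<^esub> free_ext R M c \<psi>"
      using free_ext_superset[OF c p T(1) _ T(2)] free_ext_superset[OF c q T(1) _ T(2)]
      by (auto simp: T_def)
    finally show ?thesis .
  qed
  moreover have "free_ext R M c (a \<odot>\<^bsub>?F\<^esub> \<phi>) = a \<odot>\<^bsub>M\<^esub> free_ext R M c \<phi>"
    if a: "a \<in> carrier R" and p: "\<phi> \<in> carrier ?F" for a \<phi>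
  proof -
    define T where "T = {x. \<phi> x \<noteq> \<zero>}"
    have T: "finite T" "T \<subseteq> X" using C[OF p] by (auto simp: T_def)
    have cT: "c x \<in> carrier M" if "x \<in> T" for x using that T c by auto
    have "free_ext R M c (a \<odot>\<^bsub>?F\<^esub> \<phi>) = finsum M (\<lambda>x. (a \<otimes> \<phi> x) \<odot>\<^bsub>M\<^esub> c x) T"
      by (subst free_ext_superset[OF c F.smult_closed[OF a p] T(1) _ T(2)])
        (auto simp: S T_def a)
    also have "\<dots> = finsum M (\<lambda>x. a \<odot>\<^bsub>M\<^esub> (\<phi> x \<odot>\<^bsub>M\<^esub> c x)) T"
      using cT C[OF p] a by (intro M.finsum_cong') (auto simp: smult_assoc1)
    also have "\<dots> = a \<odot>\<^bsub>M\<^esub> free_ext R M c \<phi>"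
      unfolding free_ext_def T_def[symmetric]
      using cT C[OF p] a T by (intro finsum_smult_distr[symmetric]) auto
    finally show ?thesis .
  qed
  ultimately show ?thesis by (auto simp: left_module_hom_def)
qed

lemma free_ext_basis:
  assumes c: "c \<in> X \<rightarrow> carrier M" and y: "y \<in> X"
  shows "(\<lambda>x. if x = y then \<one> else \<zero>) \<in> carrier (free_module R X)"
    and "free_ext R M c (\<lambda>x. if x = y then \<one> else \<zero>) = c y"
proof -
  let ?b = "\<lambda>x. if x = y then \<one> else \<zero>"
  show b: "?b \<in> carrier (free_module R X)"
    using y by (auto simp: free_module_def intro: finite_subset[of _ "{y}"])
  have "free_ext R M c ?b = finsum M (\<lambda>x. ?b x \<odot>\<^bsub>M\<^esub> c x) {y}"
    using y by (intro free_ext_superset[OF c b]) auto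
  also have "\<dots> = c y" using funcset_mem[OF c y] by (simp add: M.finsum_insert M.finsum_empty)
  finally show "free_ext R M c ?b = c y" .
qed

lemma hom_free_ext:
  assumes N: "left_module R N" and g: "g \<in> left_module_hom R M N"
    and c: "c \<in> X \<rightarrow> carrier M" and p: "\<phi> \<in> carrier (free_module R X)"
  shows "g (free_ext R M c \<phi>) = free_ext R N (g \<circ> c) \<phi>"
proof -
  interpret N: left_module R N by fact
  have g: "g \<in> carrier M \<rightarrow> carrier N"
    "\<And>x y. x \<in> carrier M \<Longrightarrow> y \<in> carrier M \<Longrightarrow> g (x \<oplus>\<^bsub>M\<^esub> y) = g x \<oplus>\<^bsub>N\<^esub> g y"
    "\<And>a x. a \<in> carrier R \<Longrightarrow> x \<in> carrier M \<Longrightarrow> g (a \<odot>\<^bsub>M\<^esub> x) = a \<odot>\<^bsub>N\<^esub> g x"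
    using g by (auto simp: left_module_hom_def)
  have g0: "g \<zero>\<^bsub>M\<^esub> = \<zero>\<^bsub>N\<^esub>"
    using g(3)[of \<zero> "\<zero>\<^bsub>M\<^esub>"] funcset_mem[OF g(1), of "\<zero>\<^bsub>M\<^esub>"]
    by (simp add: smult_l_null N.smult_l_null)
  have P: "\<phi> x \<in> carrier R" for x using p by (auto simp: free_module_def)
  have "g (finsum M (\<lambda>x. \<phi> x \<odot>\<^bsub>M\<^esub> c x) T) = finsum N (\<lambda>x. \<phi> x \<odot>\<^bsub>N\<^esub> g (c x)) T"
    if "finite T" "T \<subseteq> X" for T
    using that
  proof (induction T rule: finite_induct)
    case empty
    then show ?case by (simp add: M.finsum_empty N.M.finsum_empty g0)
  next
    case (insert y T)
    have 1: "(\<lambda>x. \<phi> x \<odot>\<^bsub>M\<^esub> c x) \<in> T \<rightarrow> carrier M" "\<phi> y \<odot>\<^bsub>M\<^esub> c y \<in> carrier M"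
      "c y \<in> carrier M"
      using insert.prems c P by auto
    have 2: "(\<lambda>x. \<phi> x \<odot>\<^bsub>N\<^esub> g (c x)) \<in> T \<rightarrow> carrier N" "\<phi> y \<odot>\<^bsub>N\<^esub> g (c y) \<in> carrier N"
      using insert.prems c P g(1) by (auto intro!: N.smult_closed)
    show ?case
      using insert 1 2
      by (simp add: M.finsum_insert N.M.finsum_insert g(2,3) M.finsum_closed P)
  qed
  then show ?thesis using p by (auto simp: free_ext_def free_module_def)
qed

end

lemma projective_module_lifting:
  fixes P :: "('a, 'b) module" and A :: "('a, 'c) module" and B :: "('a, 'd) module"
  assumes P: "projective_module R P" and A: "left_module R A" and B: "left_module R B"
  shows "has_lifting R P A B"
  unfolding has_lifting_def
proof (intro ballI impI)
  fix g f assume g: "g \<in> left_module_hom R A B" and f: "f \<in> left_module_hom R P B"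
    and surj: "g ` carrier A = carrier B"
  interpret P: left_module R P using P by (simp add: projective_module_def)
  interpret A: left_module R A by fact
  interpret B: left_module R B by fact
  let ?F = "free_module R (carrier P)" and ?e = "free_ext R P (\<lambda>x. x)"
  have F: "left_module R ?F" by (rule left_module_free_module) (rule P.R.ring_axioms)
  have e: "?e \<in> left_module_hom R ?F P" by (rule P.free_ext_hom) simp
  have "?e ` carrier ?F = carrier P"
  proof
    show "?e ` carrier ?F \<subseteq> carrier P" using e by (auto simp: left_module_hom_def)
    show "carrier P \<subseteq> ?e ` carrier ?F"
      using P.free_ext_basis[of "\<lambda>x. x" "carrier P"] by (metis (no_types, lifting) image_eqI Pi_I subsetI)
  qed
  moreover have "(\<lambda>x. x) \<in> left_module_hom R P P" by (auto simp: left_module_hom_def)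
  moreover have "has_lifting R P ?F P" using P F P.left_module_axioms by (simp add: projective_module_def)
  ultimately have "\<exists>s\<in>left_module_hom R P ?F. \<forall>x\<in>carrier P. ?e (s x) = x"
    using e by (auto simp: has_lifting_def dest!: bspec[of _ _ ?e] bspec[of _ _ "\<lambda>x. x"])
  then obtain s where s: "s \<in> left_module_hom R P ?F"
    and es: "\<And>x. x \<in> carrier P \<Longrightarrow> ?e (s x) = x"
    by blast
  have fP: "f x \<in> carrier B" if "x \<in> carrier P" for x
    using f that by (auto simp: left_module_hom_def)
  define c where "c x = inv_into (carrier A) g (f x)" for x
  have c: "c x \<in> carrier A" "g (c x) = f x" if "x \<in> carrier P" for x
    using fP[OF that] surj by (auto simp: c_def inv_into_into f_inv_into_f)
  have cP: "c \<in> carrier P \<rightarrow> carrier A" using c by auto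
  let ?h = "free_ext R A c \<circ> s"
  have "?h \<in> left_module_hom R P A"
    using A.free_ext_hom[OF cP] s by (auto simp: left_module_hom_def Pi_iff)
  moreover have "g (?h x) = f x" if x: "x \<in> carrier P" for x
  proof -
    have sx: "s x \<in> carrier ?F" using s x by (auto simp: left_module_hom_def)
    have sx': "{y. s x y \<noteq> \<zero>\<^bsub>R\<^esub>} \<subseteq> carrier P" "\<And>y. s x y \<in> carrier R"
      using sx by (auto simp: free_module_def)
    have "g (?h x) = free_ext R B (g \<circ> c) (s x)"
      using A.hom_free_ext[OF B g cP sx] by simp
    also have "\<dots> = free_ext R B (f \<circ> (\<lambda>x. x)) (s x)"
      unfolding free_ext_def using sx' c fP
      by (intro B.M.finsum_cong') (auto intro!: B.smult_closed)
    also have "\<dots> = f (?e (s x))"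
      by (rule P.hom_free_ext[OF B f _ sx, symmetric]) simp
    finally show ?thesis using es[OF x] by simp
  qed
  ultimately show "\<exists>h\<in>left_module_hom R P A. \<forall>x\<in>carrier P. g (h x) = f x" by blast
qed

definition projective_resolution_fg ::
  "'a ring \<Rightarrow> ('a, 'c) module \<Rightarrow> (nat \<Rightarrow> ('a, 'b) module) \<Rightarrow> (nat \<Rightarrow> 'b \<Rightarrow> 'b) \<Rightarrow> ('b \<Rightarrow> 'c) \<Rightarrow> bool" where
  "projective_resolution_fg R M P d \<epsilon> \<longleftrightarrow>
    left_module R M \<and>
    (\<forall>k. projective_module R (P k) \<and> fin_gen_module R (P k)) \<and>
    (\<forall>k. d k \<in> left_module_hom R (P (Suc k)) (P k)) \<and>
    \<epsilon> \<in> left_module_hom R (P 0) M \<and>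
    \<epsilon> ` carrier (P 0) = carrier M \<and>
    d 0 ` carrier (P 1) = a_kernel (P 0) M \<epsilon> \<and>
    (\<forall>k. d (Suc k) ` carrier (P (Suc (Suc k))) = a_kernel (P (Suc k)) (P k) (d k))"


section \<open>Monoid rings and the homological finiteness property\<close>

definition monoid_ring :: "'m monoid \<Rightarrow> ('m \<Rightarrow> int) ring" where
  "monoid_ring M =
    \<lparr>carrier = {f. finite {x. f x \<noteq> 0} \<and> {x. f x \<noteq> 0} \<subseteq> carrier M},
     monoid.mult = (\<lambda>f g x. \<Sum>(a, b) \<in> {(a, b). f a \<noteq> 0 \<and> g b \<noteq> 0 \<and> a \<otimes>\<^bsub>M\<^esub> b = x}. f a * g b),
     one = (\<lambda>x. if x = \<one>\<^bsub>M\<^esub> then 1 else 0),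
     zero = (\<lambda>_. 0),
     add = (\<lambda>f g x. f x + g x)\<rparr>"

text \<open>The integers with every element of the monoid acting as the identity: an element of the
  monoid ring acts by multiplication with the sum of its coefficients.\<close>

definition trivial_module :: "('m \<Rightarrow> int, int) module" where
  "trivial_module =
    \<lparr>carrier = UNIV, monoid.mult = (*), one = 1, zero = 0, add = (+),
     smult = (\<lambda>f k. (\<Sum>x | f x \<noteq> 0. f x) * k)\<rparr>"

text \<open>A finitely generated projective module is a direct summand of a free module of finite rank
  \<open>r\<close>, hence isomorphic to one whose elements are \<open>r\<close>-tuples of ring elements. So there is no
  loss in taking the modules of the resolution in the type of sequences of ring elements.\<close>

definition FP_infinity :: "'m monoid \<Rightarrow> bool" where
  "FP_infinity M \<longleftrightarrow>
    (\<exists>(P :: nat \<Rightarrow> ('m \<Rightarrow> int, nat \<Rightarrow> 'm \<Rightarrow> int) module) d \<epsilon>.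
       projective_resolution_fg (monoid_ring M) trivial_module P d \<epsilon>)"

end

theory Submission
  imports Defs "HOL-Library.Multiset" "HOL-Library.Countable_Set" "HOL-Library.Product_Lexorder"
begin

text \<open>
  Call two words bisimilar if the same strings of Kashiwara operators are defined on both. Mapping a
  letter \<open>x\<close> to \<open>x\<close> followed by the column of all letters except the bar of \<open>x\<close> turns the operator
  \<open>f\<^sub>i\<close> of type C into \<open>f\<^sub>i f\<^sub>2\<^sub>n\<^sub>-\<^sub>i\<close> of type A. In type A the Knuth relations show that highest weight
  words of equal weight are bisimilar, and a comparison with products of columns shows that a
  component has a single highest weight word; both facts pass to type C. Hence plactic equivalence
  is bisimilarity and a class \<open>m\<close> is determined by its dominant weight and its position in a
  crystal depending only on that weight. It follows that the weight of a product is at most the sum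
  of the weights, and that a class of weight \<open>l + l'\<close> is in exactly one way a product of a class of
  weight \<open>l\<close> and one of weight \<open>l'\<close>.

  Take as generators the classes of nonzero multiplicity-free weight. Splitting off again and again
  the largest multiplicity-free weight gives a unique normal form for each class. Normality is a
  condition on adjacent letters only, and normalising a word decreases it for a monomial order. So
  the trivial module has a resolution of Anick type, whose \<open>k\<close>-th module is free on the finitely many
  words of length \<open>k\<close> in which no adjacent pair is normal.
\<close>

section \<open>Crystals of words\<close>

text \<open>The defining equivalence speaks of isomorphisms of components and says nothing directly
  about products. Bisimilarity does: which factor of a product an operator changes is decided by the
  numbers of unmatched signs of the factors, and these are visible to strings of operators. To turn
  a bisimulation back into an isomorphism, highest weight words have to be unique in their
  components. In type C this is imported from type A, where the Knuth relations concern three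
  letters and can be checked by cases.

  The generators have to allow every sum of distinct fundamental weights, not only single ones: with
  this choice the greedy splitting makes the supports of the weights decrease along a normal form,
  and this is the hypothesis of the rigidity argument (\<open>cartan_rigid\<close>) that makes
  normality a condition on neighbours.

  Weights are compared through a single positive linear form, the height, which is the pairing with
  half the sum of the positive roots. A product whose height is the sum of the heights of its
  factors already has the sum of their weights, so equality of two numbers replaces a decomposition
  of tensor products.\<close>

fun eps :: "('a \<Rightarrow> mark option) \<Rightarrow> 'a list \<Rightarrow> nat" where
  "eps mk [] = 0"
| "eps mk (x # w) = (case mk x of None \<Rightarrow> eps mk w
     | Some Plus_mark \<Rightarrow> eps mk w - 1 | Some Minus_mark \<Rightarrow> Suc (eps mk w))"

text \<open>\<open>eps\<close> and \<open>phi\<close> count the unmatched minus and plus marks. A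
  plus placed in front cancels one unmatched minus of the rest if there is one and survives
  otherwise; the truncated subtraction in \<open>eps\<close> expresses this.\<close>

fun phi :: "('a \<Rightarrow> mark option) \<Rightarrow> 'a list \<Rightarrow> nat" where
  "phi mk [] = 0"
| "phi mk (x # w) = (if mk x = Some Plus_mark \<and> eps mk w = 0 then Suc (phi mk w) else phi mk w)"

fun f_op :: "('a \<Rightarrow> mark option) \<Rightarrow> ('a \<Rightarrow> 'a) \<Rightarrow> 'a list \<Rightarrow> 'a list option" where
  "f_op mk lo [] = None"
| "f_op mk lo (x # w) = (if mk x = Some Plus_mark \<and> eps mk w = 0 then Some (lo x # w)
     else map_option ((#) x) (f_op mk lo w))"

text \<open>If the whole word has an unmatched minus and the rest has none, that minus is the front
  letter; hence the nested tests.\<close>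

fun e_op :: "('a \<Rightarrow> mark option) \<Rightarrow> ('a \<Rightarrow> 'a) \<Rightarrow> 'a list \<Rightarrow> 'a list option" where
  "e_op mk ra [] = None"
| "e_op mk ra (x # w) = (if eps mk (x # w) = 0 then None
     else if eps mk w = 0 then Some (ra x # w) else map_option ((#) x) (e_op mk ra w))"

text \<open>The unmatched plus marks of \<open>u\<close> cancel against the unmatched minus marks of
  \<open>v\<close>, and whichever kind is in excess survives.\<close>

lemma eps_append: "eps mk (u @ v) = eps mk u + (eps mk v - phi mk u)"
  by (induction u) (auto split: option.splits mark.splits)

lemma phi_append: "phi mk (u @ v) = phi mk v + (phi mk u - eps mk v)"
  by (induction u) (auto simp: eps_append)

lemma phi_minus_eps_append:
  "int (phi mk (u @ v)) - int (eps mk (u @ v))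
     = (int (phi mk u) - int (eps mk u)) + (int (phi mk v) - int (eps mk v))"
  by (simp add: eps_append phi_append)

lemma f_op_None_iff: "f_op mk lo w = None \<longleftrightarrow> phi mk w = 0"
  by (induction w) auto

lemma e_op_None_iff: "e_op mk ra w = None \<longleftrightarrow> eps mk w = 0"
  by (induction w) (auto split: option.splits mark.splits)

text \<open>The tensor product rule for crystals: after cancellation across the border, the leftmost
  plus lies in \<open>u\<close> exactly if \<open>u\<close> has a plus in excess.\<close>

lemma f_op_append: "f_op mk lo (u @ v) =
   (if phi mk u > eps mk v then map_option (\<lambda>u'. u' @ v) (f_op mk lo u)
    else map_option ((@) u) (f_op mk lo v))"
proof (induction u)
  case Nil
  show ?case by (cases "f_op mk lo v") auto
next
  case (Cons x u)
  have *: "f_op mk lo u = None" if "phi mk u = 0" using that f_op_None_iff by blast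
  show ?case
    using Cons *
    by (auto simp: eps_append option.map_comp comp_def split: if_splits)
qed

lemma e_op_append: "e_op mk ra (u @ v) =
   (if eps mk v > phi mk u then map_option ((@) u) (e_op mk ra v)
    else map_option (\<lambda>u'. u' @ v) (e_op mk ra u))"
proof (induction u)
  case Nil
  show ?case using e_op_None_iff[of mk ra v] by (cases "e_op mk ra v") auto
next
  case (Cons x u)
  have *: "e_op mk ra u = None" if "eps mk u = 0" using that e_op_None_iff by blast
  show ?case
    using Cons *
    by (auto simp: eps_append option.map_comp comp_def split: if_splits option.splits mark.splits)
qed

lemma f_op_length: "f_op mk lo w = Some v \<Longrightarrow> length v = length w"
  by (induction w arbitrary: v) (auto split: if_splits)

lemma e_op_length: "e_op mk lo w = Some v \<Longrightarrow> length v = length w"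
  by (induction w arbitrary: v) (auto split: if_splits)

text \<open>The two vanishing conditions say that no sign on either side competes with the changed
  letter. They allow the change of a single letter to be replayed in another crystal.\<close>

lemma f_op_decomp:
  "f_op mk lo w = Some v \<Longrightarrow> \<exists>a x b. w = a @ x # b \<and> v = a @ lo x # b \<and> mk x = Some Plus_mark \<and>
     phi mk a = 0 \<and> eps mk b = 0"
proof (induction w arbitrary: v)
  case (Cons y w)
  show ?case
  proof (cases "mk y = Some Plus_mark \<and> eps mk w = 0")
    case True
    then show ?thesis using Cons.prems by (intro exI[of _ "[]"]) auto
  next
    case False
    then obtain v' where v': "f_op mk lo w = Some v'" "v = y # v'" using Cons.prems by (auto split: if_splits)
    then obtain a x b where ax: "w = a @ x # b" "v' = a @ lo x # b" "mk x = Some Plus_mark"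
      "phi mk a = 0" "eps mk b = 0" using Cons.IH[of v'] by blast
    have "eps mk w = eps mk a" using ax by (simp add: eps_append)
    then have "phi mk (y # a) = 0" using False ax by auto
    then show ?thesis using ax v' by (intro exI[of _ "y # a"] exI[of _ x] exI[of _ b]) auto
  qed
qed simp

text \<open>Only the mutual inversion of raising and lowering on marked letters enters the general
  theory, so the crystals of types A and C are both instances.\<close>

locale word_crystal =
  fixes mk :: "'i \<Rightarrow> 'a \<Rightarrow> mark option" and lo ra :: "'i \<Rightarrow> 'a \<Rightarrow> 'a"
  assumes lo: "mk i x = Some Plus_mark \<Longrightarrow> mk i (lo i x) = Some Minus_mark \<and> ra i (lo i x) = x"
    and ra: "mk i x = Some Minus_mark \<Longrightarrow> mk i (ra i x) = Some Plus_mark \<and> lo i (ra i x) = x"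
begin

lemma f_op_eps_phi: "f_op (mk i) (lo i) u = Some v \<Longrightarrow> eps (mk i) v = Suc (eps (mk i) u) \<and> Suc (phi (mk i) v) = phi (mk i) u"
  by (induction u arbitrary: v) (auto simp: lo split: if_splits option.splits mark.splits)

lemma e_op_eps_phi: "e_op (mk i) (ra i) u = Some v \<Longrightarrow> Suc (eps (mk i) v) = eps (mk i) u \<and> phi (mk i) v = Suc (phi (mk i) u)"
  by (induction u arbitrary: v) (auto simp: ra split: if_splits option.splits mark.splits)

lemma e_op_f_op: "f_op (mk i) (lo i) u = Some v \<Longrightarrow> e_op (mk i) (ra i) v = Some u"
proof (induction u arbitrary: v)
  case (Cons x u)
  show ?case
  proof (cases "mk i x = Some Plus_mark \<and> eps (mk i) u = 0")
    case True
    then show ?thesis using Cons.prems by (auto simp: lo)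
  next
    case False
    then obtain v' where v': "f_op (mk i) (lo i) u = Some v'" "v = x # v'" using Cons.prems by (auto split: if_splits)
    then show ?thesis using Cons.IH[OF v'(1)] f_op_eps_phi[OF v'(1)] False
      by (auto split: option.splits mark.splits)
  qed
qed simp

lemma f_op_e_op: "e_op (mk i) (ra i) u = Some v \<Longrightarrow> f_op (mk i) (lo i) v = Some u"
proof (induction u arbitrary: v)
  case (Cons x u)
  show ?case
  proof (cases "eps (mk i) u = 0")
    case True
    then show ?thesis using Cons.prems by (auto simp: ra split: if_splits option.splits mark.splits)
  next
    case False
    then obtain v' where v': "e_op (mk i) (ra i) u = Some v'" "v = x # v'"
      using Cons.prems by (auto split: if_splits)
    then show ?thesis using Cons.IH[OF v'(1)] e_op_eps_phi[OF v'(1)] False Cons.prems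
      by (auto split: option.splits mark.splits if_splits)
  qed
qed simp

lemma e_op_decomp:
  assumes "e_op (mk i) (ra i) w = Some v"
  shows "\<exists>a x b. w = a @ lo i x # b \<and> v = a @ x # b \<and> mk i x = Some Plus_mark \<and>
    phi (mk i) a = 0 \<and> eps (mk i) b = 0"
  using f_op_decomp[OF f_op_e_op[OF assms]] by blast

text \<open>\<open>True\<close> selects lowering and \<open>False\<close> raising. With both in one
  kind of string, a string can reach every word of a component, and inverting a step negates its
  flag.\<close>

definition act :: "'i \<times> bool \<Rightarrow> 'a list \<Rightarrow> 'a list option" where
  "act a w = (if snd a then f_op (mk (fst a)) (lo (fst a)) w else e_op (mk (fst a)) (ra (fst a)) w)"

fun run :: "('i \<times> bool) list \<Rightarrow> 'a list \<Rightarrow> 'a list option" where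
  "run [] w = Some w"
| "run (a # s) w = Option.bind (act a w) (run s)"

lemma run_append: "run (s @ t) w = Option.bind (run s w) (run t)"
  proof (induction s arbitrary: w)
  case (Cons a s)
  then show ?case by (cases "act a w") auto
qed simp

lemma act_inverse: "act (i, b) u = Some v \<longleftrightarrow> act (i, \<not> b) v = Some u"
  by (cases b) (simp_all add: act_def, (blast intro: e_op_f_op f_op_e_op)+)

lemma act_length: "act a u = Some v \<Longrightarrow> length v = length u"
  by (auto simp: act_def f_op_length e_op_length split: if_splits)

lemma act_append: "act (i, b) (u @ v) =
   (if b then if phi (mk i) u > eps (mk i) v then map_option (\<lambda>u'. u' @ v) (act (i, b) u)
              else map_option ((@) u) (act (i, b) v)
    else if eps (mk i) v > phi (mk i) u then map_option ((@) u) (act (i, b) v)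
    else map_option (\<lambda>u'. u' @ v) (act (i, b) u))"
  by (simp add: act_def f_op_append e_op_append)

section \<open>Components and bisimilarity\<close>

definition conn :: "'i set \<Rightarrow> 'a list \<Rightarrow> 'a list \<Rightarrow> bool" where
  "conn I u v \<longleftrightarrow> (\<exists>s\<in>lists (I \<times> UNIV). run s u = Some v)"

lemma conn_refl [simp]: "conn I u u"
  unfolding conn_def by (rule bexI[of _ "[]"]) auto

lemma conn_trans: "conn I u v \<Longrightarrow> conn I v w \<Longrightarrow> conn I u w"
  unfolding conn_def by (metis append_in_lists_conv bind.bind_lunit run_append)

lemma conn_act: "i \<in> I \<Longrightarrow> act (i, b) u = Some v \<Longrightarrow> conn I u v"
  unfolding conn_def by (intro bexI[of _ "[(i, b)]"]) auto

lemma conn_induct [consumes 1, case_names refl step]: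
  assumes "conn I u v" "P u"
    and step: "\<And>v w i b. conn I u v \<Longrightarrow> P v \<Longrightarrow> i \<in> I \<Longrightarrow> act (i, b) v = Some w \<Longrightarrow> P w"
  shows "P v"
proof -
  obtain s where "s \<in> lists (I \<times> UNIV)" "run s u = Some v" using assms(1) by (auto simp: conn_def)
  then show ?thesis
  proof (induction s arbitrary: v rule: rev_induct)
    case Nil
    then show ?case using assms(2) by simp
  next
    case (snoc a s)
    obtain v' where v': "run s u = Some v'" "run [a] v' = Some v"
      using snoc.prems by (auto simp: run_append bind_eq_Some_conv)
    moreover have "s \<in> lists (I \<times> UNIV)" "fst a \<in> I" using snoc.prems by auto
    moreover have "act (fst a, snd a) v' = Some v" using v' by (auto simp: bind_eq_Some_conv)
    ultimately show ?case using snoc.IH step unfolding conn_def by blast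
  qed
qed

lemma conn_sym: "conn I u v \<Longrightarrow> conn I v u"
proof (induction rule: conn_induct)
  case (step v w i b)
  then show ?case using act_inverse[of i b v w] by (blast intro: conn_trans conn_act)
qed simp

lemma conn_length: "conn I u v \<Longrightarrow> length v = length u"
  by (induction rule: conn_induct) (auto dest: act_length)

text \<open>Every operator changes only one factor, so the component of a product lies inside the
  product of the two components.\<close>

lemma conn_append:
  assumes "conn I (u @ v) w"
  shows "\<exists>u' v'. w = u' @ v' \<and> conn I u u' \<and> conn I v v'"
  using assms
proof (induction rule: conn_induct)
  case refl
  show ?case using conn_refl by blast
next
  case (step x w i b)
  then obtain u' v' where uv: "x = u' @ v'" "conn I u u'" "conn I v v'" by blast
  show ?case
    using step.hyps(2,3) uv(1) conn_trans[OF uv(2) conn_act[of i I b]] conn_trans[OF uv(3) conn_act[of i I b]] uv(2,3)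
    by (fastforce simp: act_append split: if_splits)
qed

text \<open>Only definedness of strings is compared; the correspondence between the two components
  is derived from it. The colours are a parameter because type A is used with all colours and also
  with those below \<open>2 * n - 1\<close> only.\<close>

definition bis :: "'i set \<Rightarrow> 'a list \<Rightarrow> 'a list \<Rightarrow> bool" where
  "bis I u v \<longleftrightarrow> (\<forall>s\<in>lists (I \<times> UNIV). run s u = None \<longleftrightarrow> run s v = None)"

lemma bis_refl [simp]: "bis I u u" by (simp add: bis_def)
lemma bis_sym: "bis I u v \<Longrightarrow> bis I v u" by (simp add: bis_def)
lemma bis_trans [trans]: "bis I u v \<Longrightarrow> bis I v w \<Longrightarrow> bis I u w" by (simp add: bis_def)

lemma bis_run:
  assumes "bis I u v" "s \<in> lists (I \<times> UNIV)" "run s u = Some u'"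
  shows "\<exists>v'. run s v = Some v' \<and> bis I u' v'"
proof -
  have "run s v \<noteq> None" using assms unfolding bis_def by force
  then obtain v' where v': "run s v = Some v'" by blast
  have "bis I u' v'" unfolding bis_def
  proof
    fix t assume "t \<in> lists (I \<times> (UNIV :: bool set))"
    then have "s @ t \<in> lists (I \<times> (UNIV :: bool set))" using assms(2) by simp
    then have "run (s @ t) u = None \<longleftrightarrow> run (s @ t) v = None" using assms(1) unfolding bis_def by blast
    then show "run t u' = None \<longleftrightarrow> run t v' = None" by (simp add: run_append assms(3) v')
  qed
  then show ?thesis using v' by blast
qed

lemma bis_act:
  assumes "bis I u v" "i \<in> I" "act (i, b) u = Some u'"
  shows "\<exists>v'. act (i, b) v = Some v' \<and> bis I u' v'"
  using bis_run[OF assms(1), of "[(i, b)]" u'] assms(2,3) by (auto simp: bind_eq_Some_conv)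

lemma bis_coinduct:
  assumes "Z u v"
    and step: "\<And>u v i b u'. Z u v \<Longrightarrow> i \<in> I \<Longrightarrow> act (i, b) u = Some u' \<Longrightarrow> \<exists>v'. act (i, b) v = Some v' \<and> Z u' v'"
    and sym: "\<And>u v. Z u v \<Longrightarrow> Z v u"
  shows "bis I u v"
proof -
  have "run s v \<noteq> None" if "s \<in> lists (I \<times> UNIV)" "run s u \<noteq> None" "Z u v" for s u v
    using that(1,2,3)
  proof (induction s arbitrary: u v rule: list.induct)
    case (Cons a s)
    obtain u' where u': "act a u = Some u'" using Cons.prems(2) by (cases "act a u") simp_all
    obtain v' where v': "act a v = Some v'" "Z u' v'"
      using step[of u v "fst a" "snd a" u'] Cons.prems u' by auto
    show ?case using Cons u' v' by auto
  qed simp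
  then show ?thesis using assms(1) sym[OF assms(1)] unfolding bis_def by blast
qed

text \<open>Raising with one colour until it is undefined counts \<open>eps\<close>, and lowering
  counts \<open>phi\<close>, so both can be read off from definedness. One inequality is enough
  because \<open>bis\<close> is symmetric.\<close>

lemma bis_eps_phi_aux:
  assumes "bis I u v" "i \<in> I"
  shows "eps (mk i) u \<le> eps (mk i) v \<and> phi (mk i) u \<le> phi (mk i) v"
proof
  show "eps (mk i) u \<le> eps (mk i) v"
    using assms(1)
  proof (induction "eps (mk i) u" arbitrary: u v)
    case (Suc k)
    then obtain u' where u': "act (i, False) u = Some u'"
      using e_op_None_iff[of "mk i" "ra i" u] by (auto simp: act_def)
    obtain v' where v': "act (i, False) v = Some v'" "bis I u' v'" using bis_act[OF Suc.prems assms(2) u'] by blast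
    show ?case using Suc(1)[of u' v'] Suc(2) e_op_eps_phi[of i u u'] e_op_eps_phi[of i v v'] u' v' by (auto simp: act_def)
  qed simp
  show "phi (mk i) u \<le> phi (mk i) v"
    using assms(1)
  proof (induction "phi (mk i) u" arbitrary: u v)
    case (Suc k)
    then obtain u' where u': "act (i, True) u = Some u'"
      using f_op_None_iff[of "mk i" "lo i" u] by (auto simp: act_def)
    obtain v' where v': "act (i, True) v = Some v'" "bis I u' v'" using bis_act[OF Suc.prems assms(2) u'] by blast
    show ?case using Suc(1)[of u' v'] Suc(2) f_op_eps_phi[of i u u'] f_op_eps_phi[of i v v'] u' v' by (auto simp: act_def)
  qed simp
qed

lemma bis_eps_phi:
  assumes "bis I u v" "i \<in> I"
  shows "eps (mk i) u = eps (mk i) v" "phi (mk i) u = phi (mk i) v"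
  using bis_eps_phi_aux[OF assms] bis_eps_phi_aux[OF bis_sym[OF assms(1)] assms(2)] by auto

text \<open>By the tensor product rule the factor that is changed depends only on \<open>phi\<close>
  of the left and \<open>eps\<close> of the right word, which agree for bisimilar words. So the
  products of bisimilar words form a bisimulation.\<close>

lemma bis_append:
  assumes "bis I u u'" "bis I v v'"
  shows "bis I (u @ v) (u' @ v')"
proof (rule bis_coinduct[where Z = "\<lambda>x y. \<exists>u u' v v'. x = u @ v \<and> y = u' @ v' \<and> bis I u u' \<and> bis I v v'"])
  show "\<exists>ua u'a va v'a. u @ v = ua @ va \<and> u' @ v' = u'a @ v'a \<and> bis I ua u'a \<and> bis I va v'a"
    using assms by blast
next
  fix x y i b x'
  assume "\<exists>u u' v v'. x = u @ v \<and> y = u' @ v' \<and> bis I u u' \<and> bis I v v'" and i: "i \<in> I"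
    and x': "act (i, b) x = Some x'"
  then obtain u u' v v' where xy: "x = u @ v" "y = u' @ v'" and B: "bis I u u'" "bis I v v'" by blast
  note e = bis_eps_phi[OF B(1) i] bis_eps_phi[OF B(2) i]
  show "\<exists>y'. act (i, b) y = Some y' \<and> (\<exists>u u' v v'. x' = u @ v \<and> y' = u' @ v' \<and> bis I u u' \<and> bis I v v')"
    using x' bis_act[OF B(1) i, of b] bis_act[OF B(2) i, of b] B e unfolding xy act_append
    by (fastforce split: if_splits)
next
  show "\<And>u v. \<exists>ua u' va v'. u = ua @ va \<and> v = u' @ v' \<and> bis I ua u' \<and> bis I va v' \<Longrightarrow>
           \<exists>ua u' va v'. v = ua @ va \<and> u = u' @ v' \<and> bis I ua u' \<and> bis I va v'"
    using bis_sym by blast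
qed

definition hw :: "'i set \<Rightarrow> 'a list \<Rightarrow> bool" where
  "hw I w \<longleftrightarrow> (\<forall>i\<in>I. eps (mk i) w = 0)"

lemma hw_act: "hw I w \<longleftrightarrow> (\<forall>i\<in>I. act (i, False) w = None)"
  by (simp add: hw_def act_def e_op_None_iff)

lemma hw_append_left: "hw I (u @ v) \<Longrightarrow> hw I u"
  by (simp add: hw_def eps_append)

lemma bis_hw: "bis I u v \<Longrightarrow> hw I u \<Longrightarrow> hw I v"
  by (simp add: hw_def bis_eps_phi)

end

section \<open>Type A\<close>

text \<open>All naturals serve as letters and as colours: this is type A of infinite rank. Finite
  rank is recovered by restricting the set of colours.\<close>

definition markA :: "nat \<Rightarrow> nat \<Rightarrow> mark option" where
  "markA i x = (if x = i then Some Plus_mark else if x = Suc i then Some Minus_mark else None)"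

interpretation A: word_crystal markA "\<lambda>i _. Suc i" "\<lambda>i _. i"
  by unfold_locales (auto simp: markA_def split: if_splits)

lemma phi_minus_eps_A: "int (phi (markA i) w) - int (eps (markA i) w) = int (count_list w i) - int (count_list w (Suc i))"
proof (induction w)
  case (Cons x w)
  have "int (phi (markA i) [x]) - int (eps (markA i) [x]) = int (count_list [x] i) - int (count_list [x] (Suc i))"
    by (auto simp: markA_def)
  then show ?case using Cons phi_minus_eps_append[of "markA i" "[x]" w] by simp
qed simp

section \<open>Knuth relations and highest weight words of equal weight\<close>

abbreviation eqA (infix "\<approx>" 50) where "eqA \<equiv> A.bis UNIV"

text \<open>Differences of consecutive counts are invariants, so the discrepancy between the words
  is the same for every letter, and it vanishes at a letter beyond those of both words. Here the
  unbounded supply of colours enters.\<close>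

lemma eqA_count:
  assumes "u \<approx> v"
  shows "count_list u i = count_list v i"
proof -
  let ?d = "\<lambda>i. int (count_list u i) - int (count_list v i)"
  have s: "?d i = ?d (Suc i)" for i
    using phi_minus_eps_A[of i u] phi_minus_eps_A[of i v] A.bis_eps_phi[OF assms, of i] by simp
  have "?d i = ?d (i + k)" for k by (induction k) (use s in auto)
  moreover obtain m where "\<forall>x\<in>set u \<union> set v. x < m"
    using finite_nat_set_iff_bounded[of "set u \<union> set v"] by auto
  then have "count_list u (i + m) = 0" "count_list v (i + m) = 0"
    by (metis UnCI count_list_0_iff not_add_less2)+
  ultimately show ?thesis by (metis diff_0_right eq_iff_diff_eq_0 of_nat_0 of_nat_eq_iff)
qed

text \<open>The usual Knuth relations read from right to left: here \<open>i\<close> cancels a later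
  \<open>Suc i\<close>, so the columns are the strictly increasing words.\<close>

inductive knuth :: "nat list \<Rightarrow> nat list \<Rightarrow> bool" where
  "x < y \<Longrightarrow> y \<le> z \<Longrightarrow> knuth [x, z, y] [z, x, y]"
| "x \<le> y \<Longrightarrow> y < z \<Longrightarrow> knuth [y, x, z] [y, z, x]"

text \<open>Kind and orientation of the relation may change: raising with colour \<open>1\<close>
  takes \<open>[1, 2, 2]\<close> and \<open>[2, 1, 2]\<close> to \<open>[1, 2, 1]\<close> and
  \<open>[1, 1, 2]\<close>. Hence the disjunction.\<close>

lemma knuth_act:
  assumes "knuth u v"
  shows "A.act (i, b) u = Some u' \<Longrightarrow> \<exists>v'. A.act (i, b) v = Some v' \<and> (knuth u' v' \<or> knuth v' u')"
    and "A.act (i, b) v = Some v' \<Longrightarrow> \<exists>u'. A.act (i, b) u = Some u' \<and> (knuth u' v' \<or> knuth v' u')"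
  using assms
  by (induction rule: knuth.induct)
    (cases b; force simp: A.act_def markA_def knuth.simps split: if_splits)+

lemma knuth_eqA: "knuth u v \<Longrightarrow> u \<approx> v"
  by (rule A.bis_coinduct[where Z = "\<lambda>u v. knuth u v \<or> knuth v u"]) (use knuth_act in blast)+

lemma eqA_Cons: "u \<approx> v \<Longrightarrow> x # u \<approx> x # v"
  using A.bis_append[of UNIV "[x]" "[x]" u v] by simp

lemma eqA_append_right: "u \<approx> v \<Longrightarrow> u @ w \<approx> v @ w"
  by (simp add: A.bis_append)

lemma eqA_append_left: "u \<approx> v \<Longrightarrow> w @ u \<approx> w @ v"
  by (simp add: A.bis_append)

context
  fixes x y z :: nat
  assumes xy: "x \<le> y" and yz: "y < z"
begin

private abbreviation alt :: "nat \<Rightarrow> nat list" where "alt c \<equiv> concat (replicate c [y, z])"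

private lemma alt_snoc: "alt (Suc c) = alt c @ [y, z]"
  by (induction c) auto

private lemma move_y: "y # alt c \<approx> alt c @ [y]"
proof (induction c)
  case (Suc c)
  have "[y, y, z] \<approx> [y, z, y]" using yz by (intro knuth_eqA knuth.intros) auto
  from eqA_append_right[OF this, of "alt c"] have "y # alt (Suc c) \<approx> [y, z] @ y # alt c" by simp
  also have "[y, z] @ y # alt c \<approx> [y, z] @ alt c @ [y]" by (rule eqA_append_left) (rule Suc)
  finally show ?case by simp
qed simp

private lemma alt_1: "replicate c y @ replicate c z \<approx> alt c"
proof (induction c)
  case (Suc c)
  have "replicate (Suc c) y @ replicate (Suc c) z = y # (replicate c y @ replicate c z) @ [z]"
    by (simp add: replicate_append_same)
  also have "\<dots> \<approx> y # alt c @ [z]" by (intro eqA_Cons eqA_append_right Suc)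
  also have "y # alt c @ [z] = (y # alt c) @ [z]" by simp
  also have "\<dots> \<approx> (alt c @ [y]) @ [z]" by (intro eqA_append_right move_y)
  finally show ?case by (simp only: alt_snoc append.simps append_assoc)
qed simp

private lemma alt_2: "replicate c y @ x # replicate c z \<approx> alt c @ [x]"
proof (induction c)
  case (Suc c)
  have "replicate (Suc c) y @ x # replicate (Suc c) z = y # (replicate c y @ x # replicate c z) @ [z]"
    by (simp add: replicate_append_same)
  also have "\<dots> \<approx> y # (alt c @ [x]) @ [z]" by (intro eqA_Cons eqA_append_right Suc)
  also have "y # (alt c @ [x]) @ [z] = (y # alt c) @ [x, z]" by simp
  also have "\<dots> \<approx> (alt c @ [y]) @ [x, z]" by (intro eqA_append_right move_y)
  also have "(alt c @ [y]) @ [x, z] = alt c @ [y, x, z]" by simp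
  also have "\<dots> \<approx> alt c @ [y, z, x]"
    using xy yz by (intro eqA_append_left knuth_eqA knuth.intros) auto
  finally show ?case by (simp only: alt_snoc append.simps append_assoc)
qed simp

text \<open>The word \<open>[y, z]\<close> repeated \<open>c\<close> times is an intermediate form:
  every \<open>z\<close> has its own \<open>y\<close> on the left there, so that
  \<open>[y, x, z]\<close> can be exchanged for \<open>[y, z, x]\<close>. The bound
  \<open>c \<le> a\<close> supplies enough letters \<open>y\<close>.\<close>

lemma rows_insert:
  assumes "c \<le> a"
  shows "replicate a y @ replicate c z @ [x] \<approx> replicate a y @ x # replicate c z"
proof -
  have a: "replicate a y = replicate (a - c) y @ replicate c y"
    using assms by (metis le_add_diff_inverse2 replicate_add)
  have "replicate c y @ replicate c z @ [x] \<approx> alt c @ [x]"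
    using eqA_append_right[OF alt_1] by simp
  also have "\<dots> \<approx> replicate c y @ x # replicate c z" by (rule A.bis_sym[OF alt_2])
  finally show ?thesis unfolding a by (simp add: eqA_append_left)
qed

end

text \<open>The blocks are the rows of the highest weight tableau of shape \<open>l\<close>; the
  word is the canonical representative of its weight.\<close>

definition rows :: "(nat \<Rightarrow> nat) \<Rightarrow> nat \<Rightarrow> nat list" where
  "rows l m = concat (map (\<lambda>i. replicate (l i) i) [0..<m])"

lemma rows_Suc: "rows l (Suc m) = rows l m @ replicate (l m) m"
  by (simp add: rows_def)

text \<open>The new letter moves left through the blocks of larger letters. Passing the block of
  \<open>m\<close> uses up letters of the block before it, which is at least as long because
  \<open>l\<close> decreases.\<close>

lemma rows_snoc:
  assumes "antimono l" "x < m"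
  shows "rows l m @ [x] \<approx> rows (l(x := Suc (l x))) m"
  using assms(2)
proof (induction m)
  case (Suc m)
  let ?l = "l(x := Suc (l x))"
  have eq: "rows ?l k = rows l k" if "k \<le> x" for k
    using that by (auto simp: rows_def intro!: arg_cong[of _ _ concat])
  show ?case
  proof (cases "x = m")
    case True
    have "rows ?l (Suc m) = rows l m @ m # replicate (l m) m"
      using eq[of m] True by (simp add: rows_Suc del: fun_upd_apply) simp
    moreover have "rows l (Suc m) @ [x] = rows l m @ m # replicate (l m) m"
      by (simp add: True rows_Suc replicate_append_same)
    ultimately show ?thesis by (simp only: A.bis_refl)
  next
    case False
    then obtain k where k: "m = Suc k" "x < m" "x \<le> k" using Suc.prems by (cases m) auto
    have "rows l (Suc m) @ [x] = rows l k @ replicate (l k) k @ replicate (l m) m @ [x]"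
      by (simp add: k rows_Suc)
    also have "\<dots> \<approx> rows l k @ replicate (l k) k @ x # replicate (l m) m"
      using antimonoD[OF assms(1), of k m] k by (intro eqA_append_left rows_insert) auto
    also have "\<dots> = (rows l m @ [x]) @ replicate (l m) m" by (simp add: k rows_Suc)
    also have "\<dots> \<approx> rows ?l m @ replicate (l m) m"
      using k by (intro eqA_append_right Suc.IH)
    also have "rows ?l m @ replicate (l m) m = rows ?l (Suc m)"
      using False by (simp only: rows_Suc fun_upd_other not_sym)
    finally show ?thesis .
  qed
qed simp

lemma hwA_antimono:
  assumes "A.hw UNIV w"
  shows "antimono (count_list w)"
  unfolding antimono_iff_le_Suc
proof
  fix i
  show "count_list w (Suc i) \<le> count_list w i"
    using phi_minus_eps_A[of i w] assms by (simp add: A.hw_def)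
qed

text \<open>Induction on the last letter is possible because prefixes of highest weight words are of
  highest weight, and their letter counts decrease as \<open>rows_snoc\<close> requires.\<close>

lemma hwA_rows:
  "A.hw UNIV w \<Longrightarrow> set w \<subseteq> {..<m} \<Longrightarrow> w \<approx> rows (count_list w) m"
proof (induction w rule: rev_induct)
  case Nil
  have "rows (count_list []) m = []" by (simp add: rows_def)
  then show ?case by (simp only: A.bis_refl)
next
  case (snoc x w)
  have hw: "A.hw UNIV w" by (rule A.hw_append_left) (rule snoc.prems)
  have "w @ [x] \<approx> rows (count_list w) m @ [x]"
    using snoc hw by (intro eqA_append_right) auto
  also have "\<dots> \<approx> rows ((count_list w)(x := Suc (count_list w x))) m"
    using hwA_antimono[OF hw] snoc.prems by (intro rows_snoc) auto
  also have "(count_list w)(x := Suc (count_list w x)) = count_list (w @ [x])"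
    by (auto simp: fun_eq_iff)
  finally show ?case .
qed

lemma hwA_eqA:
  assumes "A.hw UNIV w" "A.hw UNIV w'" "count_list w = count_list w'"
  shows "w \<approx> w'"
proof -
  obtain m where m: "\<forall>x\<in>set w \<union> set w'. x < m"
    using finite_nat_set_iff_bounded[of "set w \<union> set w'"] by auto
  have "w \<approx> rows (count_list w) m" using m by (intro hwA_rows assms) auto
  also have "rows (count_list w) m \<approx> w'"
    unfolding assms(3) using m by (intro A.bis_sym[OF hwA_rows] assms) auto
  finally show ?thesis .
qed

section \<open>Products of columns and uniqueness of the highest weight word\<close>

definition cols :: "nat list \<Rightarrow> nat list" where
  "cols ks = concat (map (\<lambda>k. [0..<k]) ks)"

text \<open>Subtracting the smallest entry \<open>l m\<close> from the first \<open>Suc m\<close>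
  entries splits off \<open>l m\<close> columns of length \<open>Suc m\<close>: the passage to the
  conjugate partition.\<close>

lemma antimono_cols:
  "antimono l \<Longrightarrow> (\<And>i. m \<le> i \<Longrightarrow> l i = 0) \<Longrightarrow> \<exists>ks. count_list (cols ks) = l"
proof (induction m arbitrary: l)
  case 0
  then show ?case by (intro exI[of _ "[]"]) (auto simp: cols_def)
next
  case (Suc m)
  define l' where "l' i = l i - l m" for i
  have am: "l j \<le> l i" if "i \<le> j" for i j using antimonoD[OF Suc.prems(1)] that by blast
  have "antimono l'" by (intro antimonoI) (simp add: l'_def am diff_le_mono)
  moreover have "l' i = 0" if "m \<le> i" for i using am[OF that] by (simp add: l'_def)
  ultimately obtain ks where ks: "count_list (cols ks) = l'" using Suc.IH by blast
  have c: "count_list (cols (replicate c (Suc m))) i = (if i \<le> m then c else 0)" for c i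
  proof (induction c)
    case (Suc c)
    have "count_list [0..<k] i = (if i < k then 1 else 0)" for k by (induction k) auto
    from this[of "Suc m"] show ?case using Suc by (simp add: cols_def del: upt_Suc)
  qed (simp add: cols_def)
  have "count_list (cols (replicate (l m) (Suc m) @ ks)) i = l i" for i
    using c[of "l m" i] ks am[of i m] Suc.prems(2)[of i] by (auto simp: cols_def l'_def fun_eq_iff)
  then show ?case by blast
qed

lemma hwA_upt: "A.hw UNIV [0..<k]"
proof -
  have "eps (markA i) [j..<k] \<le> (if j = Suc i then 1 else 0)" if "j \<le> k" for i j
    using that by (induction j rule: inc_induct) (auto simp: upt_conv_Cons markA_def)
  from this[of 0] show ?thesis by (auto simp: A.hw_def)
qed

lemma hwA_cols: "A.hw UNIV (cols ks)"
  by (induction ks) (use hwA_upt in \<open>auto simp: cols_def A.hw_def eps_append\<close>)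

text \<open>The dangerous case would be to change one of two neighbours \<open>i\<close>,
  \<open>Suc i\<close> into the other; but these cancel each other, as the sign conditions of the
  decomposition record.\<close>

lemma sorted_act:
  assumes "sorted_wrt (<) u" "A.act (i, b) u = Some v"
  shows "sorted_wrt (<) v"
proof (cases b)
  case True
  then obtain a x c where u: "u = a @ x # c" "v = a @ Suc i # c" "x = i" "eps (markA i) c = 0"
    using f_op_decomp[of "markA i" "\<lambda>_. Suc i" u v] assms(2) by (auto simp: A.act_def markA_def split: if_splits)
  have "Suc i \<noteq> hd c" if "c \<noteq> []" using u(4) that by (cases c) (auto simp: markA_def)
  moreover have "i < hd c" if "c \<noteq> []" using that assms(1) u by (auto simp: sorted_wrt_append)
  ultimately have "Suc i < hd c" if "c \<noteq> []" using that by fastforce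
  then show ?thesis using assms(1) u by (cases c) (auto simp: sorted_wrt_append)
next
  case False
  then obtain a x c where u: "v = a @ x # c" "u = a @ Suc i # c" "x = i" "phi (markA i) a = 0"
    using A.e_op_decomp[of i u v] assms(2) by (auto simp: A.act_def markA_def split: if_splits)
  have "i \<noteq> last a" if "a \<noteq> []"
    using u(4) that by (cases a rule: rev_cases) (auto simp: markA_def phi_append)
  then show ?thesis using assms(1) u
    by (cases a rule: rev_cases) (auto simp: sorted_wrt_append less_Suc_eq)
qed

lemma sorted_sum_ge:
  assumes "sorted_wrt (<) (u :: nat list)"
  shows "sum_list [0..<length u] \<le> sum_list u \<and>
    (sum_list u = sum_list [0..<length u] \<longrightarrow> u = [0..<length u])"
  using assms
proof (induction u rule: rev_induct)
  case (snoc x u)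
  have "length u \<le> x" using sorted_wrt_less_idx[OF snoc.prems, of "length u"] by (simp add: nth_append)
  then show ?case using snoc by (auto simp: sorted_wrt_append)
qed simp

text \<open>In a strictly increasing word the letter at index \<open>j\<close> is at least
  \<open>j\<close>. A word in the component of a product of columns is again a product of such
  words, so the sums compare factor by factor.\<close>

lemma cols_sum_ge:
  "A.conn UNIV (cols ks) u \<Longrightarrow>
    sum_list (cols ks) \<le> sum_list u \<and> (sum_list u = sum_list (cols ks) \<longrightarrow> u = cols ks)"
proof (induction ks arbitrary: u)
  case Nil
  then show ?case using A.conn_length by (fastforce simp: cols_def)
next
  case (Cons k ks)
  obtain v w where u: "u = v @ w" "A.conn UNIV [0..<k] v" "A.conn UNIV (cols ks) w"
    using A.conn_append[of UNIV "[0..<k]" "cols ks" u] Cons.prems by (auto simp: cols_def)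
  have "sorted_wrt (<) v"
    using u(2) by (induction rule: A.conn_induct) (auto intro: sorted_act)
  moreover have "length v = k" using A.conn_length[OF u(2)] by simp
  ultimately show ?case using sorted_sum_ge[of v] Cons.IH[OF u(3)]
    by (auto simp: u(1) cols_def)
qed

text \<open>Each word is replaced by a bisimilar product of columns, where the sum of the letters is
  minimal in the component. Exchanging the two words turns the inequality of sums into an equality,
  and the minimum is attained only once.\<close>

lemma hwA_conn_count:
  assumes "A.hw UNIV w" "A.hw UNIV w'" "A.conn UNIV w w'"
  shows "count_list w = count_list w'"
proof -
  have key: "sum_list w \<le> sum_list w' \<and> (sum_list w' = sum_list w \<longrightarrow> count_list w = count_list w')"
    if w: "A.hw UNIV w" "A.conn UNIV w w'" for w w'
  proof -
    obtain m where m: "\<forall>x\<in>set w. x < m"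
      using finite_nat_set_iff_bounded[of "set w"] by auto
    have "\<exists>ks. count_list (cols ks) = count_list w"
      by (rule antimono_cols[OF hwA_antimono[OF w(1)], of m]) (use m in \<open>auto simp: count_list_0_iff\<close>)
    then obtain ks where ks: "count_list (cols ks) = count_list w" by blast
    have eq: "w \<approx> cols ks" using ks by (intro hwA_eqA w hwA_cols) auto
    obtain s where s: "s \<in> lists (UNIV \<times> UNIV)" "A.run s w = Some w'" using w(2) by (auto simp: A.conn_def)
    obtain u' where u': "A.run s (cols ks) = Some u'" "w' \<approx> u'" using A.bis_run[OF eq s] by blast
    have "A.conn UNIV (cols ks) u'" using u' s by (auto simp: A.conn_def)
    note c = cols_sum_ge[OF this]
    have sum: "sum_list u = sum_list v" if "count_list u = count_list v" for u v :: "nat list"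
      using that by (metis count_mset multiset_eqI sum_mset_sum_list)
    have cu: "count_list w' = count_list u'" using eqA_count[OF u'(2)] by blast
    show ?thesis using c sum[OF ks] sum[OF cu] ks cu by auto
  qed
  show ?thesis using key[OF assms(1,3)] key[OF assms(2) A.conn_sym[OF assms(3)]] by auto
qed

text \<open>The prefixes are again connected highest weight words; once they agree, equal counts fix
  the last letter.\<close>

lemma hwA_unique:
  "A.hw UNIV w \<Longrightarrow> A.hw UNIV w' \<Longrightarrow> A.conn UNIV w w' \<Longrightarrow> w = w'"
proof (induction w arbitrary: w' rule: rev_induct)
  case Nil
  then show ?case using A.conn_length by fastforce
next
  case (snoc x u)
  obtain u' v where w': "w' = u' @ v" "A.conn UNIV u u'" "A.conn UNIV [x] v"
    using A.conn_append[OF snoc.prems(3)] by blast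
  obtain x' where v: "v = [x']" using A.conn_length[OF w'(3)] by (cases v) auto
  have "u = u'"
    using snoc.prems w' by (intro snoc.IH) (auto intro: A.hw_append_left)
  moreover have "count_list (u @ [x]) x = count_list w' x"
    using hwA_conn_count[OF snoc.prems] by simp
  ultimately show ?case using w' v by (auto split: if_splits)
qed

section \<open>Type C as a virtual crystal in type A\<close>

lemma map_filter_upt_Suc:
  "List.map_filter (\<lambda>p. map_option (Pair p) (g ((x # w) ! p))) [0..<Suc k] =
    (case g x of None \<Rightarrow> [] | Some m \<Rightarrow> [(0, m)]) @
    map (map_prod Suc id) (List.map_filter (\<lambda>p. map_option (Pair p) (g (w ! p))) [0..<k])"
proof -
  have "List.map_filter (\<lambda>p. map_option (Pair p) (g ((x # w) ! p))) (map Suc l) =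
    map (map_prod Suc id) (List.map_filter (\<lambda>p. map_option (Pair p) (g (w ! p))) l)" for l
    by (induction l) (auto simp: List.map_filter_simps split: option.splits)
  moreover have "[0..<Suc k] = 0 # map Suc [0..<k]" by (simp add: upt_conv_Cons map_Suc_upt del: upt_Suc)
  ultimately show ?thesis by (simp add: List.map_filter_simps del: upt_Suc split: option.splits)
qed

lemma reduce_shift: "reduce (map (map_prod f id) s) = map (map_prod f id) (reduce s)"
proof (induction s)
  case (Cons y s)
  have "reduce_step (map_prod f id y) (map (map_prod f id) t) = map (map_prod f id) (reduce_step y t)" for t
    by (cases "(y, t)" rule: reduce_step.cases) auto
  then show ?case using Cons by (simp only: reduce_def list.map foldr.simps comp_apply)
qed (simp add: reduce_def)

text \<open>The given operator writes at a position of the word, the recursive one descends along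
  it. What happens to a plus placed in front is decided by the shape of the reduced signature, with
  its minus marks first, and by their number.\<close>

lemma reduce_signature:
  "\<exists>ms ps. reduce (signature n i w) = map (\<lambda>p. (p, Minus_mark)) ms @ map (\<lambda>p. (p, Plus_mark)) ps \<and>
    length ms = eps (mark_of n i) w \<and>
    f_op (mark_of n i) (lower n i) w = (case ps of [] \<Rightarrow> None | p # _ \<Rightarrow> Some (w[p := lower n i (w ! p)]))"
proof (induction w)
  case Nil
  then show ?case by (simp add: signature_def reduce_def List.map_filter_simps)
next
  case (Cons x w)
  then obtain ms ps where IH: "reduce (signature n i w) = map (\<lambda>p. (p, Minus_mark)) ms @ map (\<lambda>p. (p, Plus_mark)) ps"
    "length ms = eps (mark_of n i) w"
    "f_op (mark_of n i) (lower n i) w = (case ps of [] \<Rightarrow> None | p # _ \<Rightarrow> Some (w[p := lower n i (w ! p)]))"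
    by blast
  let ?ms = "map Suc ms" and ?ps = "map Suc ps"
  have sig: "signature n i (x # w) = (case mark_of n i x of None \<Rightarrow> [] | Some m \<Rightarrow> [(0, m)]) @
      map (map_prod Suc id) (signature n i w)"
    unfolding signature_def by (simp only: map_filter_upt_Suc list.size(4) add_0_right add_Suc_right One_nat_def)
  have red: "reduce (map (map_prod Suc id) (signature n i w)) =
      map (\<lambda>p. (p, Minus_mark)) ?ms @ map (\<lambda>p. (p, Plus_mark)) ?ps"
    by (simp add: reduce_shift IH(1))
  have f: "map_option ((#) x) (f_op (mark_of n i) (lower n i) w) =
     (case ?ps of [] \<Rightarrow> None | p # _ \<Rightarrow> Some ((x # w)[p := lower n i ((x # w) ! p)]))"
    by (simp add: IH(3) split: list.splits)
  show ?case
  proof (cases "mark_of n i x")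
    case None
    then show ?thesis using IH(2) red f by (intro exI[of _ ?ms] exI[of _ ?ps]) (simp add: sig)
  next
    case (Some m)
    have r: "reduce (signature n i (x # w)) =
        reduce_step (0, m) (map (\<lambda>p. (p, Minus_mark)) ?ms @ map (\<lambda>p. (p, Plus_mark)) ?ps)"
      using red by (simp add: sig Some reduce_def)
    show ?thesis
    proof (cases m)
      case Minus_mark
      then show ?thesis using IH(2) r f Some by (intro exI[of _ "0 # ?ms"] exI[of _ ?ps]) simp
    next
      case Plus_mark
      show ?thesis
      proof (cases ms)
        case Nil
        then have "reduce_step (0, Plus_mark) (map (\<lambda>p. (p, Plus_mark)) ?ps) = map (\<lambda>p. (p, Plus_mark)) (0 # ?ps)"
          by (cases ps) auto
        then show ?thesis using IH(2) r Some Plus_mark Nil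
          by (intro exI[of _ "[]"] exI[of _ "0 # ?ps"]) simp
      next
        case (Cons p ms')
        then show ?thesis using IH(2)[symmetric] r f Some Plus_mark
          by (intro exI[of _ "map Suc ms'"] exI[of _ "?ps"]) simp
      qed
    qed
  qed
qed

lemma kashiwara_f_eq_f_op: "kashiwara_f n i w = f_op (mark_of n i) (lower n i) w"
proof -
  obtain ms ps where r: "reduce (signature n i w) = map (\<lambda>p. (p, Minus_mark)) ms @ map (\<lambda>p. (p, Plus_mark)) ps"
    "f_op (mark_of n i) (lower n i) w = (case ps of [] \<Rightarrow> None | p # _ \<Rightarrow> Some (w[p := lower n i (w ! p)]))"
    using reduce_signature by blast
  have "filter (\<lambda>x. snd x = Plus_mark) (reduce (signature n i w)) = map (\<lambda>p. (p, Plus_mark)) ps"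
    by (simp add: r(1) filter_map comp_def)
  then show ?thesis by (simp add: kashiwara_f_def r(2) split: list.splits)
qed

text \<open>For \<open>i > n\<close> the letter \<open>Plain i\<close> is still marked by
  \<open>mark_of\<close>, although lowering it gives an unmarked letter. Without marks for these
  colours, raising and lowering are inverse for all \<open>i\<close>.\<close>

definition markC :: "nat \<Rightarrow> nat \<Rightarrow> letter \<Rightarrow> mark option" where
  "markC n i x = (if i \<le> n then mark_of n i x else None)"

definition raiseC :: "nat \<Rightarrow> nat \<Rightarrow> letter \<Rightarrow> letter" where
  "raiseC n i x = (if x = Bar i then (if i = n then Plain n else Bar (i + 1)) else Plain i)"

interpretation C: word_crystal "markC n" "lower n" "raiseC n" for n
  by unfold_locales (auto simp: markC_def mark_of_def lower_def raiseC_def split: if_splits)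

lemma markC_eq: "i \<le> n \<Longrightarrow> markC n i = mark_of n i"
  by (simp add: markC_def fun_eq_iff)

text \<open>The letters and colours of type A start at \<open>0\<close>: the bar becomes \<open>x \<mapsto> 2n - 1 - x\<close>, and the colour
  \<open>i\<close> of type C becomes the colours \<open>i - 1\<close> and \<open>2n - 1 - i\<close>.\<close>

fun pos :: "nat \<Rightarrow> letter \<Rightarrow> nat" where
  "pos n (Plain j) = j - 1"
| "pos n (Bar j) = 2 * n - j"

section \<open>The embedding into type A\<close>

definition cocol :: "nat \<Rightarrow> nat \<Rightarrow> nat list" where
  "cocol n d = filter (\<lambda>y. y \<noteq> d) [0..<2 * n]"

text \<open>The first letter stands for the vector representation, the column of
  \<open>2 * n - 1\<close> letters for its dual. Folding the type A diagram with
  \<open>2 * n - 1\<close> nodes sends the first fundamental weight of type C to the sum of the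
  first and the last one of type A.\<close>

definition virt1 :: "nat \<Rightarrow> letter \<Rightarrow> nat list" where
  "virt1 n x = pos n x # cocol n (2 * n - 1 - pos n x)"

definition virt :: "nat \<Rightarrow> letter list \<Rightarrow> nat list" where
  "virt n w = concat (map (virt1 n) w)"

lemma virt_simps [simp]: "virt n [] = []" "virt n (x # w) = virt1 n x @ virt n w"
  "virt n (u @ v) = virt n u @ virt n v"
  by (auto simp: virt_def)

lemma unmarked_A: "c \<notin> set w \<Longrightarrow> Suc c \<notin> set w \<Longrightarrow> eps (markA c) w = 0 \<and> phi (markA c) w = 0"
  by (induction w) (auto simp: markA_def)

text \<open>Neighbours \<open>c\<close>, \<open>Suc c\<close> of a column cancel, so for the colour
  \<open>c\<close> a sign survives only if one of them is the omitted letter.\<close>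

lemma cocol_split:
  assumes "Suc c < 2 * n"
  shows "cocol n c = [0..<c] @ Suc c # [c + 2..<2 * n]" "cocol n (Suc c) = [0..<c] @ c # [c + 2..<2 * n]"
    "\<exists>a b. d \<noteq> c \<longrightarrow> d \<noteq> Suc c \<longrightarrow> cocol n d = a @ [c, Suc c] @ b \<and> c \<notin> set a \<union> set b \<and> Suc c \<notin> set a \<union> set b"
proof -
  have s: "[0..<2 * n] = [0..<c] @ [c, Suc c] @ [c + 2..<2 * n]"
  proof -
    have "[0..<c + (2 * n - c)] = [0..<c] @ [c..<c + (2 * n - c)]" by (rule upt_add_eq_append) simp
    then have "[0..<2 * n] = [0..<c] @ [c..<2 * n]" using assms by simp
    also have "[c..<2 * n] = [c, Suc c] @ [c + 2..<2 * n]" using assms by (simp add: upt_conv_Cons)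
    finally show ?thesis .
  qed
  show "cocol n c = [0..<c] @ Suc c # [c + 2..<2 * n]" "cocol n (Suc c) = [0..<c] @ c # [c + 2..<2 * n]"
    unfolding cocol_def s by (auto simp: filter_id_conv)
  show "\<exists>a b. d \<noteq> c \<longrightarrow> d \<noteq> Suc c \<longrightarrow> cocol n d = a @ [c, Suc c] @ b \<and> c \<notin> set a \<union> set b \<and> Suc c \<notin> set a \<union> set b"
    unfolding cocol_def s by (intro exI[of _ "filter (\<lambda>y. y \<noteq> d) [0..<c]"] exI[of _ "filter (\<lambda>y. y \<noteq> d) [c + 2..<2 * n]"]) auto
qed

lemma cocol_eps_phi:
  assumes "Suc c < 2 * n"
  shows "eps (markA c) (cocol n d) = (if d = c then 1 else 0)" "phi (markA c) (cocol n d) = (if d = Suc c then 1 else 0)"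
proof -
  obtain a b where ab: "d \<noteq> c \<Longrightarrow> d \<noteq> Suc c \<Longrightarrow> cocol n d = a @ [c, Suc c] @ b \<and> c \<notin> set a \<union> set b \<and> Suc c \<notin> set a \<union> set b"
    using cocol_split(3)[OF assms] by blast
  have "eps (markA c) (cocol n d) = (if d = c then 1 else 0) \<and> phi (markA c) (cocol n d) = (if d = Suc c then 1 else 0)"
    using cocol_split(1,2)[OF assms] ab unmarked_A[of c a] unmarked_A[of c b]
      unmarked_A[of c "[0..<c]"] unmarked_A[of c "[c + 2..<2 * n]"]
    by (cases "d = c"; cases "d = Suc c") (auto simp: eps_append phi_append markA_def)
  then show "eps (markA c) (cocol n d) = (if d = c then 1 else 0)" "phi (markA c) (cocol n d) = (if d = Suc c then 1 else 0)"
    by auto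
qed

lemma cocol_f_op:
  assumes "Suc c < 2 * n"
  shows "f_op (markA c) (\<lambda>_. Suc c) (cocol n (Suc c)) = Some (cocol n c)"
  using cocol_split(1,2)[OF assms] unmarked_A[of c "[0..<c]"] unmarked_A[of c "[c + 2..<2 * n]"]
  by (simp add: f_op_append markA_def)

text \<open>Raising undoes the two lowerings in the opposite order. For \<open>i = n\<close> both
  colours are \<open>n - 1\<close>, so the same operator is applied twice.\<close>

definition lift :: "nat \<Rightarrow> nat \<times> bool \<Rightarrow> (nat \<times> bool) list" where
  "lift n a = (let i = fst a in
    if snd a then [(i - 1, True), (2 * n - 1 - i, True)] else [(2 * n - 1 - i, False), (i - 1, False)])"

text \<open>Both type A colours attached to \<open>i\<close> see the same numbers of signs; the
  factor \<open>2\<close> reflects that for \<open>i = n\<close> the two colours coincide.\<close>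

lemma virt1_eps_phi:
  assumes "x \<in> alphabet n" "i \<in> {1..n}" "c \<in> {i - 1, 2 * n - 1 - i}"
  shows "eps (markA c) (virt1 n x) = (if i = n then 2 else 1) * eps (markC n i) [x]"
    and "phi (markA c) (virt1 n x) = (if i = n then 2 else 1) * phi (markC n i) [x]"
proof -
  have "Suc c < 2 * n" using assms by auto
  note e = cocol_eps_phi[OF this]
  obtain j where j: "x = Plain (Suc j) \<or> x = Bar (Suc j)" "j < n"
    using assms(1) by (cases x) (auto simp: alphabet_def dest!: Suc_le_D)
  \<comment> \<open>The parameters \<open>i'\<close>, \<open>k\<close>, \<open>l\<close> remove all
    subtractions: the colours become \<open>i'\<close> and \<open>i' + 2 * k\<close>, and the
    letters \<open>Plain (Suc j)\<close> and \<open>Bar (Suc j)\<close> get the positions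
    \<open>j\<close> and \<open>Suc (i' + k + l)\<close>.\<close>
  obtain i' k where i: "i = Suc i'" "n = Suc (i' + k)"
    using assms(2) by (metis Suc_le_D add_Suc atLeastAtMost_iff le_iff_add One_nat_def)
  obtain l where l: "j + l = i' + k" using j(2) i(2) by (metis less_Suc_eq_le le_iff_add)
  have n2: "2 * n = Suc (j + Suc (i' + k + l))" using l i(2) by simp
  have c: "c = i' \<or> c = i' + 2 * k" using assms(3) i by auto
  have d: "2 * n - 1 - j = Suc (i' + k + l)" "2 * n - Suc j = Suc (i' + k + l)"
    "2 * n - 1 - Suc (i' + k + l) = j"
    "2 * n - Suc (Suc (i' + k + l)) = j" using n2 by auto
  have v: "virt1 n x = (if x = Plain (Suc j) then j # cocol n (Suc (i' + k + l)) else Suc (i' + k + l) # cocol n j)"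
    using j(1) by (auto simp: virt1_def d)
  have x: "markC n i x = (if x = Plain (Suc j) then if j = i' then Some Plus_mark else if k > 0 \<and> j = Suc i' then Some Minus_mark else None
     else if j = i' then Some Minus_mark else if k > 0 \<and> j = Suc i' then Some Plus_mark else None)"
    using j(1) i by (auto simp: markC_def mark_of_def)
  have "Suc (i' + k + l) = c \<longleftrightarrow> c = i' + 2 * k \<and> k > 0 \<and> j = Suc i'" "Suc (i' + k + l) = Suc c \<longleftrightarrow> c = i' + 2 * k \<and> j = i'"
    "j = c \<longleftrightarrow> c = i' \<and> j = i'" "j = Suc c \<longleftrightarrow> c = i' \<and> k > 0 \<and> j = Suc i'" "i = n \<longleftrightarrow> k = 0"
    using c l i by auto
  note eq = this
  have P: "eps (markA c) (p # cocol n d) =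
      (if d = c then if p = c then 0 else if p = Suc c then 2 else 1 else if p = Suc c then 1 else 0)"
    "phi (markA c) (p # cocol n d) = (if d = Suc c then 1 else 0) + (if p = c \<and> d \<noteq> c then 1 else 0)" for p d
    by (auto simp: e markA_def)
  have R: "eps (markC n i) [x] = (if markC n i x = Some Minus_mark then 1 else 0)"
    "phi (markC n i) [x] = (if markC n i x = Some Plus_mark then 1 else 0)"
    by (auto split: option.splits mark.splits)
  have "eps (markA c) (virt1 n x) = (if i = n then 2 else 1) * eps (markC n i) [x] \<and>
    phi (markA c) (virt1 n x) = (if i = n then 2 else 1) * phi (markC n i) [x]"
    unfolding R x eq(5) v if_distrib[of "eps (markA c)"] if_distrib[of "phi (markA c)"] P eq(1-4)
    using c
    by (cases "x = Plain (Suc j)"; cases "k = 0"; cases "j = i'"; cases "j = Suc i'"; cases "c = i'")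
      simp_all
  then show "eps (markA c) (virt1 n x) = (if i = n then 2 else 1) * eps (markC n i) [x]"
    "phi (markA c) (virt1 n x) = (if i = n then 2 else 1) * phi (markC n i) [x]" by auto
qed

text \<open>Truncated differences are compatible with multiplication by a constant, so the tensor
  product rule extends the result from letters to words.\<close>

lemma virt_eps_phi:
  assumes "w \<in> words n" "i \<in> {1..n}" "c \<in> {i - 1, 2 * n - 1 - i}"
  shows "eps (markA c) (virt n w) = (if i = n then 2 else 1) * eps (markC n i) w"
    and "phi (markA c) (virt n w) = (if i = n then 2 else 1) * phi (markC n i) w"
proof -
  have "eps (markA c) (virt n w) = (if i = n then 2 else 1) * eps (markC n i) w \<and>
    phi (markA c) (virt n w) = (if i = n then 2 else 1) * phi (markC n i) w"
    using assms(1)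
  proof (induction w)
    case (Cons x w)
    have "eps (markC n i) (x # w) = eps (markC n i) [x] + (eps (markC n i) w - phi (markC n i) [x])"
      "phi (markC n i) (x # w) = phi (markC n i) w + (phi (markC n i) [x] - eps (markC n i) w)"
      using eps_append[of "markC n i" "[x]" w] phi_append[of "markC n i" "[x]" w] by (simp_all only: append.simps)
    moreover have "x \<in> alphabet n" "w \<in> words n" using Cons.prems by (auto simp: words_def)
    ultimately show ?case using Cons.IH virt1_eps_phi[OF _ assms(2,3), of x]
      by (simp del: eps.simps phi.simps add: eps_append phi_append diff_mult_distrib2)
  qed simp
  then show "eps (markA c) (virt n w) = (if i = n then 2 else 1) * eps (markC n i) w"
    "phi (markA c) (virt n w) = (if i = n then 2 else 1) * phi (markC n i) w" by auto
qed

lemma virt1_lower: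
  assumes "x \<in> alphabet n" "i \<in> {1..n}" "markC n i x = Some Plus_mark"
  shows "A.run [(i - 1, True), (2 * n - 1 - i, True)] (virt1 n x) = Some (virt1 n (lower n i x))"
proof -
  let ?c = "i - 1" and ?c' = "2 * n - 1 - i"
  have c: "Suc ?c < 2 * n" "Suc ?c' < 2 * n" using assms(2) by auto
  note s = cocol_eps_phi[OF c(1)] cocol_eps_phi[OF c(2)]
  consider "x = Plain i" "i = n" | "x = Plain i" "i < n" | "x = Bar (Suc i)" "i < n"
    using assms by (cases "i = n") (auto simp: markC_def mark_of_def split: if_splits)
  then show ?thesis
  proof cases
    case 1
    have "virt1 n x = ?c # cocol n (Suc ?c)" "virt1 n (lower n i x) = Suc ?c # cocol n ?c" "?c' = ?c"
      using 1 assms(2) by (auto simp: virt1_def lower_def Suc_diff_le)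
    then show ?thesis using cocol_f_op[OF c(1)] s by (simp add: A.act_def markA_def)
  next
    case 2
    have "virt1 n x = ?c # cocol n (Suc ?c')" "virt1 n (lower n i x) = Suc ?c # cocol n ?c'"
      using 2 assms(2) by (auto simp: virt1_def lower_def intro!: arg_cong[of _ _ "cocol n"])
    moreover obtain m where "n = Suc (i + m)" using 2 less_iff_Suc_add by blast
    then have "?c' \<noteq> Suc ?c" "?c' \<noteq> ?c" "Suc ?c' \<noteq> Suc ?c" "Suc ?c' \<noteq> ?c" using assms(2) by auto
    ultimately show ?thesis using cocol_f_op[OF c(2)] s by (simp add: A.act_def markA_def)
  next
    case 3
    have "virt1 n x = ?c' # cocol n (Suc ?c)" "virt1 n (lower n i x) = Suc ?c' # cocol n ?c"
      using 3 assms(2) by (auto simp: virt1_def lower_def intro!: arg_cong[of _ _ "cocol n"])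
    moreover obtain m where "n = Suc (i + m)" using 3 less_iff_Suc_add by blast
    then have "?c' \<noteq> Suc ?c" "?c' \<noteq> ?c" "Suc ?c' \<noteq> Suc ?c" "Suc ?c' \<noteq> ?c" using assms(2) by auto
    ultimately show ?thesis using cocol_f_op[OF c(1)] s by (simp add: A.act_def markA_def)
  qed
qed

lemma words_append [simp]: "u @ v \<in> words n \<longleftrightarrow> u \<in> words n \<and> v \<in> words n"
  by (simp add: words_def)

lemma words_Cons [simp]: "x # v \<in> words n \<longleftrightarrow> x \<in> alphabet n \<and> v \<in> words n"
  by (simp add: words_def)

lemma words_Nil [simp]: "[] \<in> words n"
  by (simp add: words_def)

lemma act_words:
  assumes "w \<in> words n" "i \<in> {1..n}" "C.act n (i, b) w = Some w'"
  shows "w' \<in> words n"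
proof (cases b)
  case True
  then obtain a x c where "w = a @ x # c" "w' = a @ lower n i x # c" "markC n i x = Some Plus_mark"
    using f_op_decomp[of "markC n i" "lower n i" w w'] assms(3) by (auto simp: C.act_def)
  moreover have "lower n i x \<in> alphabet n" using assms(2) by (auto simp: alphabet_def lower_def)
  ultimately show ?thesis using assms(1) by simp
next
  case False
  then obtain a x c where "w' = a @ x # c" "w = a @ lower n i x # c" "markC n i x = Some Plus_mark"
    using C.e_op_decomp[of n i w w'] assms(3) by (auto simp: C.act_def)
  moreover have "x \<in> alphabet n"
    using assms(2) calculation(3) by (auto simp: alphabet_def markC_def mark_of_def split: if_splits)
  ultimately show ?thesis using assms(1) by simp
qed

lemma conn_words:
  assumes "C.conn n {1..n} u v" "u \<in> words n"
  shows "v \<in> words n"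
  using assms by (induction rule: C.conn_induct) (auto intro: act_words)

lemma act_middle_A:
  assumes "phi (markA c) a = 0" "eps (markA c) b = 0" "A.act (c, True) y = Some y'"
  shows "A.act (c, True) (a @ y @ b) = Some (a @ y' @ b)"
proof -
  have "phi (markA c) y \<noteq> 0" using assms(3) f_op_None_iff[of "markA c" "\<lambda>_. Suc c" y] by (auto simp: A.act_def)
  then show ?thesis using assms by (simp add: A.act_append)
qed

lemma virt_act:
  assumes w: "w \<in> words n" and i: "i \<in> {1..n}"
  shows "A.run (lift n (i, b)) (virt n w) = map_option (virt n) (C.act n (i, b) w)"
proof -
  let ?c = "i - 1" and ?c' = "2 * n - 1 - i"
  \<comment> \<open>Only lowering is computed; raising follows by inversion. For both type A colours
    the unmatched signs around the changed letter vanish, so both operators act inside one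
    block.\<close>
  have down: "A.run [(?c, True), (?c', True)] (virt n w) = Some (virt n w')"
    if w: "w \<in> words n" and w': "C.act n (i, True) w = Some w'" for w w'
  proof -
    obtain a x b where ax: "w = a @ x # b" "w' = a @ lower n i x # b" "markC n i x = Some Plus_mark"
      "phi (markC n i) a = 0" "eps (markC n i) b = 0"
      using f_op_decomp[of "markC n i" "lower n i" w w'] w' by (auto simp: C.act_def)
    have wab: "a \<in> words n" "b \<in> words n" "x \<in> alphabet n" using w ax(1) by auto
    have z: "phi (markA c) (virt n a) = 0" "eps (markA c) (virt n b) = 0" if "c \<in> {?c, ?c'}" for c
      using virt_eps_phi[OF wab(1) i that] virt_eps_phi[OF wab(2) i that] ax(4,5) by auto
    obtain y where y: "A.act (?c, True) (virt1 n x) = Some y" "A.act (?c', True) y = Some (virt1 n (lower n i x))"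
      using virt1_lower[OF wab(3) i ax(3)] by (auto simp: bind_eq_Some_conv)
    show ?thesis
      using act_middle_A[OF z y(1)] act_middle_A[OF z y(2)] by (simp add: ax(1,2))
  qed
  show ?thesis
  proof (cases b)
    case True
    show ?thesis
    proof (cases "C.act n (i, b) w")
      case None
      then have "phi (markC n i) w = 0" using True f_op_None_iff by (auto simp: C.act_def)
      then have "phi (markA ?c) (virt n w) = 0" using virt_eps_phi[OF w i, of ?c] by simp
      then have "A.act (?c, True) (virt n w) = None" by (simp add: A.act_def f_op_None_iff)
      then show ?thesis using True None by (simp add: lift_def)
    next
      case (Some w')
      then show ?thesis using down[OF w] True by (simp add: lift_def)
    qed
  next
    case False
    show ?thesis
    proof (cases "C.act n (i, b) w")
      case None
      then have "eps (markC n i) w = 0" using False e_op_None_iff by (auto simp: C.act_def)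
      then have "eps (markA ?c') (virt n w) = 0" using virt_eps_phi[OF w i, of ?c'] by simp
      then have "A.act (?c', False) (virt n w) = None" by (simp add: A.act_def e_op_None_iff)
      then show ?thesis using False None by (simp add: lift_def)
    next
      case (Some w')
      have "w' \<in> words n" by (rule act_words[OF w i Some])
      moreover have "C.act n (i, True) w' = Some w" using C.act_inverse[of n i b w w'] Some False by simp
      ultimately obtain y where y: "A.act (?c, True) (virt n w') = Some y" "A.act (?c', True) y = Some (virt n w)"
        using down[of w' w] by (auto simp: bind_eq_Some_conv)
      have "A.act (?c', False) (virt n w) = Some y" "A.act (?c, False) y = Some (virt n w')"
        using y A.act_inverse[of ?c' True y "virt n w"] A.act_inverse[of ?c True "virt n w'" y] by simp_all
      then show ?thesis using False Some by (simp add: lift_def)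
    qed
  qed
qed

lemma virt_conn:
  assumes "C.conn n {1..n} u v" "u \<in> words n"
  shows "A.conn UNIV (virt n u) (virt n v)"
  using assms(1)
proof (induction rule: C.conn_induct)
  case refl
  show ?case by simp
next
  case (step v w i b)
  have "A.run (lift n (i, b)) (virt n v) = Some (virt n w)"
    using virt_act[OF conn_words[OF step.hyps(1) assms(2)] step.hyps(2), of b] step.hyps(3) by simp
  then have "A.conn UNIV (virt n v) (virt n w)"
    unfolding A.conn_def by (intro bexI) auto
  then show ?case using step.IH by (rule A.conn_trans[rotated])
qed

section \<open>Transfer of the two facts on highest weight words to type C\<close>

lemma pos_less: "x \<in> alphabet n \<Longrightarrow> pos n x < 2 * n"
  by (auto simp: alphabet_def)

lemma set_virt: "w \<in> words n \<Longrightarrow> set (virt n w) \<subseteq> {..<2 * n}"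
  by (induction w) (auto simp: virt1_def cocol_def dest: pos_less)

lemma virt_hw:
  assumes "C.hw n {1..n} w" "w \<in> words n"
  shows "A.hw UNIV (virt n w)"
proof -
  have "eps (markA c) (virt n w) = 0" for c
  proof (cases "Suc c < 2 * n")
    case True
    \<comment> \<open>The type C colour to which \<open>c\<close> is attached: the left half of the
      diagram gives \<open>i - 1\<close>, the right half \<open>2 * n - 1 - i\<close>.\<close>
    define i where "i = (if c < n then Suc c else 2 * n - 1 - c)"
    have "i \<in> {1..n}" "c \<in> {i - 1, 2 * n - 1 - i}" using True by (auto simp: i_def)
    then show ?thesis using virt_eps_phi(1)[OF assms(2)] assms(1) by (auto simp: C.hw_def)
  next
    case False
    have "set w \<subseteq> {..<2 * n} \<Longrightarrow> eps (markA c) w = 0" for w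
      using False by (induction w) (auto simp: markA_def)
    then show ?thesis using set_virt[OF assms(2)] by blast
  qed
  then show ?thesis by (simp add: A.hw_def)
qed

text \<open>All letters become blocks of the same length \<open>2 * n\<close>, so equal images agree
  block by block, and the first entry of a block determines the letter.\<close>

lemma virt_inj: "u \<in> words n \<Longrightarrow> v \<in> words n \<Longrightarrow> virt n u = virt n v \<Longrightarrow> u = v"
proof (induction u arbitrary: v)
  case Nil
  then show ?case by (cases v) (auto simp: virt1_def)
next
  case (Cons x u)
  then obtain y v' where v: "v = y # v'" by (cases v) (auto simp: virt1_def)
  have "length (virt1 n x) = 2 * n" if "x \<in> alphabet n" for x
  proof -
    have "length (cocol n d) = 2 * n - 1" if "d < 2 * n" for d
    proof -
      have "(\<lambda>y. y \<noteq> d) = (\<noteq>) d" by auto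
      then have "cocol n d = remove1 d [0..<2 * n]"
        by (simp add: cocol_def distinct_remove1_removeAll removeAll_filter_not_eq)
      then show ?thesis using that by (simp add: length_remove1)
    qed
    then show ?thesis using pos_less[OF that] by (simp add: virt1_def)
  qed
  then have "virt1 n x = virt1 n y" "virt n u = virt n v'" using Cons.prems v by auto
  moreover from this(1) have "x = y"
    using Cons.prems v by (auto simp: virt1_def alphabet_def)
  ultimately show ?case using Cons v by auto
qed

lemma hwC_unique:
  assumes "C.hw n {1..n} u" "C.hw n {1..n} v" "C.conn n {1..n} u v" "u \<in> words n"
  shows "u = v"
  by (rule virt_inj[OF assms(4) conn_words[OF assms(3,4)]], rule hwA_unique)
    (use assms conn_words[OF assms(3,4)] in \<open>auto intro: virt_hw virt_conn\<close>)

text \<open>A column of all \<open>2 * n\<close> letters is trivial for these colours. The colour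
  \<open>2 * n - 1\<close> would see the last letter unmatched, which is why the set of colours is
  cut off.\<close>

lemma full_columns_trivial: "A.bis {..<2 * n - 1} (concat (replicate k [0..<2 * n])) []"
proof -
  have e: "eps (markA c) [0..<2 * n] = 0 \<and> phi (markA c) [0..<2 * n] = 0" if "c < 2 * n - 1" for c
  proof -
    have "[0..<2 * n] = cocol n (2 * n)" by (auto simp: cocol_def filter_id_conv)
    then show ?thesis using cocol_eps_phi[of c n "2 * n"] that by auto
  qed
  have e: "eps (markA c) (concat (replicate k [0..<2 * n])) = 0 \<and> phi (markA c) (concat (replicate k [0..<2 * n])) = 0"
    if "c < 2 * n - 1" for c
    using e[OF that] by (induction k) (auto simp: eps_append phi_append)
  show ?thesis
  proof (rule A.bis_coinduct[where Z = "\<lambda>u v. \<forall>c<2 * n - 1. eps (markA c) u = 0 \<and> phi (markA c) u = 0 \<and> eps (markA c) v = 0 \<and> phi (markA c) v = 0"])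
    fix u v :: "nat list" and i b u'
    assume z: "\<forall>c<2 * n - 1. eps (markA c) u = 0 \<and> phi (markA c) u = 0 \<and> eps (markA c) v = 0 \<and> phi (markA c) v = 0"
      and i: "i \<in> {..<2 * n - 1}" and a: "A.act (i, b) u = Some u'"
    have "A.act (i, b) u = None" using z i f_op_None_iff[of "markA i" "\<lambda>_. Suc i" u] e_op_None_iff[of "markA i" "\<lambda>_. i" u]
      by (auto simp: A.act_def)
    then show "\<exists>v'. A.act (i, b) v = Some v' \<and> (\<forall>c<2 * n - 1. eps (markA c) u' = 0 \<and> phi (markA c) u' = 0 \<and> eps (markA c) v' = 0 \<and> phi (markA c) v' = 0)"
      using a by simp
  qed (use e in auto)
qed

lemma virt_bis:
  assumes "u \<in> words n" "v \<in> words n" "A.bis {..<2 * n - 1} (virt n u) (virt n v)"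
  shows "C.bis n {1..n} u v"
proof (rule C.bis_coinduct[where Z = "\<lambda>u v. u \<in> words n \<and> v \<in> words n \<and> A.bis {..<2 * n - 1} (virt n u) (virt n v)"])
  fix u v i b u'
  assume *: "u \<in> words n \<and> v \<in> words n \<and> A.bis {..<2 * n - 1} (virt n u) (virt n v)"
    and i: "i \<in> {1..n}" and u': "C.act n (i, b) u = Some u'"
  have "lift n (i, b) \<in> lists ({..<2 * n - 1} \<times> UNIV)" using i by (auto simp: lift_def)
  moreover have "A.run (lift n (i, b)) (virt n u) = Some (virt n u')" using virt_act[of u n i b] * i u' by simp
  ultimately obtain y where y: "A.run (lift n (i, b)) (virt n v) = Some y" "A.bis {..<2 * n - 1} (virt n u') y"
    using A.bis_run[of "{..<2 * n - 1}" "virt n u" "virt n v"] * by blast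
  then obtain v' where "C.act n (i, b) v = Some v'" "y = virt n v'"
    using virt_act[of v n i b] * i by (cases "C.act n (i, b) v") auto
  then show "\<exists>v'. C.act n (i, b) v = Some v' \<and> u' \<in> words n \<and> v' \<in> words n \<and> A.bis {..<2 * n - 1} (virt n u') (virt n v')"
    using y(2) * i u' by (auto intro: act_words)
qed (use assms in \<open>auto intro: A.bis_sym\<close>)

text \<open>The type C data fix only the differences of consecutive letter counts of the images.
  Prepending columns of all letters equalises the counts and has no effect on the colours below
  \<open>2 * n - 1\<close>.\<close>

lemma hwC_bis:
  assumes hw: "C.hw n {1..n} u" "C.hw n {1..n} v" and w: "u \<in> words n" "v \<in> words n"
    and phi: "\<And>i. i \<in> {1..n} \<Longrightarrow> phi (markC n i) u = phi (markC n i) v"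
  shows "C.bis n {1..n} u v"
proof -
  have main: "A.bis {..<2 * n - 1} (virt n u) (virt n v)"
    if hw: "C.hw n {1..n} u" "C.hw n {1..n} v" and w: "u \<in> words n" "v \<in> words n"
    and phi: "\<And>i. i \<in> {1..n} \<Longrightarrow> phi (markC n i) u = phi (markC n i) v"
    and le: "count_list (virt n u) 0 \<le> count_list (virt n v) 0" for u v
  proof -
    \<comment> \<open>The type A weights of the two images may differ by full columns.\<close>
    define k where "k = count_list (virt n v) 0 - count_list (virt n u) 0"
    let ?p = "concat (replicate k [0..<2 * n])"
    have step: "int (count_list (virt n v) c) - int (count_list (virt n u) c) =
        int (count_list (virt n v) (Suc c)) - int (count_list (virt n u) (Suc c))" if "Suc c < 2 * n" for c
    proof -
      define i where "i = (if c < n then Suc c else 2 * n - 1 - c)"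
      have i: "i \<in> {1..n}" "c \<in> {i - 1, 2 * n - 1 - i}" using that by (auto simp: i_def)
      show ?thesis
        using phi_minus_eps_A[of c "virt n u"] phi_minus_eps_A[of c "virt n v"] virt_eps_phi[OF w(1) i] virt_eps_phi[OF w(2) i]
          phi[OF i(1)] hw i(1) by (simp add: C.hw_def)
    qed
    have c: "int (count_list (virt n v) c) - int (count_list (virt n u) c) = int k" if "c < 2 * n" for c
      using that by (induction c) (use step le in \<open>auto simp: k_def\<close>)
    have p: "count_list ?p c = (if c < 2 * n then k else 0)" for c
    proof -
      have "count_list [0..<m] c = (if c < m then 1 else 0)" for m by (induction m) auto
      then show ?thesis by (induction k) auto
    qed
    have "count_list (?p @ virt n u) c = count_list (virt n v) c" for c
    proof (cases "c < 2 * n")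
      case True
      then show ?thesis using c[OF True] p[of c] by simp
    next
      case False
      then have "count_list (virt n u) c = 0" "count_list (virt n v) c = 0"
        unfolding count_list_0_iff using set_virt[OF w(1)] set_virt[OF w(2)] by auto
      then show ?thesis using p[of c] False by simp
    qed
    moreover have "A.hw UNIV (?p @ virt n u)"
    proof -
      have "?p = cols (replicate k (2 * n))" by (simp add: cols_def)
      then show ?thesis using hwA_cols[of "replicate k (2 * n)"] virt_hw[OF hw(1) w(1)]
        by (simp add: A.hw_def eps_append)
    qed
    ultimately have "?p @ virt n u \<approx> virt n v"
      using virt_hw[OF hw(2) w(2)] by (intro hwA_eqA) auto
    then have "A.bis {..<2 * n - 1} (?p @ virt n u) (virt n v)" unfolding A.bis_def by auto
    moreover have "A.bis {..<2 * n - 1} (?p @ virt n u) ([] @ virt n u)"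
      by (intro A.bis_append full_columns_trivial A.bis_refl)
    ultimately show ?thesis using A.bis_sym A.bis_trans by (metis append_Nil)
  qed
  show ?thesis
  proof (cases "count_list (virt n u) 0 \<le> count_list (virt n v) 0")
    case True
    then show ?thesis using assms by (intro virt_bis main) auto
  next
    case False
    then show ?thesis using assms by (intro virt_bis A.bis_sym[OF main]) auto
  qed
qed

section \<open>The dominant weight of a class\<close>

lemma (in word_crystal) run_inj: "run s u = Some z \<Longrightarrow> run s v = Some z \<Longrightarrow> u = v"
proof (induction s arbitrary: u v)
  case (Cons a s)
  obtain u' v' where "act a u = Some u'" "run s u' = Some z" "act a v = Some v'" "run s v' = Some z"
    using Cons.prems by (auto simp: bind_eq_Some_conv)
  then show ?case using Cons.IH act_inverse[of "fst a" "snd a"] by (metis option.inject prod.collapse)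
qed simp

abbreviation connC where "connC n \<equiv> C.conn n {1..n}"
abbreviation bisC where "bisC n \<equiv> C.bis n {1..n}"
abbreviation hwC where "hwC n \<equiv> C.hw n {1..n}"

text \<open>The pairing of the weight of a letter with half the sum of the positive roots, which has
  the coordinates \<open>n\<close>, ..., \<open>2\<close>, \<open>1\<close>. The simple roots have
  height \<open>1\<close>, except the last one, which has height \<open>2\<close>.\<close>

fun letter_height :: "nat \<Rightarrow> letter \<Rightarrow> int" where
  "letter_height n (Plain j) = int n + 1 - int j"
| "letter_height n (Bar j) = int j - int n - 1"

definition height :: "nat \<Rightarrow> letter list \<Rightarrow> int" where
  "height n w = sum_list (map (letter_height n) w)"

lemma height_append [simp]: "height n (u @ v) = height n u + height n v"
  by (simp add: height_def)

lemma height_act: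
  assumes "C.act n (i, False) w = Some w'" "i \<in> {1..n}"
  shows "height n w < height n w'"
proof -
  obtain a x c where "w' = a @ x # c" "w = a @ lower n i x # c" "markC n i x = Some Plus_mark"
    using C.e_op_decomp[of n i w w'] assms(1) by (auto simp: C.act_def)
  then show ?thesis using assms(2)
    by (auto simp: height_def markC_def mark_of_def lower_def split: if_splits)
qed

lemma height_le: "w \<in> words n \<Longrightarrow> height n w \<le> int n * int (length w)"
proof (induction w)
  case (Cons x w)
  then have "letter_height n x \<le> int n" by (auto simp: alphabet_def)
  then show ?case using Cons by (auto simp: height_def algebra_simps)
qed (simp add: height_def)

text \<open>Raising increases the height and keeps the length, which bounds the height; so raising
  terminates.\<close>

lemma raise_induct [consumes 1, case_names step]:
  assumes "w \<in> words n"
    and "\<And>w. w \<in> words n \<Longrightarrow>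
      (\<And>i w'. i \<in> {1..n} \<Longrightarrow> C.act n (i, False) w = Some w' \<Longrightarrow> w' \<in> words n \<Longrightarrow> P w') \<Longrightarrow> P w"
  shows "P w"
  using assms(1)
proof (induction "nat (int n * int (length w) - height n w)" arbitrary: w rule: less_induct)
  case less
  show ?case
  proof (rule assms(2)[OF less.prems])
    fix i w' assume *: "i \<in> {1..n}" "C.act n (i, False) w = Some w'" "w' \<in> words n"
    show "P w'"
      using height_act[OF *(2,1)] height_le[OF *(3)] C.act_length[OF *(2)] *(3) by (intro less.hyps) auto
  qed
qed

lemma ex_hwC:
  assumes "w \<in> words n"
  shows "\<exists>v. connC n w v \<and> hwC n v \<and> height n w \<le> height n v \<and> (height n w = height n v \<longrightarrow> w = v)"
  using assms
proof (induction rule: raise_induct)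
  case (step w)
  show ?case
  proof (cases "hwC n w")
    case True
    then show ?thesis by (intro exI[of _ w]) simp
  next
    case False
    then obtain i w' where i: "i \<in> {1..n}" "C.act n (i, False) w = Some w'" by (auto simp: C.hw_act)
    have w': "w' \<in> words n" "connC n w w'" "height n w < height n w'"
      using act_words[OF step.hyps(1) i] C.conn_act[OF i] height_act[OF i(2,1)] by auto
    obtain v where "connC n w' v" "hwC n v" "height n w' \<le> height n v" using step(2)[OF i w'(1)] by blast
    then show ?thesis using w' by (intro exI[of _ v]) (auto intro: C.conn_trans)
  qed
qed

section \<open>The highest weight word of a component and its weight\<close>

definition hwof :: "nat \<Rightarrow> letter list \<Rightarrow> letter list" where
  "hwof n w = (THE v. connC n w v \<and> hwC n v)"

lemma hwof_eqI:
  assumes "w \<in> words n" "connC n w v" "hwC n v"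
  shows "hwof n w = v"
  unfolding hwof_def
proof (rule the_equality)
  fix v' assume v': "connC n w v' \<and> hwC n v'"
  show "v' = v"
    using v' assms conn_words[of n w v'] C.conn_trans[OF C.conn_sym[of n "{1..n}" w v'], of v]
    by (intro hwC_unique[of n v' v]) simp_all
qed (use assms in simp)

lemma hwof:
  assumes "w \<in> words n"
  shows "connC n w (hwof n w)" "hwC n (hwof n w)" "hwof n w \<in> words n" "height n w \<le> height n (hwof n w)"
    "height n w = height n (hwof n w) \<Longrightarrow> hwof n w = w"
proof -
  obtain v where v: "connC n w v" "hwC n v" "height n w \<le> height n v" "height n w = height n v \<longrightarrow> w = v"
    using ex_hwC[OF assms] by blast
  have "hwof n w = v" using hwof_eqI[OF assms v(1,2)] .
  then show "connC n w (hwof n w)" "hwC n (hwof n w)" "hwof n w \<in> words n" "height n w \<le> height n (hwof n w)"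
    "height n w = height n (hwof n w) \<Longrightarrow> hwof n w = w"
    using v conn_words[OF v(1) assms] by auto
qed

lemma hwof_conn: "u \<in> words n \<Longrightarrow> connC n u v \<Longrightarrow> hwof n v = hwof n u"
  using hwof[of u n] conn_words[of n u v] C.conn_trans[OF C.conn_sym[of n "{1..n}" u v], of "hwof n u"]
  by (intro hwof_eqI) simp_all

lemma hwof_hw: "u \<in> words n \<Longrightarrow> hwC n u \<Longrightarrow> hwof n u = u"
  by (intro hwof_eqI) auto

text \<open>The coefficients of the dominant weight in the fundamental weights. The value
  \<open>0\<close> outside the colours lets weights be compared as functions.\<close>

definition hw_wt :: "nat \<Rightarrow> letter list \<Rightarrow> nat \<Rightarrow> nat" where
  "hw_wt n w i = (if i \<in> {1..n} then phi (markC n i) (hwof n w) else 0)"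

lemma hw_wt_conn: "u \<in> words n \<Longrightarrow> connC n u v \<Longrightarrow> hw_wt n v = hw_wt n u"
  using hwof_conn[of u n v] by (simp add: hw_wt_def fun_eq_iff)

lemma bis_transport:
  assumes "bisC n u v" "connC n u u'"
  shows "\<exists>v'. connC n v v' \<and> bisC n u' v'"
  using assms(2) C.bis_run[OF assms(1)] unfolding C.conn_def by blast

lemma bis_hwof:
  assumes "bisC n u v" "u \<in> words n" "v \<in> words n"
  shows "bisC n (hwof n u) (hwof n v)"
proof -
  obtain v' where v': "connC n v v'" "bisC n (hwof n u) v'"
    using bis_transport[OF assms(1) hwof(1)[OF assms(2)]] by blast
  have "hwC n v'" using C.bis_hw[OF v'(2) hwof(2)[OF assms(2)]] .
  then show ?thesis using hwof_eqI[OF assms(3) v'(1)] v'(2) by simp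
qed

lemma bis_hw_wt: "bisC n u v \<Longrightarrow> u \<in> words n \<Longrightarrow> v \<in> words n \<Longrightarrow> hw_wt n u = hw_wt n v"
  using C.bis_eps_phi(2)[OF bis_hwof] by (auto simp: hw_wt_def fun_eq_iff)

lemma hw_wt_bis:
  assumes "u \<in> words n" "v \<in> words n" "hw_wt n u = hw_wt n v"
  shows "bisC n (hwof n u) (hwof n v)"
proof (rule hwC_bis)
  fix i assume "i \<in> {1..n}"
  then show "phi (markC n i) (hwof n u) = phi (markC n i) (hwof n v)"
    using fun_cong[OF assms(3), of i] by (simp add: hw_wt_def)
qed (use assms hwof in auto)

lemma hw_wt_transport:
  assumes "u \<in> words n" "v \<in> words n" "hw_wt n u = hw_wt n v"
  shows "\<exists>z. connC n (hwof n v) z \<and> bisC n u z"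
  using bis_transport[OF hw_wt_bis[OF assms] C.conn_sym[OF hwof(1)[OF assms(1)]]] .

text \<open>A string that takes one word to the top takes the other one to a highest weight word
  too, by uniqueness the same, and strings are injective.\<close>

lemma bis_conn_eq:
  assumes "bisC n u v" "connC n u v" "u \<in> words n"
  shows "u = v"
proof -
  have v: "v \<in> words n" using conn_words assms by blast
  obtain s where s: "s \<in> lists ({1..n} \<times> UNIV)" "C.run n s u = Some (hwof n u)"
    using hwof(1)[OF assms(3)] by (auto simp: C.conn_def)
  obtain z where z: "C.run n s v = Some z" "bisC n (hwof n u) z" using C.bis_run[OF assms(1) s] by blast
  have "connC n v z" using z s by (auto simp: C.conn_def)
  then have "hwof n v = z" using C.bis_hw[OF z(2)] hwof[OF assms(3)] v by (intro hwof_eqI) auto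
  then have "z = hwof n u" using hwof_conn[OF assms(3,2)] by simp
  then show ?thesis using C.run_inj s z by blast
qed

section \<open>Highest weights of products\<close>

lemma hw_append_hw: "hwC n u \<Longrightarrow> hwC n v \<Longrightarrow> hwC n (u @ v)"
  by (simp add: C.hw_def eps_append)

text \<open>On the way to the top the left factor reaches its own top, since prefixes of highest
  weight words are of highest weight; the right factor is only known to stay in its
  component.\<close>

lemma hwof_append_split:
  assumes "u \<in> words n" "v \<in> words n"
  shows "\<exists>v'. hwof n (u @ v) = hwof n u @ v' \<and> connC n v v'"
proof -
  have uv: "u @ v \<in> words n" using assms by simp
  obtain u' v' where w: "hwof n (u @ v) = u' @ v'" "connC n u u'" "connC n v v'"
    using C.conn_append[OF hwof(1)[OF uv]] by blast
  have "hwC n u'" using hwof(2)[OF uv] w(1) C.hw_append_left by metis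
  then show ?thesis using hwof_eqI[OF assms(1) w(2)] w by auto
qed

text \<open>In a component only the highest weight word has the largest height, so equality of
  heights leaves no choice for the right factor.\<close>

lemma height_hwof_append:
  assumes "u \<in> words n" "v \<in> words n"
  shows "height n (hwof n (u @ v)) \<le> height n (hwof n u) + height n (hwof n v)"
    and "height n (hwof n (u @ v)) = height n (hwof n u) + height n (hwof n v) \<Longrightarrow>
      hwof n (u @ v) = hwof n u @ hwof n v"
proof -
  obtain v' where v': "hwof n (u @ v) = hwof n u @ v'" "connC n v v'" using hwof_append_split[OF assms] by blast
  have w: "v' \<in> words n" "hwof n v' = hwof n v" using conn_words[OF v'(2) assms(2)] hwof_conn[OF assms(2) v'(2)] by auto
  show "height n (hwof n (u @ v)) \<le> height n (hwof n u) + height n (hwof n v)"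
    using v'(1) hwof(4)[OF w(1)] w(2) by simp
  show "height n (hwof n (u @ v)) = height n (hwof n u) + height n (hwof n v) \<Longrightarrow>
      hwof n (u @ v) = hwof n u @ hwof n v"
    using v'(1) hwof(5)[OF w(1)] w(2) by simp
qed

text \<open>The height of the fundamental weight of \<open>i\<close>, which is the weight of the
  word of the letters from \<open>1\<close> to \<open>i\<close>.\<close>

definition ht_coeff :: "nat \<Rightarrow> nat \<Rightarrow> nat" where
  "ht_coeff n i = (\<Sum>j = 1..i. n + 1 - j)"

lemma height_phi_eps:
  "w \<in> words n \<Longrightarrow>
    height n w = (\<Sum>i = 1..n. int (ht_coeff n i) * (int (phi (markC n i) w) - int (eps (markC n i) w)))"
proof (induction w)
  case (Cons x w)
  have d: "int (phi (markC n i) (x # w)) - int (eps (markC n i) (x # w)) =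
      (int (phi (markC n i) [x]) - int (eps (markC n i) [x])) + (int (phi (markC n i) w) - int (eps (markC n i) w))" for i
    using phi_minus_eps_append[of "markC n i" "[x]" w] by (simp only: append.simps)
  have c: "int (ht_coeff n (Suc i)) = int (ht_coeff n i) + int n - int i" if "i < n" for i
    using that by (simp add: ht_coeff_def)
  have "letter_height n x = (\<Sum>i = 1..n. int (ht_coeff n i) * (int (phi (markC n i) [x]) - int (eps (markC n i) [x])))"
  proof -
    obtain j where j: "1 \<le> j" "j \<le> n" "x = Plain j \<or> x = Bar j"
      using Cons.prems unfolding words_Cons alphabet_def by fastforce
    define s :: int where "s = (if x = Plain j then 1 else -1)"
    \<comment> \<open>The weight of \<open>Plain j\<close> is the difference of the fundamental
      weights of \<open>j\<close> and \<open>j - 1\<close>, that of \<open>Bar j\<close> its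
      negative. For \<open>j = 1\<close> there is no second one, in accordance with
      \<open>ht_coeff n 0 = 0\<close>.\<close>
    have "int (phi (markC n i) [x]) - int (eps (markC n i) [x]) = (if i = j then s else 0) - (if i = j - 1 then s else 0)"
      if "i \<in> {1..n}" for i
      using j(3)
    proof
      assume "x = Plain j"
      then show ?thesis using that j by (auto simp: s_def markC_def mark_of_def)
    next
      assume "x = Bar j"
      then show ?thesis using that j by (auto simp: s_def markC_def mark_of_def)
    qed
    then have "(\<Sum>i = 1..n. int (ht_coeff n i) * (int (phi (markC n i) [x]) - int (eps (markC n i) [x]))) =
        (\<Sum>i = 1..n. int (ht_coeff n i) * ((if i = j then s else 0) - (if i = j - 1 then s else 0)))"
      by (intro sum.cong refl arg_cong2[of _ _ _ _ "(*)"])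
    also have "\<dots> = (\<Sum>i = 1..n. int (ht_coeff n i) * (if i = j then s else 0)) - (\<Sum>i = 1..n. int (ht_coeff n i) * (if i = j - 1 then s else 0))"
      by (simp only: right_diff_distrib sum_subtractf)
    also have "\<dots> = int (ht_coeff n j) * s - int (ht_coeff n (j - 1)) * s"
    proof -
      have "(\<Sum>i = 1..n. int (ht_coeff n i) * (if i = j then s else 0)) = int (ht_coeff n j) * s"
        using j by (subst sum.remove[of _ j]) auto
      moreover have "(\<Sum>i = 1..n. int (ht_coeff n i) * (if i = j - 1 then s else 0)) = int (ht_coeff n (j - 1)) * s"
      proof (cases "j = 1")
        case True
        then show ?thesis by (auto simp: ht_coeff_def intro!: sum.neutral)
      next
        case False
        then show ?thesis using j by (subst sum.remove[of _ "j - 1"]) auto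
      qed
      ultimately show ?thesis by simp
    qed
    also have "int (ht_coeff n j) = int (ht_coeff n (j - 1)) + (int n + 1 - int j)"
      using c[of "j - 1"] j by (cases j) simp_all
    also have "\<dots> * s - int (ht_coeff n (j - 1)) * s = (int n + 1 - int j) * s" by (simp add: algebra_simps)
    also have "\<dots> = letter_height n x" using j by (auto simp: s_def)
    finally show ?thesis by simp
  qed
  then show ?case
    unfolding d using Cons by (simp add: height_def distrib_left sum.distrib)
qed (simp add: height_def)

lemma height_hw_wt:
  assumes "w \<in> words n"
  shows "height n (hwof n w) = int (\<Sum>i = 1..n. ht_coeff n i * hw_wt n w i)"
  using height_phi_eps[OF hwof(3)[OF assms]] hwof(2)[OF assms] by (simp add: C.hw_def hw_wt_def)

text \<open>Additivity of the weight gives additivity of the height, and this already forces the top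
  of the product to be the product of the tops.\<close>

lemma hwof_append_iff:
  assumes "u \<in> words n" "v \<in> words n"
  shows "hwof n (u @ v) = hwof n u @ hwof n v \<longleftrightarrow> hw_wt n (u @ v) = (\<lambda>i. hw_wt n u i + hw_wt n v i)"
proof
  assume "hwof n (u @ v) = hwof n u @ hwof n v"
  then show "hw_wt n (u @ v) = (\<lambda>i. hw_wt n u i + hw_wt n v i)"
    using hwof(2)[OF assms(1)] hwof(2)[OF assms(2)] by (auto simp: hw_wt_def phi_append C.hw_def fun_eq_iff)
next
  assume l: "hw_wt n (u @ v) = (\<lambda>i. hw_wt n u i + hw_wt n v i)"
  have "height n (hwof n (u @ v)) = height n (hwof n u) + height n (hwof n v)"
    using assms by (simp add: height_hw_wt l distrib_left sum.distrib)
  then show "hwof n (u @ v) = hwof n u @ hwof n v" by (rule height_hwof_append(2)[OF assms])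
qed

text \<open>Otherwise the last raising step on the way to \<open>b @ c\<close> would act on the right factor, so its
  colour \<open>i\<close> would satisfy \<open>phi b = 0\<close> and \<open>phi c > 0\<close>.\<close>

lemma cartan_rigid:
  assumes b: "hwC n b" and c: "hwC n c" and supp: "\<And>i. i \<in> {1..n} \<Longrightarrow> 0 < phi (markC n i) c \<Longrightarrow> 0 < phi (markC n i) b"
    and w: "b \<in> words n" "c' \<in> words n" and conn: "connC n (b @ c') (b @ c)"
  shows "c' = c"
  using w(2) conn
proof (induction rule: raise_induct)
  case (step c')
  show ?case
  proof (cases "hwC n (b @ c')")
    case True
    have "b @ c' = b @ c"
      using True hw_append_hw[OF b c] step.prems step.hyps(1) w by (intro hwC_unique) auto
    then show ?thesis by simp
  next
    case False
    then obtain i y where i: "i \<in> {1..n}" "C.act n (i, False) (b @ c') = Some y" by (auto simp: C.hw_act)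
    have "C.act n (i, False) b = None" using b i(1) by (auto simp: C.hw_act)
    then obtain c'' where c'': "C.act n (i, False) c' = Some c''" "y = b @ c''" "eps (markC n i) c' > phi (markC n i) b"
      using i(2) by (auto simp: C.act_append split: if_splits)
    have "connC n (b @ c'') (b @ c)"
      using C.conn_trans[OF C.conn_sym[OF C.conn_act[OF i]] step.prems] c''(2) by simp
    then have "c'' = c" using step(2)[OF i(1) c''(1) act_words[OF step.hyps(1) i(1) c''(1)]] by blast
    then have "eps (markC n i) c' = 1" "phi (markC n i) c = Suc (phi (markC n i) c')"
      using C.e_op_eps_phi[of n i c' c''] c''(1) c i(1) by (auto simp: C.act_def C.hw_def)
    then show ?thesis using supp[OF i(1)] c''(3) by simp
  qed
qed

text \<open>With the other bracketing, the right factor \<open>c'\<close> at the top of the triple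
  product follows \<open>hwof n b\<close>, and together they are connected with
  \<open>b @ c\<close>. As the top of \<open>b @ c\<close> ends in \<open>hwof n c\<close>, rigidity
  gives \<open>c' = hwof n c\<close>.\<close>

lemma hwof_append3:
  assumes w: "a \<in> words n" "b \<in> words n" "c \<in> words n"
    and ab: "hwof n (a @ b) = hwof n a @ hwof n b" and bc: "hwof n (b @ c) = hwof n b @ hwof n c"
    and supp: "\<And>i. hw_wt n c i \<noteq> 0 \<Longrightarrow> hw_wt n b i \<noteq> 0"
  shows "hwof n ((a @ b) @ c) = hwof n (a @ b) @ hwof n c"
proof -
  have w': "a @ b \<in> words n" "(a @ b) @ c \<in> words n" using w by auto
  obtain c' where c': "hwof n ((a @ b) @ c) = hwof n (a @ b) @ c'" "connC n c c'"
    using hwof_append_split[OF w'(1) w(3)] by blast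
  have "a @ b @ c \<in> words n" "b @ c \<in> words n" using w by auto
  then obtain x where x: "hwof n (a @ b @ c) = hwof n a @ x" "connC n (b @ c) x"
    using hwof_append_split[OF w(1), of "b @ c"] by blast
  have "x = hwof n b @ c'" using c'(1) x(1) ab by simp
  then have "connC n (hwof n b @ c') (b @ c)" using C.conn_sym x(2) by simp
  from C.conn_trans[OF this hwof(1)[OF \<open>b @ c \<in> words n\<close>]]
  have "connC n (hwof n b @ c') (hwof n b @ hwof n c)" by (simp only: bc)
  moreover have "0 < phi (markC n i) (hwof n b)" if "i \<in> {1..n}" "0 < phi (markC n i) (hwof n c)" for i
    using supp[of i] that by (simp add: hw_wt_def)
  ultimately have "c' = hwof n c"
    using hwof(2,3)[OF w(2)] hwof(2)[OF w(3)] conn_words[OF c'(2) w(3)]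
    by (intro cartan_rigid[of n "hwof n b"]) simp_all
  then show ?thesis using c'(1) by simp
qed

section \<open>Factorisation along a splitting of the weight\<close>

lemma ex_dominant:
  "\<exists>w. w \<in> words n \<and> hwC n w \<and> (\<forall>i\<in>{1..n}. phi (markC n i) w = l i)"
proof -
  have D: "\<exists>w. w \<in> words n \<and> hwC n w \<and> (\<forall>i\<in>{1..n}. phi (markC n i) w = (if i = k then c else 0))"
    if k: "k \<in> {1..n}" for k c
  proof -
    \<comment> \<open>The column of the letters from \<open>1\<close> to \<open>k\<close>, whose
      weight is the fundamental weight of \<open>k\<close>.\<close>
    let ?D = "map Plain [1..<Suc k]"
    have "m \<le> k \<Longrightarrow> \<forall>i\<in>{1..n}. eps (markC n i) (map Plain [1..<Suc m]) = 0 \<and> phi (markC n i) (map Plain [1..<Suc m]) = (if i = m then 1 else 0)" for m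
      using k by (induction m) (auto simp: eps_append phi_append markC_def mark_of_def)
    from this[OF order_refl] have e: "\<forall>i\<in>{1..n}. eps (markC n i) ?D = 0 \<and> phi (markC n i) ?D = (if i = k then 1 else 0)" .
    have "?D \<in> words n" using k by (auto simp: words_def alphabet_def)
    then have "concat (replicate c ?D) \<in> words n \<and> (\<forall>i\<in>{1..n}. eps (markC n i) (concat (replicate c ?D)) = 0 \<and> phi (markC n i) (concat (replicate c ?D)) = (if i = k then c else 0))"
      using e by (induction c) (auto simp: eps_append phi_append simp del: upt_Suc)
    then show ?thesis by (auto simp: C.hw_def)
  qed
  have "m \<le> n \<Longrightarrow> \<exists>w. w \<in> words n \<and> hwC n w \<and> (\<forall>i\<in>{1..n}. phi (markC n i) w = (if i \<le> m then l i else 0))" for m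
  proof (induction m)
    case 0
    then show ?case by (intro exI[of _ "[]"]) (auto simp: C.hw_def)
  next
    case (Suc m)
    then obtain w where w: "w \<in> words n" "hwC n w" "\<forall>i\<in>{1..n}. phi (markC n i) w = (if i \<le> m then l i else 0)" by auto
    obtain v where v: "v \<in> words n" "hwC n v" "\<forall>i\<in>{1..n}. phi (markC n i) v = (if i = Suc m then l (Suc m) else 0)"
      using D[of "Suc m" "l (Suc m)"] Suc.prems by auto
    show ?case using w v
      by (intro exI[of _ "w @ v"]) (auto simp: C.hw_def eps_append phi_append le_Suc_eq)
  qed
  from this[of n] show ?thesis by force
qed

text \<open>Highest weight words of weights \<open>l1\<close> and \<open>l2\<close> concatenate to
  one of the weight of \<open>w\<close>. So \<open>w\<close> has a bisimilar partner in the
  component of this product, and the partner splits into words connected with the two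
  factors.\<close>

lemma ex_factor:
  assumes w: "w \<in> words n" and l: "hw_wt n w = (\<lambda>i. l1 i + l2 i)"
  shows "\<exists>u v. u \<in> words n \<and> v \<in> words n \<and> bisC n w (u @ v) \<and> hw_wt n u = l1 \<and> hw_wt n v = l2"
proof -
  obtain u v where u: "u \<in> words n" "hwC n u" "\<forall>i\<in>{1..n}. phi (markC n i) u = l1 i"
    and v: "v \<in> words n" "hwC n v" "\<forall>i\<in>{1..n}. phi (markC n i) v = l2 i" using ex_dominant by metis
  have out: "l1 i = 0 \<and> l2 i = 0" if "i \<notin> {1..n}" for i using fun_cong[OF l, of i] that by (auto simp: hw_wt_def)
  have h: "hwof n u = u" "hwof n v = v" "hwof n (u @ v) = u @ v"
    using u v hw_append_hw by (auto intro!: hwof_hw)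
  have lu: "hw_wt n u = l1" "hw_wt n v = l2" using u v h out by (auto simp: hw_wt_def fun_eq_iff)
  have "hw_wt n (u @ v) = hw_wt n w" using hwof_append_iff[OF u(1) v(1)] h lu l by simp
  then obtain z where z: "connC n (u @ v) z" "bisC n w z" using hw_wt_transport[OF w, of "u @ v"] u v h(3) by auto
  obtain u' v' where z': "z = u' @ v'" "connC n u u'" "connC n v v'" using C.conn_append[OF z(1)] by blast
  then show ?thesis using conn_words u v z(2) hw_wt_conn lu by metis
qed

text \<open>Moving the second factorisation into the components of the first one makes the two
  products bisimilar words of one component, hence the same word; equal lengths separate the
  factors.\<close>

lemma factor_unique:
  assumes w: "u \<in> words n" "v \<in> words n" "u' \<in> words n" "v' \<in> words n"
    and bis: "bisC n (u @ v) (u' @ v')" and l: "hw_wt n u = hw_wt n u'" "hw_wt n v = hw_wt n v'"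
      "hw_wt n (u @ v) = (\<lambda>i. hw_wt n u i + hw_wt n v i)"
  shows "bisC n u u'" "bisC n v v'"
proof -
  obtain x where x: "connC n (hwof n u) x" "bisC n u' x" using hw_wt_transport[OF w(3,1)] l(1) by auto
  obtain y where y: "connC n (hwof n v) y" "bisC n v' y" using hw_wt_transport[OF w(4,2)] l(2) by auto
  have ux: "connC n u x" using C.conn_trans[OF hwof(1)[OF w(1)] x(1)] .
  have vy: "connC n v y" using C.conn_trans[OF hwof(1)[OF w(2)] y(1)] .
  have xy: "x \<in> words n" "y \<in> words n" "hwof n x = hwof n u" "hwof n y = hwof n v" "hw_wt n x = hw_wt n u" "hw_wt n y = hw_wt n v"
    using conn_words[OF ux w(1)] conn_words[OF vy w(2)] hwof_conn[OF w(1) ux] hwof_conn[OF w(2) vy]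
      hw_wt_conn[OF w(1) ux] hw_wt_conn[OF w(2) vy] by auto
  have b: "bisC n (u @ v) (x @ y)" using C.bis_trans[OF bis C.bis_append[OF x(2) y(2)]] .
  have "hw_wt n (x @ y) = hw_wt n (u @ v)" using bis_hw_wt[OF b] w xy by simp
  then have "hwof n (x @ y) = hwof n u @ hwof n v" using hwof_append_iff[OF xy(1,2)] xy l(3) by simp
  moreover have "hwof n (u @ v) = hwof n u @ hwof n v" using hwof_append_iff[OF w(1,2)] l(3) by simp
  moreover have "connC n (u @ v) (hwof n (u @ v))" "connC n (hwof n (x @ y)) (x @ y)"
    using hwof(1)[of "u @ v" n] C.conn_sym[OF hwof(1)[of "x @ y" n]] w xy by auto
  ultimately have "connC n (u @ v) (x @ y)" using C.conn_trans by metis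
  then have "u @ v = x @ y" using bis_conn_eq[OF b] w by simp
  moreover have "length u = length x" using C.conn_length[OF ux] by simp
  ultimately have "u = x" "v = y" by auto
  then show "bisC n u u'" "bisC n v v'" using x y C.bis_sym by auto
qed

lemma finite_conn:
  assumes "u \<in> words n"
  shows "finite {v. connC n u v}"
proof (rule finite_subset)
  show "{v. connC n u v} \<subseteq> {v. set v \<subseteq> alphabet n \<and> length v = length u}"
    using conn_words[OF _ assms] C.conn_length by (auto simp: words_def in_lists_conv_set)
  show "finite {v. set v \<subseteq> alphabet n \<and> length v = length u}"
    by (rule finite_lists_length_eq) (simp add: alphabet_def)
qed

section \<open>Plactic equivalence is bisimilarity\<close>

definition letter_diff :: "letter list \<Rightarrow> nat \<Rightarrow> int" where
  "letter_diff w i = int (count_list w (Plain i)) - int (count_list w (Bar i))"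

lemma phi_minus_eps_C:
  assumes "i \<in> {1..n}"
  shows "int (phi (markC n i) w) - int (eps (markC n i) w) =
    letter_diff w i - (if i = n then 0 else letter_diff w (Suc i))"
proof (induction w)
  case (Cons x w)
  have "int (phi (markC n i) [x]) - int (eps (markC n i) [x]) =
     letter_diff [x] i - (if i = n then 0 else letter_diff [x] (Suc i))"
    using assms by (auto simp: letter_diff_def markC_def mark_of_def)
  then show ?case
    using Cons phi_minus_eps_append[of "markC n i" "[x]" w] by (auto simp: letter_diff_def)
qed (simp add: letter_diff_def)

text \<open>The colour \<open>n\<close> yields the last coordinate itself and not a difference, so
  descending from \<open>n\<close> recovers all coordinates.\<close>

lemma bis_weight:
  assumes "bisC n u v"
  shows "weight n u = weight n v"
proof -
  have s: "letter_diff u i - (if i = n then 0 else letter_diff u (Suc i)) =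
    letter_diff v i - (if i = n then 0 else letter_diff v (Suc i))" if "i \<in> {1..n}" for i
    using C.bis_eps_phi[OF assms that] phi_minus_eps_C[OF that] by metis
  have "letter_diff u i = letter_diff v i" if "1 \<le> i" "i \<le> n" for i
    using that(2,1) by (induction rule: inc_induct) (use s[of n] s in \<open>force+\<close>)
  then show ?thesis by (auto simp: weight_def letter_diff_def)
qed

lemma crystal_edges_iff:
  "(a, i, b) \<in> crystal_edges n \<longleftrightarrow> a \<in> words n \<and> i \<in> {1..n} \<and> C.act n (i, True) a = Some b"
  using act_words[of a n i True b]
  by (auto simp: crystal_edges_def kashiwara_f_eq_f_op C.act_def markC_eq)

lemma crystal_component_eq:
  assumes "u \<in> words n"
  shows "crystal_component n u = {v. connC n u v}"
proof -
  let ?E = "{(a, b). \<exists>i. (a, i, b) \<in> crystal_edges n}"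
  have "(u, v) \<in> (?E \<union> ?E\<inverse>)\<^sup>* \<Longrightarrow> connC n u v" for v
  proof (induction rule: rtrancl_induct)
    case (step y z)
    then obtain i b where "i \<in> {1..n}" "C.act n (i, b) y = Some z"
      using C.act_inverse[of n _ True z y] by (auto simp: crystal_edges_iff)
    then show ?case using step C.conn_trans C.conn_act by blast
  qed simp
  moreover have "connC n u v \<Longrightarrow> (u, v) \<in> (?E \<union> ?E\<inverse>)\<^sup>*" for v
  proof (induction rule: C.conn_induct)
    case (step v w i b)
    have v: "v \<in> words n" using conn_words[OF step.hyps(1) assms] .
    have w: "w \<in> words n" using act_words[OF v step.hyps(2,3)] .
    have "(v, w) \<in> ?E \<union> ?E\<inverse>"
      using step.hyps(2,3) v w C.act_inverse[of n i b v w] by (cases b) (auto simp: crystal_edges_iff)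
    then show ?case using step.IH by (rule rtrancl_into_rtrancl[rotated])
  qed simp
  ultimately show ?thesis unfolding crystal_component_def Let_def by blast
qed

text \<open>The bisimulation contains the graph of the isomorphism and its converse, so that it is
  symmetric. Raising is an edge read backwards.\<close>

lemma plactic_rel_bis:
  assumes "(u, v) \<in> plactic_rel n"
  shows "bisC n u v"
proof -
  obtain \<phi> where w: "u \<in> words n" "v \<in> words n" and \<phi>: "crystal_iso n {x. connC n u x} {x. connC n v x} \<phi>" "\<phi> u = v"
    using assms by (auto simp: plactic_rel_def crystal_component_eq)
  have bij: "bij_betw \<phi> {x. connC n u x} {x. connC n v x}"
    using \<phi>(1) by (simp add: crystal_iso_def)
  have e: "(a, i, b) \<in> crystal_edges n \<longleftrightarrow> (\<phi> a, i, \<phi> b) \<in> crystal_edges n" if "connC n u a" "connC n u b" for a i b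
    using \<phi>(1) that by (auto simp: crystal_iso_def)
  have act: "C.act n (i, b) x = Some x' \<longleftrightarrow> C.act n (i, b) (\<phi> x) = Some (\<phi> x')"
    if x: "connC n u x" "connC n u x'" "i \<in> {1..n}" for x x' i b
  proof -
    have "connC n v (\<phi> x)" "connC n v (\<phi> x')" using bij that by (auto simp: bij_betw_def)
    then have "x \<in> words n" "x' \<in> words n" "\<phi> x \<in> words n" "\<phi> x' \<in> words n" using conn_words w x by blast+
    then show ?thesis using e[OF x(1,2), of i] e[OF x(2,1), of i] x(3) C.act_inverse[of n i b]
      by (cases b) (auto simp: crystal_edges_iff)
  qed
  show ?thesis
  proof (rule C.bis_coinduct[where Z = "\<lambda>x y. connC n u x \<and> y = \<phi> x \<or> connC n u y \<and> x = \<phi> y"])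
    fix x y i b x' assume z: "connC n u x \<and> y = \<phi> x \<or> connC n u y \<and> x = \<phi> y"
      and i: "i \<in> {1..n}" and a: "C.act n (i, b) x = Some x'"
    from z show "\<exists>y'. C.act n (i, b) y = Some y' \<and> (connC n u x' \<and> y' = \<phi> x' \<or> connC n u y' \<and> x' = \<phi> y')"
    proof
      assume z: "connC n u x \<and> y = \<phi> x"
      then have "connC n u x'" using C.conn_trans C.conn_act[OF i a] by blast
      then show ?thesis using act[of x x' i b] z i a by blast
    next
      assume z: "connC n u y \<and> x = \<phi> y"
      then have "connC n v x" using bij by (auto simp: bij_betw_def)
      then have "connC n v x'" using C.conn_trans C.conn_act[OF i a] by blast
      then obtain y' where "connC n u y'" "x' = \<phi> y'" using bij by (auto simp: bij_betw_def)
      then show ?thesis using act[of y y' i b] z i a by blast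
    qed
  qed (use \<phi>(2) in auto)
qed

text \<open>The isomorphism sends a word to its bisimilar partner in the other component. The
  partner is found by following a string and is unique because bisimilar connected words are
  equal.\<close>

lemma bis_plactic_rel:
  assumes b: "bisC n u v" and w: "u \<in> words n" "v \<in> words n"
  shows "(u, v) \<in> plactic_rel n"
proof -
  define \<phi> where "\<phi> x = (THE y. connC n v y \<and> bisC n x y)" for x
  have uni: "y = y'" if "connC n v y" "connC n v y'" "bisC n x y" "bisC n x y'" for x y y'
    using bis_conn_eq[of n y y'] that conn_words[OF that(1) w(2)] C.bis_sym C.bis_trans C.conn_sym C.conn_trans by metis
  have uni': "x = x'" if "connC n u x" "connC n u x'" "bisC n x y" "bisC n x' y" for x x' y
    using bis_conn_eq[of n x x'] that conn_words[OF that(1) w(1)] C.bis_sym C.bis_trans C.conn_sym C.conn_trans by metis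
  have \<phi>_eq: "\<phi> x = y" if "connC n v y" "bisC n x y" for x y
    unfolding \<phi>_def using that uni by blast
  have \<phi>: "connC n v (\<phi> x) \<and> bisC n x (\<phi> x)" if "connC n u x" for x
    using bis_transport[OF b that] \<phi>_eq by auto
  have "bij_betw \<phi> {x. connC n u x} {x. connC n v x}"
  proof (rule bij_betw_imageI)
    show "inj_on \<phi> {x. connC n u x}" by (rule inj_onI) (metis \<phi> mem_Collect_eq uni')
    have "\<exists>x. connC n u x \<and> y = \<phi> x" if "connC n v y" for y
      using bis_transport[OF C.bis_sym[OF b] that] \<phi>_eq[OF that] C.bis_sym by metis
    then show "\<phi> ` {x. connC n u x} = {x. connC n v x}" using \<phi> by auto
  qed
  moreover have "weight n (\<phi> x) = weight n x" if "connC n u x" for x using \<phi>[OF that] bis_weight by metis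
  moreover have "(x, i, y) \<in> crystal_edges n \<longleftrightarrow> (\<phi> x, i, \<phi> y) \<in> crystal_edges n"
    if x: "connC n u x" "connC n u y" for x i y
  proof -
    have xw: "x \<in> words n" "\<phi> x \<in> words n" using conn_words w x \<phi> by blast+
    have "C.act n (i, True) x = Some y \<longleftrightarrow> C.act n (i, True) (\<phi> x) = Some (\<phi> y)" if i: "i \<in> {1..n}"
    proof
      assume "C.act n (i, True) x = Some y"
      then obtain z where z: "C.act n (i, True) (\<phi> x) = Some z" "bisC n y z" using C.bis_act[of n _ x "\<phi> x"] \<phi>[OF x(1)] i by blast
      have "connC n v z" using C.conn_trans \<phi>[OF x(1)] C.conn_act[OF i z(1)] by blast
      then show "C.act n (i, True) (\<phi> x) = Some (\<phi> y)" using \<phi>_eq[OF _ z(2)] z(1) by simp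
    next
      assume "C.act n (i, True) (\<phi> x) = Some (\<phi> y)"
      then obtain z where z: "C.act n (i, True) x = Some z" "bisC n (\<phi> y) z"
        using C.bis_act[of n _ "\<phi> x" x] C.bis_sym \<phi>[OF x(1)] i by blast
      have "connC n u z" using C.conn_trans x(1) C.conn_act[OF i z(1)] by blast
      then have "z = y" using uni'[of z y "\<phi> y"] x(2) z(2) \<phi>[OF x(2)] C.bis_sym by blast
      then show "C.act n (i, True) x = Some y" using z by simp
    qed
    then show ?thesis using xw by (auto simp: crystal_edges_iff)
  qed
  ultimately have "crystal_iso n {x. connC n u x} {x. connC n v x} \<phi>" by (auto simp: crystal_iso_def)
  moreover have "\<phi> u = v" by (rule \<phi>_eq) (use b in auto)
  ultimately show ?thesis using w by (auto simp: plactic_rel_def crystal_component_eq)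
qed

lemma plactic_rel_eq: "plactic_rel n = {(u, v). u \<in> words n \<and> v \<in> words n \<and> bisC n u v}"
  using plactic_rel_bis bis_plactic_rel by (auto simp: plactic_rel_def)

section \<open>Monoid rings and free modules\<close>

text \<open>The additive extension of \<open>\<phi>\<close> to the monoid ring. A product is
  evaluated by iterating it, which reduces associativity of convolution to that of the
  monoid.\<close>

definition ev :: "('m \<Rightarrow> int) \<Rightarrow> ('m \<Rightarrow> int) \<Rightarrow> int" where
  "ev f \<phi> = (\<Sum>a | f a \<noteq> 0. f a * \<phi> a)"

lemma ev_superset: "finite S \<Longrightarrow> {a. f a \<noteq> 0} \<subseteq> S \<Longrightarrow> ev f \<phi> = (\<Sum>a\<in>S. f a * \<phi> a)"
  unfolding ev_def by (rule sum.mono_neutral_left) auto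

lemma ev_add:
  assumes "finite {a. f a \<noteq> 0}" "finite {a. g a \<noteq> 0}"
  shows "ev (\<lambda>a. f a + g a) \<phi> = ev f \<phi> + ev g \<phi>"
proof -
  let ?S = "{a. f a \<noteq> 0} \<union> {a. g a \<noteq> 0}"
  have S: "finite ?S" using assms by simp
  show ?thesis
    by (subst (1 2 3) ev_superset[OF S]) (auto simp: distrib_right sum.distrib)
qed

lemma ev_add_right: "ev f (\<lambda>a. \<phi> a + \<psi> a) = ev f \<phi> + ev f \<psi>"
  by (simp add: ev_def distrib_left sum.distrib)

lemma ev_mult_right: "ev f (\<lambda>a. \<phi> a * z) = ev f \<phi> * z"
  by (simp add: ev_def sum_distrib_right mult.assoc)

lemma ev_single: "ev (\<lambda>x. if x = m then z else 0) \<phi> = z * \<phi> m"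
  by (subst ev_superset[of "{m}"]) auto

lemma ev_nonzero: "ev f \<phi> \<noteq> 0 \<Longrightarrow> \<exists>a. f a \<noteq> 0 \<and> \<phi> a \<noteq> 0"
  unfolding ev_def by (metis (mono_tags, lifting) mem_Collect_eq mult_zero_right sum.neutral)

lemma ev_delta: "finite {a. f a \<noteq> 0} \<Longrightarrow> ev f (\<lambda>a. if a = x then 1 else 0) = f x"
  by (simp add: ev_def if_distrib sum.delta cong: if_cong)

lemma ev_cong: "(\<And>a. f a \<noteq> 0 \<Longrightarrow> \<phi> a = \<psi> a) \<Longrightarrow> ev f \<phi> = ev f \<psi>"
  unfolding ev_def by (rule sum.cong) auto

context
  fixes M :: "'m monoid" (structure)
begin

abbreviation (input) "ZM \<equiv> monoid_ring M"

lemma carrier_ZM: "f \<in> carrier ZM \<longleftrightarrow> finite {x. f x \<noteq> 0} \<and> {x. f x \<noteq> 0} \<subseteq> carrier M"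
  by (simp add: monoid_ring_def)

lemma zero_ZM: "\<zero>\<^bsub>ZM\<^esub> = (\<lambda>_. 0)" and one_ZM: "\<one>\<^bsub>ZM\<^esub> = (\<lambda>x. if x = \<one> then 1 else 0)"
  and add_ZM: "f \<oplus>\<^bsub>ZM\<^esub> g = (\<lambda>x. f x + g x)"
  by (simp_all add: monoid_ring_def)

lemma mult_ZM:
  assumes "f \<in> carrier ZM" "g \<in> carrier ZM"
  shows "f \<otimes>\<^bsub>ZM\<^esub> g = (\<lambda>x. ev f (\<lambda>a. ev g (\<lambda>b. if a \<otimes> b = x then 1 else 0)))"
proof
  fix x
  have fin: "finite ({a. f a \<noteq> 0} \<times> {b. g b \<noteq> 0})" using assms by (auto simp: carrier_ZM)
  have "(f \<otimes>\<^bsub>ZM\<^esub> g) x = (\<Sum>(a, b)\<in>{(a, b). f a \<noteq> 0 \<and> g b \<noteq> 0 \<and> a \<otimes> b = x}. f a * g b)"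
    by (simp add: monoid_ring_def)
  also have "\<dots> = (\<Sum>(a, b)\<in>{a. f a \<noteq> 0} \<times> {b. g b \<noteq> 0}. f a * (g b * (if a \<otimes> b = x then 1 else 0)))"
    by (rule sum.mono_neutral_cong_left[OF fin]) (auto split: if_splits)
  also have "\<dots> = ev f (\<lambda>a. ev g (\<lambda>b. if a \<otimes> b = x then 1 else 0))"
    unfolding ev_def by (subst sum.cartesian_product[symmetric]) (simp only: sum_distrib_left)
  finally show "(f \<otimes>\<^bsub>ZM\<^esub> g) x = ev f (\<lambda>a. ev g (\<lambda>b. if a \<otimes> b = x then 1 else 0))" .
qed

lemma mult_ZM_nonzero:
  assumes "f \<in> carrier ZM" "g \<in> carrier ZM" "(f \<otimes>\<^bsub>ZM\<^esub> g) x \<noteq> 0"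
  shows "\<exists>a b. f a \<noteq> 0 \<and> g b \<noteq> 0 \<and> a \<otimes> b = x"
proof -
  have "ev f (\<lambda>a. ev g (\<lambda>b. if a \<otimes> b = x then 1 else 0)) \<noteq> 0" using assms(3) by (simp add: mult_ZM[OF assms(1,2)])
  then obtain a where a: "f a \<noteq> 0" "ev g (\<lambda>b. if a \<otimes> b = x then 1 else 0) \<noteq> 0" using ev_nonzero by blast
  from ev_nonzero[OF a(2)] a(1) show ?thesis by (auto split: if_splits)
qed

lemma mult_ZM_closed:
  assumes "monoid M" "f \<in> carrier ZM" "g \<in> carrier ZM"
  shows "f \<otimes>\<^bsub>ZM\<^esub> g \<in> carrier ZM"
proof -
  interpret monoid M by fact
  let ?S = "(\<lambda>(a, b). a \<otimes> b) ` ({a. f a \<noteq> 0} \<times> {b. g b \<noteq> 0})"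
  have "{x. (f \<otimes>\<^bsub>ZM\<^esub> g) x \<noteq> 0} \<subseteq> ?S" using mult_ZM_nonzero[OF assms(2,3)] by fastforce
  moreover have "finite ?S" "?S \<subseteq> carrier M" using assms(2,3) by (auto simp: carrier_ZM)
  ultimately show ?thesis unfolding carrier_ZM by (meson finite_subset subset_trans)
qed

lemma ev_mult_ZM:
  assumes "f \<in> carrier ZM" "g \<in> carrier ZM"
  shows "ev (f \<otimes>\<^bsub>ZM\<^esub> g) \<phi> = ev f (\<lambda>a. ev g (\<lambda>b. \<phi> (a \<otimes> b)))"
proof -
  let ?A = "{a. f a \<noteq> 0}" and ?B = "{b. g b \<noteq> 0}"
  let ?S = "(\<lambda>(a, b). a \<otimes> b) ` (?A \<times> ?B)"
  have fin: "finite ?A" "finite ?B" "finite ?S" using assms by (auto simp: carrier_ZM)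
  have "{x. (f \<otimes>\<^bsub>ZM\<^esub> g) x \<noteq> 0} \<subseteq> ?S" using mult_ZM_nonzero[OF assms] by fastforce
  then have "ev (f \<otimes>\<^bsub>ZM\<^esub> g) \<phi> = (\<Sum>x\<in>?S. (f \<otimes>\<^bsub>ZM\<^esub> g) x * \<phi> x)"
    by (rule ev_superset[OF fin(3)])
  also have "\<dots> = (\<Sum>x\<in>?S. \<Sum>a\<in>?A. \<Sum>b\<in>?B. f a * (g b * (if a \<otimes> b = x then \<phi> x else 0)))"
    unfolding mult_ZM[OF assms] ev_def
    by (auto simp: sum_distrib_left sum_distrib_right intro!: sum.cong)
  also have "\<dots> = (\<Sum>a\<in>?A. \<Sum>b\<in>?B. \<Sum>x\<in>?S. f a * (g b * (if a \<otimes> b = x then \<phi> x else 0)))"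
    by (subst sum.swap, rule sum.cong[OF refl], rule sum.swap)
  also have "\<dots> = (\<Sum>a\<in>?A. \<Sum>b\<in>?B. f a * (g b * \<phi> (a \<otimes> b)))"
  proof (intro sum.cong refl)
    fix a b assume ab: "a \<in> ?A" "b \<in> ?B"
    have "(\<Sum>x\<in>?S. f a * (g b * (if a \<otimes> b = x then \<phi> x else 0))) = f a * (g b * (\<Sum>x\<in>?S. if a \<otimes> b = x then \<phi> x else 0))"
      by (simp add: sum_distrib_left)
    also have "(\<Sum>x\<in>?S. if a \<otimes> b = x then \<phi> x else 0) = \<phi> (a \<otimes> b)"
      using ab fin(3) by (subst sum.delta') auto
    finally show "(\<Sum>x\<in>?S. f a * (g b * (if a \<otimes> b = x then \<phi> x else 0))) = f a * (g b * \<phi> (a \<otimes> b))" .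
  qed
  also have "\<dots> = ev f (\<lambda>a. ev g (\<lambda>b. \<phi> (a \<otimes> b)))" by (simp add: ev_def sum_distrib_left)
  finally show ?thesis .
qed

lemma ring_monoid_ring:
  assumes "monoid M"
  shows "ring ZM"
proof -
  interpret monoid M by fact
  have add_closed: "f \<oplus>\<^bsub>ZM\<^esub> g \<in> carrier ZM" if "f \<in> carrier ZM" "g \<in> carrier ZM" for f g
  proof -
    have "{x. f x + g x \<noteq> 0} \<subseteq> {x. f x \<noteq> 0} \<union> {x. g x \<noteq> 0}" by auto
    then show ?thesis using that unfolding carrier_ZM add_ZM
      by (meson finite_UnI finite_subset le_sup_iff subset_trans)
  qed
  have one_closed: "\<one>\<^bsub>ZM\<^esub> \<in> carrier ZM"
    by (auto simp: carrier_ZM one_ZM)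
  note mult_closed = mult_ZM_closed[OF assms]
  have sup: "f a = 0" if "f \<in> carrier ZM" "a \<notin> carrier M" for f a using that by (auto simp: carrier_ZM)
  show ?thesis
  proof (rule ringI)
    show "abelian_group ZM"
    proof (rule abelian_groupI)
      fix f assume f: "f \<in> carrier ZM"
      then have "(\<lambda>x. - f x) \<in> carrier ZM" by (auto simp: carrier_ZM)
      then show "\<exists>g\<in>carrier ZM. g \<oplus>\<^bsub>ZM\<^esub> f = \<zero>\<^bsub>ZM\<^esub>"
        by (intro bexI[of _ "\<lambda>x. - f x"]) (auto simp: add_ZM zero_ZM)
    qed (use add_closed in \<open>auto simp: add_ZM zero_ZM carrier_ZM\<close>)
  next
    show "monoid ZM"
    proof (rule monoidI)
      fix f g h assume fgh: "f \<in> carrier ZM" "g \<in> carrier ZM" "h \<in> carrier ZM"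
      have "f \<otimes>\<^bsub>ZM\<^esub> g \<otimes>\<^bsub>ZM\<^esub> h = (\<lambda>x. ev f (\<lambda>a. ev g (\<lambda>b. ev h (\<lambda>c. if a \<otimes> b \<otimes> c = x then 1 else 0))))"
        using fgh mult_closed by (simp add: mult_ZM[of "f \<otimes>\<^bsub>ZM\<^esub> g" h] ev_mult_ZM)
      also have "\<dots> = (\<lambda>x. ev f (\<lambda>a. ev g (\<lambda>b. ev h (\<lambda>c. if a \<otimes> (b \<otimes> c) = x then 1 else 0))))"
      proof (intro ext ev_cong)
        fix x a b c assume "f a \<noteq> 0" "g b \<noteq> 0" "h c \<noteq> 0"
        then have "a \<in> carrier M" "b \<in> carrier M" "c \<in> carrier M" using sup fgh by metis+
        then show "(if a \<otimes> b \<otimes> c = x then 1 else 0 :: int) = (if a \<otimes> (b \<otimes> c) = x then 1 else 0)"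
          by (simp add: m_assoc)
      qed
      also have "\<dots> = f \<otimes>\<^bsub>ZM\<^esub> (g \<otimes>\<^bsub>ZM\<^esub> h)"
        using fgh mult_closed by (simp add: mult_ZM[of f "g \<otimes>\<^bsub>ZM\<^esub> h"] ev_mult_ZM)
      finally show "f \<otimes>\<^bsub>ZM\<^esub> g \<otimes>\<^bsub>ZM\<^esub> h = f \<otimes>\<^bsub>ZM\<^esub> (g \<otimes>\<^bsub>ZM\<^esub> h)" .
    next
      fix f assume f: "f \<in> carrier ZM"
      have fin: "finite {a. f a \<noteq> 0}" using f by (simp add: carrier_ZM)
      have "ev f (\<lambda>b. if \<one> \<otimes> b = x then 1 else 0) = f x" for x
      proof (subst ev_delta[OF fin, symmetric], rule ev_cong)
        fix a assume "f a \<noteq> 0"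
        then have "a \<in> carrier M" using sup[OF f] by blast
        then show "(if \<one> \<otimes> a = x then 1 else 0 :: int) = (if a = x then 1 else 0)" by simp
      qed
      then show "\<one>\<^bsub>ZM\<^esub> \<otimes>\<^bsub>ZM\<^esub> f = f" using f one_closed
        by (simp add: mult_ZM) (simp add: one_ZM ev_single)
      have "ev f (\<lambda>a. ev \<one>\<^bsub>ZM\<^esub> (\<lambda>b. if a \<otimes> b = x then 1 else 0)) = f x" for x
      proof (subst ev_delta[OF fin, symmetric], rule ev_cong)
        fix a assume "f a \<noteq> 0"
        then have "a \<in> carrier M" using sup[OF f] by blast
        then show "ev \<one>\<^bsub>ZM\<^esub> (\<lambda>b. if a \<otimes> b = x then 1 else 0) = (if a = x then 1 else 0)"
          by (simp add: one_ZM ev_single)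
      qed
      then show "f \<otimes>\<^bsub>ZM\<^esub> \<one>\<^bsub>ZM\<^esub> = f" using f one_closed by (simp add: mult_ZM)
    qed (use one_closed mult_closed in auto)
  next
    fix f g h assume fgh: "f \<in> carrier ZM" "g \<in> carrier ZM" "h \<in> carrier ZM"
    then have fin: "finite {a. f a \<noteq> 0}" "finite {a. g a \<noteq> 0}" by (auto simp: carrier_ZM)
    show "(f \<oplus>\<^bsub>ZM\<^esub> g) \<otimes>\<^bsub>ZM\<^esub> h = f \<otimes>\<^bsub>ZM\<^esub> h \<oplus>\<^bsub>ZM\<^esub> g \<otimes>\<^bsub>ZM\<^esub> h"
      using fgh add_closed by (simp add: mult_ZM) (simp add: add_ZM ev_add[OF fin])
    show "h \<otimes>\<^bsub>ZM\<^esub> (f \<oplus>\<^bsub>ZM\<^esub> g) = h \<otimes>\<^bsub>ZM\<^esub> f \<oplus>\<^bsub>ZM\<^esub> h \<otimes>\<^bsub>ZM\<^esub> g"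
      using fgh add_closed by (simp add: mult_ZM) (simp add: add_ZM ev_add[OF fin] ev_add_right)
  qed
qed

lemma left_module_trivial:
  assumes "monoid M"
  shows "left_module ZM trivial_module"
proof -
  interpret R: ring ZM by (rule ring_monoid_ring) fact
  have s: "f \<odot>\<^bsub>trivial_module\<^esub> k = ev f (\<lambda>_. 1) * k" for f :: "'m \<Rightarrow> int" and k
    by (simp add: trivial_module_def ev_def)
  have sm: "ev f (\<lambda>_. z) = ev f (\<lambda>_. 1) * z" for f :: "'m \<Rightarrow> int" and z
    using ev_mult_right[of f "\<lambda>_. 1" z] by simp
  have ab: "abelian_group (trivial_module :: ('m \<Rightarrow> int, int) module)"
    by (rule abelian_groupI) (auto simp: trivial_module_def intro: exI[of _ "- x" for x])
  show ?thesis
  proof (intro left_module.intro left_module_axioms.intro R.ring_axioms ab)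
    fix x :: int
    show "\<one>\<^bsub>ZM\<^esub> \<odot>\<^bsub>trivial_module\<^esub> x = x" unfolding s one_ZM ev_single by simp
  next
    fix a b :: "'m \<Rightarrow> int" and x y :: int
    assume a: "a \<in> carrier ZM"
    show "a \<odot>\<^bsub>trivial_module\<^esub> x \<in> carrier (trivial_module :: ('m \<Rightarrow> int, int) module)"
      by (simp add: trivial_module_def)
    show "a \<odot>\<^bsub>trivial_module\<^esub> (x \<oplus>\<^bsub>trivial_module :: ('m \<Rightarrow> int, int) module\<^esub> y) =
       a \<odot>\<^bsub>trivial_module\<^esub> x \<oplus>\<^bsub>trivial_module :: ('m \<Rightarrow> int, int) module\<^esub> a \<odot>\<^bsub>trivial_module\<^esub> y"
      unfolding s by (simp add: trivial_module_def distrib_left)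
    assume b: "b \<in> carrier ZM"
    show "(a \<otimes>\<^bsub>ZM\<^esub> b) \<odot>\<^bsub>trivial_module\<^esub> x = a \<odot>\<^bsub>trivial_module\<^esub> (b \<odot>\<^bsub>trivial_module\<^esub> x)"
      unfolding s ev_mult_ZM[OF a b] by (subst sm) (simp add: mult.assoc)
    show "(a \<oplus>\<^bsub>ZM\<^esub> b) \<odot>\<^bsub>trivial_module\<^esub> x =
       a \<odot>\<^bsub>trivial_module\<^esub> x \<oplus>\<^bsub>trivial_module :: ('m \<Rightarrow> int, int) module\<^esub> b \<odot>\<^bsub>trivial_module\<^esub> x"
      using a b unfolding s add_ZM by (simp add: ev_add carrier_ZM) (simp add: trivial_module_def distrib_right)
  qed
qed

end

section \<open>Free modules\<close>

abbreviation basis :: "('a, 'r) ring_scheme \<Rightarrow> 'x \<Rightarrow> 'x \<Rightarrow> 'a" where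
  "basis R x \<equiv> (\<lambda>y. if y = x then \<one>\<^bsub>R\<^esub> else \<zero>\<^bsub>R\<^esub>)"

lemma basis_closed:
  assumes "ring R" "x \<in> X"
  shows "basis R x \<in> carrier (free_module R X)"
proof -
  interpret ring R by fact
  show ?thesis using assms by (auto simp: free_module_def intro: finite_subset[of _ "{x}"])
qed

lemma free_module_induct [consumes 2, case_names zero add smult]:
  fixes R (structure)
  assumes R: "ring R" and p: "\<phi> \<in> carrier (free_module R X)"
    and zero: "Q (\<lambda>_. \<zero>)"
    and add: "\<And>\<phi> \<psi>. \<phi> \<in> carrier (free_module R X) \<Longrightarrow> \<psi> \<in> carrier (free_module R X) \<Longrightarrow> Q \<phi> \<Longrightarrow> Q \<psi> \<Longrightarrow>
      Q (\<phi> \<oplus>\<^bsub>free_module R X\<^esub> \<psi>)"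
    and smult: "\<And>a x. a \<in> carrier R \<Longrightarrow> x \<in> X \<Longrightarrow> Q (a \<odot>\<^bsub>free_module R X\<^esub> basis R x)"
  shows "Q \<phi>"
proof -
  interpret ring R by fact
  let ?F = "free_module R X"
  interpret F: left_module R ?F by (rule left_module_free_module) fact
  have C: "\<phi> x \<in> carrier R" "finite {x. \<phi> x \<noteq> \<zero>}" "{x. \<phi> x \<noteq> \<zero>} \<subseteq> X" for x
    using p by (auto simp: free_module_def)
  define restr where "restr T = (\<lambda>x. if x \<in> T then \<phi> x else \<zero>)" for T
  have "Q (restr T) \<and> restr T \<in> carrier ?F" if "finite T" "T \<subseteq> X" for T
    using that
  proof (induction T rule: finite_induct)
    case empty
    then show ?case using zero by (simp add: restr_def free_module_def)
  next
    case (insert x T)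
    have e: "restr (insert x T) = \<phi> x \<odot>\<^bsub>?F\<^esub> basis R x \<oplus>\<^bsub>?F\<^esub> restr T"
      using insert.hyps C(1) by (auto simp: restr_def free_module_def fun_eq_iff)
    have "\<phi> x \<odot>\<^bsub>?F\<^esub> basis R x \<in> carrier ?F"
      using insert.prems C(1) basis_closed[OF R] by (intro F.smult_closed) auto
    then show ?case unfolding e using insert C(1) add smult by auto
  qed
  from this[OF C(2,3)] have "Q (restr {x. \<phi> x \<noteq> \<zero>})" by blast
  also have "restr {x. \<phi> x \<noteq> \<zero>} = \<phi>" by (auto simp: restr_def)
  finally show ?thesis .
qed

lemma left_module_hom_zero:
  assumes "left_module R M" "left_module R N" "g \<in> left_module_hom R M N"
  shows "g \<zero>\<^bsub>M\<^esub> = \<zero>\<^bsub>N\<^esub>"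
proof -
  interpret M: left_module R M by fact
  interpret N: left_module R N by fact
  have "g (\<zero>\<^bsub>R\<^esub> \<odot>\<^bsub>M\<^esub> \<zero>\<^bsub>M\<^esub>) = \<zero>\<^bsub>R\<^esub> \<odot>\<^bsub>N\<^esub> g \<zero>\<^bsub>M\<^esub>" "g \<zero>\<^bsub>M\<^esub> \<in> carrier N"
    using assms(3) by (auto simp: left_module_hom_def)
  then show ?thesis by (simp add: M.smult_l_null N.smult_l_null)
qed

lemma projective_free_module:
  fixes R :: "'a ring" and X :: "'x set"
  assumes R: "ring R"
  shows "projective_module R (free_module R X)"
proof -
  let ?F = "free_module R X"
  have F: "left_module R ?F" by (rule left_module_free_module[OF R])
  have "has_lifting R ?F A B" if A: "left_module R A" and B: "left_module R B"
    for A :: "('a, ('x \<Rightarrow> 'a) \<Rightarrow> 'a) module" and B :: "('a, 'x \<Rightarrow> 'a) module"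
    unfolding has_lifting_def
  proof (intro ballI impI)
    fix g f assume g: "g \<in> left_module_hom R A B" and f: "f \<in> left_module_hom R ?F B"
      and surj: "g ` carrier A = carrier B"
    interpret A: left_module R A by fact
    interpret B: left_module R B by fact
    interpret F: left_module R ?F by fact
    have "\<exists>c. c \<in> carrier A \<and> g c = f (basis R x)" if "x \<in> X" for x
    proof -
      have "f (basis R x) \<in> carrier B" using f basis_closed[OF R that] by (auto simp: left_module_hom_def)
      then show ?thesis using surj by (metis imageE)
    qed
    then obtain c where c: "\<And>x. x \<in> X \<Longrightarrow> c x \<in> carrier A \<and> g (c x) = f (basis R x)" by metis
    then have cX: "c \<in> X \<rightarrow> carrier A" by auto
    let ?h = "free_ext R A c"
    have h: "?h \<in> left_module_hom R ?F A" by (rule A.free_ext_hom[OF cX])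
    have "g (?h \<phi>) = f \<phi>" if "\<phi> \<in> carrier ?F" for \<phi>
      using R that
    proof (induction \<phi> rule: free_module_induct)
      case zero
      have "(\<lambda>_. \<zero>\<^bsub>R\<^esub>) = \<zero>\<^bsub>?F\<^esub>" by (simp add: free_module_def)
      then show ?case
        using left_module_hom_zero[OF F A h] left_module_hom_zero[OF A B g] left_module_hom_zero[OF F B f] by simp
    next
      case (add \<phi> \<psi>)
      then show ?case using g f h by (auto simp: left_module_hom_def Pi_iff)
    next
      case (smult a x)
      have b: "basis R x \<in> carrier ?F" by (rule basis_closed[OF R smult(2)])
      have "?h (basis R x) = c x" by (rule A.free_ext_basis(2)[OF cX smult(2)])
      then show ?case using g f h b smult c[OF smult(2)] by (simp add: left_module_hom_def)
    qed
    then show "\<exists>h\<in>left_module_hom R ?F A. \<forall>x\<in>carrier ?F. g (h x) = f x" using h by blast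
  qed
  then show ?thesis using F by (simp add: projective_module_def)
qed

lemma fin_gen_free_module:
  fixes R :: "'a ring"
  assumes R: "ring R" and X: "finite X"
  shows "fin_gen_module R (free_module R X)"
  unfolding fin_gen_module_def
proof (intro exI[of _ "basis R ` X"] conjI allI impI)
  let ?F = "free_module R X"
  show "finite (basis R ` X)" "basis R ` X \<subseteq> carrier ?F" using X basis_closed[OF R] by auto
  fix N assume N: "submodule N R ?F \<and> basis R ` X \<subseteq> N"
  interpret N: submodule N R ?F using N by simp
  have "N \<subseteq> carrier ?F" using N.subset by simp
  moreover have "\<phi> \<in> N" if "\<phi> \<in> carrier ?F" for \<phi>
    using R that
  proof (induction \<phi> rule: free_module_induct)
    case zero
    then show ?case using N.one_closed by (simp add: free_module_def)
  next
    case (add \<phi> \<psi>)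
    then show ?case using N.m_closed by simp
  qed (use N in \<open>auto intro: N.smult_closed\<close>)
  ultimately show "N = carrier ?F" by blast
qed

section \<open>Resolutions from quadratic normal forms\<close>

fun wprod :: "('m, 'b) monoid_scheme \<Rightarrow> 'm list \<Rightarrow> 'm" where
  "wprod M [] = \<one>\<^bsub>M\<^esub>"
| "wprod M (x # w) = x \<otimes>\<^bsub>M\<^esub> wprod M w"

text \<open>A complete quadratic rewriting system, described by its normal forms. \<open>key\<close>
  is the monomial order that gives termination and leading terms; different words may have the same
  key.\<close>

locale quadratic_normal_form = monoid M for M :: "'m monoid" (structure) +
  fixes G :: "'m set" and nrm :: "'m \<Rightarrow> 'm \<Rightarrow> bool" and nf :: "'m \<Rightarrow> 'm list"
    and key :: "'m list \<Rightarrow> 'k :: wellorder"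
  assumes finite_G: "finite G" and G_carrier: "G \<subseteq> carrier M"
    and nf: "m \<in> carrier M \<Longrightarrow> nf m \<in> lists G \<and> wprod M (nf m) = m \<and> successively nrm (nf m)"
    and nf_wprod: "w \<in> lists G \<Longrightarrow> successively nrm w \<Longrightarrow> nf (wprod M w) = w"
    and key_nf: "w \<in> lists G \<Longrightarrow> \<not> successively nrm w \<Longrightarrow> key (nf (wprod M w)) < key w"
    and key_mono: "a \<in> lists G \<Longrightarrow> b \<in> lists G \<Longrightarrow> u \<in> lists G \<Longrightarrow> v \<in> lists G \<Longrightarrow>
      key u < key v \<Longrightarrow> key (a @ u @ b) < key (a @ v @ b)"
    and key_Nil: "x \<in> G \<Longrightarrow> key [] < key [x]"
begin

lemma wprod_closed [simp]: "w \<in> lists G \<Longrightarrow> wprod M w \<in> carrier M"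
  by (induction w) (use G_carrier in auto)

lemma wprod_append: "u \<in> lists G \<Longrightarrow> v \<in> lists G \<Longrightarrow> wprod M (u @ v) = wprod M u \<otimes> wprod M v"
proof (induction u)
  case (Cons x u)
  then have "x \<in> carrier M" "wprod M u \<in> carrier M" "wprod M v \<in> carrier M"
    using G_carrier wprod_closed by auto
  then show ?case using Cons by (simp add: m_assoc)
qed simp

lemma nf_lists [simp]: "m \<in> carrier M \<Longrightarrow> nf m \<in> lists G" and wprod_nf [simp]: "m \<in> carrier M \<Longrightarrow> wprod M (nf m) = m"
  and nf_normal: "m \<in> carrier M \<Longrightarrow> successively nrm (nf m)"
  using nf by auto

lemma nf_one: "nf \<one> = []"
  using nf_wprod[of "[]"] by simp

lemma nf_letter: "x \<in> G \<Longrightarrow> nf x = [x]"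
  using nf_wprod[of "[x]"] G_carrier by auto

lemma key_nf_append: "w \<in> lists G \<Longrightarrow> c \<in> lists G \<Longrightarrow> key (nf (wprod M w) @ c) \<le> key (w @ c)"
  using key_mono[of "[]" c "nf (wprod M w)" w] key_nf[of w] nf_wprod[of w]
  by (cases "successively nrm w") auto

text \<open>Anick chains in the case where all obstructions have length two. The empty chain belongs
  to degree \<open>0\<close>.\<close>

definition chains :: "nat \<Rightarrow> 'm list set" where
  "chains k = {c \<in> lists G. length c = k \<and> successively (\<lambda>x y. \<not> nrm x y) c}"

text \<open>\<open>FP_infinity\<close> prescribes modules of sequences of ring elements, so chains
  have to be numbered.\<close>

definition enc :: "'m list \<Rightarrow> nat" where "enc = to_nat_on (lists G)"

lemma enc_eq [simp]: "c \<in> lists G \<Longrightarrow> d \<in> lists G \<Longrightarrow> enc c = enc d \<longleftrightarrow> c = d"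
  unfolding enc_def using inj_on_to_nat_on[of "lists G"] finite_G
  by (simp add: countable_lists countable_finite inj_on_eq_iff)

lemma chains_lists: "c \<in> chains k \<Longrightarrow> c \<in> lists G"
  by (simp add: chains_def)

lemma enc_chains [simp]: "c \<in> chains k \<Longrightarrow> d \<in> chains l \<Longrightarrow> enc c = enc d \<longleftrightarrow> c = d"
  by (intro enc_eq chains_lists)

lemma chains_0: "chains 0 = {[]}" by (auto simp: chains_def)

lemma chains_Cons: "x # c \<in> chains (Suc k) \<longleftrightarrow> x \<in> G \<and> c \<in> chains k \<and> (c = [] \<or> \<not> nrm x (hd c))"
  by (auto simp: chains_def successively_Cons)

lemma chains_SucE:
  assumes "c \<in> chains (Suc k)"
  obtains x d where "c = x # d" "x \<in> G" "d \<in> chains k"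
  using assms by (cases c) (auto simp: chains_Cons, auto simp: chains_def)

lemma finite_chains: "finite (chains k)"
  by (rule finite_subset[OF _ finite_lists_length_eq[OF finite_G, of k]]) (auto simp: chains_def)

section \<open>Terms of the resolution\<close>

abbreviation ZM :: "('m \<Rightarrow> int) ring" where "ZM \<equiv> monoid_ring M"

definition P :: "nat \<Rightarrow> ('m \<Rightarrow> int, nat \<Rightarrow> 'm \<Rightarrow> int) module" where
  "P k = free_module ZM (enc ` chains k)"

text \<open>The term \<open>z m [c]\<close> with integer coefficient \<open>z\<close>, monoid
  element \<open>m\<close> and basis element \<open>[c]\<close>.\<close>

definition sing :: "int \<Rightarrow> 'm \<Rightarrow> 'm list \<Rightarrow> nat \<Rightarrow> 'm \<Rightarrow> int" where
  "sing z m c = (\<lambda>j x. if j = enc c \<and> x = m then z else 0)"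

definition delta :: "int \<Rightarrow> 'm \<Rightarrow> 'm \<Rightarrow> int" where
  "delta z m = (\<lambda>x. if x = m then z else 0)"

lemma ring_ZM: "ring ZM" by (rule ring_monoid_ring) (rule monoid_axioms)

lemma left_module_P: "left_module ZM (P k)"
  unfolding P_def by (rule left_module_free_module[OF ring_ZM])

sublocale P: left_module ZM "P k" for k by (rule left_module_P)

lemma delta_closed [simp]: "m \<in> carrier M \<Longrightarrow> delta z m \<in> carrier ZM"
  by (auto simp: carrier_ZM delta_def)

lemma P_add: "\<phi> \<oplus>\<^bsub>P k\<^esub> \<psi> = (\<lambda>j x. \<phi> j x + \<psi> j x)"
  by (simp add: P_def free_module_def add_ZM)

lemma P_zero: "\<zero>\<^bsub>P k\<^esub> = (\<lambda>_ _. 0)"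
  by (simp add: P_def free_module_def zero_ZM)

lemma P_smult: "a \<odot>\<^bsub>P k\<^esub> \<phi> = (\<lambda>j. a \<otimes>\<^bsub>ZM\<^esub> \<phi> j)"
  by (simp add: P_def free_module_def)

lemma P_carrier: "\<phi> \<in> carrier (P k) \<longleftrightarrow>
    (\<forall>j. \<phi> j \<in> carrier ZM) \<and> (\<forall>j. j \<notin> enc ` chains k \<longrightarrow> \<phi> j = (\<lambda>_. 0))"
proof
  assume "\<phi> \<in> carrier (P k)"
  then have "range \<phi> \<subseteq> carrier ZM" "{j. \<phi> j \<noteq> (\<lambda>_. 0)} \<subseteq> enc ` chains k"
    by (simp_all add: P_def free_module_def zero_ZM)
  then show "(\<forall>j. \<phi> j \<in> carrier ZM) \<and> (\<forall>j. j \<notin> enc ` chains k \<longrightarrow> \<phi> j = (\<lambda>_. 0))" by blast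
next
  assume *: "(\<forall>j. \<phi> j \<in> carrier ZM) \<and> (\<forall>j. j \<notin> enc ` chains k \<longrightarrow> \<phi> j = (\<lambda>_. 0))"
  then have "range \<phi> \<subseteq> carrier ZM" "{j. \<phi> j \<noteq> (\<lambda>_. 0)} \<subseteq> enc ` chains k" by blast+
  moreover from this(2) have "finite {j. \<phi> j \<noteq> (\<lambda>_. 0)}"
    by (rule finite_subset) (intro finite_imageI finite_chains)
  ultimately show "\<phi> \<in> carrier (P k)" by (simp add: P_def free_module_def zero_ZM)
qed

lemma sing_closed [simp]: "m \<in> carrier M \<Longrightarrow> c \<in> chains k \<Longrightarrow> sing z m c \<in> carrier (P k)"
  by (auto simp: P_carrier carrier_ZM sing_def fun_eq_iff)

lemma uminus_closed:
  assumes "\<phi> \<in> carrier (P k)"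
  shows "(\<lambda>j x. - \<phi> j x) \<in> carrier (P k)"
  using assms by (auto simp: P_carrier carrier_ZM fun_eq_iff)

lemma delta_mult:
  assumes "m \<in> carrier M" "f \<in> carrier ZM"
  shows "delta z m \<otimes>\<^bsub>ZM\<^esub> f = (\<lambda>x. z * ev f (\<lambda>b. if m \<otimes> b = x then 1 else 0))"
  using assms by (simp add: mult_ZM) (simp add: delta_def ev_single)

lemma delta_mult_delta: "m \<in> carrier M \<Longrightarrow> l \<in> carrier M \<Longrightarrow> delta z m \<otimes>\<^bsub>ZM\<^esub> delta y l = delta (z * y) (m \<otimes> l)"
  by (simp add: delta_mult) (auto simp: delta_def ev_single)

lemma sing_delta: "sing z m c = (\<lambda>j. if j = enc c then delta z m else (\<lambda>_. 0))"
  by (auto simp: sing_def delta_def fun_eq_iff)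

lemma smult_sing:
  assumes "m \<in> carrier M" "l \<in> carrier M"
  shows "delta z m \<odot>\<^bsub>P k\<^esub> sing y l c = sing (z * y) (m \<otimes> l) c"
proof -
  have "delta z m \<otimes>\<^bsub>ZM\<^esub> (\<lambda>_. 0) = (\<lambda>_. 0)"
    using P.R.r_null[of "delta z m"] assms by (simp add: zero_ZM)
  then show ?thesis using assms by (auto simp: P_smult sing_delta delta_mult_delta fun_eq_iff)
qed

lemma basis_sing: "basis ZM (enc c) = sing 1 \<one> c"
  by (auto simp: sing_def one_ZM zero_ZM fun_eq_iff)

lemma sing_smult_basis: "m \<in> carrier M \<Longrightarrow> sing z m c = delta z m \<odot>\<^bsub>P k\<^esub> sing 1 \<one> c"
  by (simp add: smult_sing)

section \<open>The order on the terms\<close>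

definition keys :: "nat \<Rightarrow> (nat \<Rightarrow> 'm \<Rightarrow> int) \<Rightarrow> 'k set" where
  "keys k \<phi> = {key (nf m @ c) | m c. m \<in> carrier M \<and> c \<in> chains k \<and> \<phi> (enc c) m \<noteq> 0}"

lemma keysI: "m \<in> carrier M \<Longrightarrow> c \<in> chains k \<Longrightarrow> \<phi> (enc c) m \<noteq> 0 \<Longrightarrow> key (nf m @ c) \<in> keys k \<phi>"
  by (auto simp: keys_def)

lemma keys_add: "keys k (\<lambda>j x. \<phi> j x + \<psi> j x) \<subseteq> keys k \<phi> \<union> keys k \<psi>"
proof
  fix \<kappa> assume "\<kappa> \<in> keys k (\<lambda>j x. \<phi> j x + \<psi> j x)"
  then obtain m c where "\<kappa> = key (nf m @ c)" "m \<in> carrier M" "c \<in> chains k" "\<phi> (enc c) m + \<psi> (enc c) m \<noteq> 0"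
    unfolding keys_def by blast
  moreover from this(4) have "\<phi> (enc c) m \<noteq> 0 \<or> \<psi> (enc c) m \<noteq> 0" by auto
  ultimately show "\<kappa> \<in> keys k \<phi> \<union> keys k \<psi>" unfolding keys_def by blast
qed

lemma keys_uminus: "keys k (\<lambda>j x. - \<phi> j x) = keys k \<phi>"
  by (simp add: keys_def)

lemma keys_zero [simp]: "keys k (\<lambda>_ _. 0) = {}"
  by (simp add: keys_def)

lemma keys_sing: "c \<in> chains k \<Longrightarrow> keys k (sing z m c) \<subseteq> {key (nf m @ c)}"
  by (auto simp: keys_def sing_def)

text \<open>Prefixing \<open>nf m\<close> preserves strict inequalities, and normalising the new
  coefficient cannot raise the key.\<close>

lemma keys_smult:
  assumes \<phi>: "\<phi> \<in> carrier (P k)" and m: "m \<in> carrier M" and v: "v \<in> lists G" and keys: "keys k \<phi> \<subseteq> {..<key v}"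
  shows "keys k (delta z m \<odot>\<^bsub>P k\<^esub> \<phi>) \<subseteq> {..<key (nf m @ v)}"
proof
  fix \<kappa> assume "\<kappa> \<in> keys k (delta z m \<odot>\<^bsub>P k\<^esub> \<phi>)"
  then obtain x c where x: "x \<in> carrier M" "c \<in> chains k" "(delta z m \<otimes>\<^bsub>ZM\<^esub> \<phi> (enc c)) x \<noteq> 0" "\<kappa> = key (nf x @ c)"
    by (auto simp: keys_def P_smult)
  have "\<phi> (enc c) \<in> carrier ZM" using \<phi> by (simp add: P_carrier)
  then obtain b where b: "\<phi> (enc c) b \<noteq> 0" "m \<otimes> b = x" "b \<in> carrier M"
    using mult_ZM_nonzero[OF delta_closed[OF m] _ x(3)] by (auto simp: delta_def carrier_ZM split: if_splits)
  have c: "c \<in> lists G" using x(2) by (rule chains_lists)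
  have "key (nf b @ c) < key v" using keysI[OF b(3) x(2), of \<phi>] b(1) keys by auto
  then have "key (nf m @ (nf b @ c) @ []) < key (nf m @ v @ [])"
    using m b(3) c v by (intro key_mono) auto
  moreover have "key (nf (m \<otimes> b) @ c) \<le> key ((nf m @ nf b) @ c)"
    using key_nf_append[of "nf m @ nf b" c] m b(3) c by (simp add: wprod_append)
  ultimately show "\<kappa> \<in> {..<key (nf m @ v)}" using b(2) x(4) by simp
qed

text \<open>The case of a single term records that its monoid element and chain occur in the given
  element, so bounds on the keys of that element stay available.\<close>

lemma P_induct [consumes 1, case_names zero add sing]:
  assumes \<phi>: "\<phi> \<in> carrier (P k)"
    and zero: "Q (\<lambda>_ _. 0)"
    and add: "\<And>\<phi> \<psi>. \<phi> \<in> carrier (P k) \<Longrightarrow> \<psi> \<in> carrier (P k) \<Longrightarrow> Q \<phi> \<Longrightarrow> Q \<psi> \<Longrightarrow> Q (\<lambda>j x. \<phi> j x + \<psi> j x)"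
    and sing: "\<And>m c z. m \<in> carrier M \<Longrightarrow> c \<in> chains k \<Longrightarrow> \<phi> (enc c) m \<noteq> 0 \<Longrightarrow> Q (sing z m c)"
  shows "Q \<phi>"
proof -
  define S where "S = {(m, c). m \<in> carrier M \<and> c \<in> chains k \<and> \<phi> (enc c) m \<noteq> 0}"
  have "finite S"
  proof (rule finite_subset)
    show "S \<subseteq> (\<Union>c\<in>chains k. {m. \<phi> (enc c) m \<noteq> 0} \<times> {c})" by (auto simp: S_def)
    show "finite (\<Union>c\<in>chains k. {m. \<phi> (enc c) m \<noteq> 0} \<times> {c})"
      using finite_chains \<phi> by (auto simp: P_carrier carrier_ZM)
  qed
  define restr where "restr T = (\<lambda>j x. if \<exists>c. (x, c) \<in> T \<and> j = enc c then \<phi> j x else 0)" for T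
  have "Q (restr T) \<and> restr T \<in> carrier (P k)" if "T \<subseteq> S" for T
    using finite_subset[OF that \<open>finite S\<close>] that
  proof (induction T rule: finite_induct)
    case empty
    then show ?case using zero P.M.zero_closed[of k] by (simp add: restr_def P_zero)
  next
    case (insert t T)
    obtain m c where t: "t = (m, c)" by fastforce
    have mc: "m \<in> carrier M" "c \<in> chains k" "\<phi> (enc c) m \<noteq> 0" using insert.prems t by (auto simp: S_def)
    have "\<not> (\<exists>d. (m, d) \<in> T \<and> enc c = enc d)"
      using insert.hyps(2) insert.prems mc by (auto simp: t S_def)
    then have e: "restr (insert t T) = (\<lambda>j x. sing (\<phi> (enc c) m) m c j x + restr T j x)"
      by (auto simp: restr_def sing_def t fun_eq_iff)
    have "restr (insert t T) \<in> carrier (P k)"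
      using P.M.a_closed[of "sing (\<phi> (enc c) m) m c" k "restr T"] insert mc by (simp add: e P_add)
    then show ?case unfolding e using insert mc add sing by auto
  qed
  from this[of S] have "Q (restr S)" by simp
  also have "restr S = \<phi>"
  proof (intro ext)
    fix j x
    show "restr S j x = \<phi> j x"
    proof (cases "\<phi> j x = 0")
      case False
      then have "j \<in> enc ` chains k" "x \<in> carrier M" using \<phi> by (auto simp: P_carrier carrier_ZM)
      then show ?thesis using False by (auto simp: restr_def S_def)
    qed (simp add: restr_def)
  qed
  finally show ?thesis .
qed

text \<open>The terms \<open>m[c]\<close> for which \<open>nf m\<close> can be continued by the first letter of \<open>c\<close>; the others
  are the leading terms of boundaries.\<close>

definition essential :: "'m \<Rightarrow> 'm list \<Rightarrow> bool" where
  "essential m c \<longleftrightarrow> (if c = [] then m = \<one> else successively nrm (nf m @ [hd c]))"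

definition ess_supp :: "nat \<Rightarrow> (nat \<Rightarrow> 'm \<Rightarrow> int) \<Rightarrow> bool" where
  "ess_supp k \<phi> \<longleftrightarrow> (\<forall>m\<in>carrier M. \<forall>c\<in>chains k. \<phi> (enc c) m \<noteq> 0 \<longrightarrow> essential m c)"

lemma ess_supp_add: "ess_supp k \<phi> \<Longrightarrow> ess_supp k \<psi> \<Longrightarrow> ess_supp k (\<lambda>j x. \<phi> j x + \<psi> j x)"
  unfolding ess_supp_def by (metis add_0)

text \<open>The last letter of \<open>nf m\<close> is moved to the front of the chain; failure of
  essentiality is what makes the longer word a chain.\<close>

lemma not_essential:
  assumes m: "m \<in> carrier M" and c: "c \<in> chains k" and e: "\<not> essential m c"
  obtains l x where "l \<in> carrier M" "x \<in> G" "nf m = nf l @ [x]" "x # c \<in> chains (Suc k)" "l \<otimes> x = m"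
proof -
  have "nf m \<noteq> []"
  proof
    assume "nf m = []"
    then have "m = \<one>" using wprod_nf[OF m] by simp
    then show False using e by (cases c) (auto simp: essential_def nf_one)
  qed
  then obtain w x where w: "nf m = w @ [x]" by (cases "nf m" rule: rev_cases) auto
  have wx: "w \<in> lists G" "x \<in> G" "successively nrm w" "x \<in> carrier M"
    using nf_lists[OF m] nf_normal[OF m] G_carrier by (auto simp: w successively_append_iff)
  have "nf (wprod M w) = w" using wx by (intro nf_wprod)
  moreover have "wprod M w \<otimes> x = m" using wprod_nf[OF m] wx unfolding w by (simp add: wprod_append)
  moreover have "c = [] \<or> \<not> nrm x (hd c)"
    using e nf_normal[OF m] by (auto simp: essential_def w successively_append_iff)
  ultimately show ?thesis using that[of "wprod M w" x] wx w c by (simp add: chains_Cons)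
qed

lemma essential_nf:
  assumes "m \<in> carrier M" "x \<in> G" "essential m (x # c)"
  shows "nf (m \<otimes> x) = nf m @ [x]"
  using assms nf_wprod[of "nf m @ [x]"] G_carrier by (auto simp: essential_def wprod_append)

section \<open>Maps with prescribed leading terms\<close>

definition leading :: "nat \<Rightarrow> ((nat \<Rightarrow> 'm \<Rightarrow> int) \<Rightarrow> nat \<Rightarrow> 'm \<Rightarrow> int) \<Rightarrow> bool" where
  "leading k D \<longleftrightarrow> D \<in> left_module_hom ZM (P (Suc k)) (P k) \<and>
    (\<forall>x c. x # c \<in> chains (Suc k) \<longrightarrow> (\<exists>r\<in>carrier (P k).
      D (sing 1 \<one> (x # c)) = (\<lambda>j y. sing 1 x c j y + r j y) \<and> keys k r \<subseteq> {..<key (x # c)}))"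

lemma hom_P:
  assumes "D \<in> left_module_hom ZM (P k) (P l)"
  shows "\<phi> \<in> carrier (P k) \<Longrightarrow> D \<phi> \<in> carrier (P l)"
    and "\<phi> \<in> carrier (P k) \<Longrightarrow> \<psi> \<in> carrier (P k) \<Longrightarrow> D (\<lambda>j x. \<phi> j x + \<psi> j x) = (\<lambda>j x. D \<phi> j x + D \<psi> j x)"
    and "a \<in> carrier ZM \<Longrightarrow> \<phi> \<in> carrier (P k) \<Longrightarrow> D (a \<odot>\<^bsub>P k\<^esub> \<phi>) = a \<odot>\<^bsub>P l\<^esub> D \<phi>"
    and "D (\<lambda>_ _. 0) = (\<lambda>_ _. 0)"
  using assms left_module_hom_zero[OF left_module_P left_module_P assms]
  by (auto simp: left_module_hom_def P_add P_zero)

text \<open>If \<open>nf m\<close> can be continued by \<open>x\<close>, the bound on the remainder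
  is the key of the first term, which is then the leading one.\<close>

lemma leading_sing:
  assumes D: "leading k D" and xc: "x # c \<in> chains (Suc k)" and m: "m \<in> carrier M"
  shows "\<exists>r\<in>carrier (P k). D (sing z m (x # c)) = (\<lambda>j y. sing z (m \<otimes> x) c j y + r j y) \<and>
     keys k r \<subseteq> {..<key (nf m @ x # c)}"
proof -
  obtain r where r: "r \<in> carrier (P k)" "D (sing 1 \<one> (x # c)) = (\<lambda>j y. sing 1 x c j y + r j y)"
     "keys k r \<subseteq> {..<key (x # c)}" using D xc unfolding leading_def by blast
  have x: "x \<in> carrier M" "c \<in> chains k" "x # c \<in> lists G"
    using xc G_carrier chains_lists by (auto simp: chains_Cons)
  have "D (sing z m (x # c)) = delta z m \<odot>\<^bsub>P k\<^esub> (sing 1 x c \<oplus>\<^bsub>P k\<^esub> r)"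
    using hom_P(3)[of D "Suc k" k "delta z m" "sing 1 \<one> (x # c)"] D m xc r(2)
    by (simp add: leading_def sing_smult_basis[OF m, of z "x # c" "Suc k"] P_add)
  also have "\<dots> = sing z (m \<otimes> x) c \<oplus>\<^bsub>P k\<^esub> delta z m \<odot>\<^bsub>P k\<^esub> r"
    using m x r(1) by (simp add: P.smult_r_distr smult_sing)
  finally show ?thesis
    using keys_smult[OF r(1) m x(3) r(3), of z] m r(1)
    by (intro bexI[of _ "delta z m \<odot>\<^bsub>P k\<^esub> r"]) (auto simp: P_add)
qed

text \<open>Division with remainder: a term that is not essential is the leading term of a boundary
  and is traded for smaller ones. The downward closed set \<open>B\<close> carries the bound on
  \<open>p\<close> that gives the next map its leading term.\<close>

lemma leading_decompose:
  assumes D: "leading k D" and B: "\<And>\<kappa> \<kappa>'. \<kappa> \<in> B \<Longrightarrow> \<kappa>' < \<kappa> \<Longrightarrow> \<kappa>' \<in> B"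
    and \<phi>: "\<phi> \<in> carrier (P k)" "keys k \<phi> \<subseteq> B"
  obtains p q where "p \<in> carrier (P (Suc k))" "q \<in> carrier (P k)" "\<phi> = (\<lambda>j x. D p j x + q j x)"
    "ess_supp k q" "keys (Suc k) p \<subseteq> B"
proof -
  define Dec where "Dec \<phi> \<longleftrightarrow> (\<exists>p\<in>carrier (P (Suc k)). \<exists>q\<in>carrier (P k). \<phi> = (\<lambda>j x. D p j x + q j x) \<and>
    ess_supp k q \<and> keys (Suc k) p \<subseteq> B \<and> keys k q \<subseteq> B)" for \<phi>
  have hom: "D \<in> left_module_hom ZM (P (Suc k)) (P k)" using D by (simp add: leading_def)
  note D_simps = hom_P[OF hom]
  have zero: "(\<lambda>_ _. 0) \<in> carrier (P l)" for l using P.M.zero_closed[of l] by (simp add: P_zero)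
  have closed: "(\<lambda>j x. \<phi> j x + \<psi> j x) \<in> carrier (P l)" if "\<phi> \<in> carrier (P l)" "\<psi> \<in> carrier (P l)" for \<phi> \<psi> l
    using P.M.a_closed[OF that] by (simp add: P_add)
  have DecE: thesis if d: "Dec \<phi>" and t: "\<And>p q. p \<in> carrier (P (Suc k)) \<Longrightarrow> q \<in> carrier (P k) \<Longrightarrow>
    \<phi> = (\<lambda>j x. D p j x + q j x) \<Longrightarrow> ess_supp k q \<Longrightarrow> keys (Suc k) p \<subseteq> B \<Longrightarrow> keys k q \<subseteq> B \<Longrightarrow> thesis" for \<phi> thesis
    using d unfolding Dec_def by (elim bexE conjE) (rule t)
  have Dec_zero: "Dec (\<lambda>_ _. 0)"
    unfolding Dec_def
  proof (intro bexI conjI)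
    show "(\<lambda>_ _. 0) = (\<lambda>j x. D (\<lambda>_ _. 0) j x + (\<lambda>_ _. 0) j x)" by (simp add: D_simps(4))
  qed (simp_all add: zero ess_supp_def keys_def)
  have Dec_add: "Dec (\<lambda>j x. \<phi> j x + \<psi> j x)" if d: "Dec \<phi>" "Dec \<psi>" for \<phi> \<psi>
  proof -
    obtain p q where p: "p \<in> carrier (P (Suc k))" "q \<in> carrier (P k)" "\<phi> = (\<lambda>j x. D p j x + q j x)"
      "ess_supp k q" "keys (Suc k) p \<subseteq> B" "keys k q \<subseteq> B"
      using d(1) by (rule DecE)
    obtain p' q' where p': "p' \<in> carrier (P (Suc k))" "q' \<in> carrier (P k)" "\<psi> = (\<lambda>j x. D p' j x + q' j x)"
      "ess_supp k q'" "keys (Suc k) p' \<subseteq> B" "keys k q' \<subseteq> B"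
      using d(2) by (rule DecE)
    show ?thesis unfolding Dec_def
    proof (intro bexI conjI)
      show "(\<lambda>j x. \<phi> j x + \<psi> j x) = (\<lambda>j x. D (\<lambda>j x. p j x + p' j x) j x + (\<lambda>j x. q j x + q' j x) j x)"
        by (simp only: p(3) p'(3) D_simps(2)[OF p(1) p'(1)]) (simp add: fun_eq_iff)
      show "ess_supp k (\<lambda>j x. q j x + q' j x)" by (rule ess_supp_add[OF p(4) p'(4)])
      show "keys (Suc k) (\<lambda>j x. p j x + p' j x) \<subseteq> B" using keys_add[of "Suc k" p p'] p(5) p'(5) by blast
      show "keys k (\<lambda>j x. q j x + q' j x) \<subseteq> B" using keys_add[of k q q'] p(6) p'(6) by blast
      show "(\<lambda>j x. q j x + q' j x) \<in> carrier (P k)" by (rule closed[OF p(2) p'(2)])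
      show "(\<lambda>j x. p j x + p' j x) \<in> carrier (P (Suc k))" by (rule closed[OF p(1) p'(1)])
    qed
  qed
  have Dec_sing: "Dec (sing z m c)" if "m \<in> carrier M" "c \<in> chains k" "key (nf m @ c) \<in> B" for z m c
    using that
  proof (induction "key (nf m @ c)" arbitrary: z m c rule: less_induct)
    case less
    show ?case
    proof (cases "essential m c")
      case True
      then show ?thesis unfolding Dec_def
      proof (intro bexI conjI)
        show "sing z m c = (\<lambda>j x. D (\<lambda>_ _. 0) j x + sing z m c j x)" by (simp add: D_simps(4))
        show "ess_supp k (sing z m c)"
          using True less.prems(2) by (auto simp: ess_supp_def sing_def)
        show "keys k (sing z m c) \<subseteq> B" using keys_sing[OF less.prems(2), of z m] less.prems(3) by blast
      qed (use zero less.prems(1,2) in simp_all)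
    next
      case False
      then obtain l x where l: "l \<in> carrier M" "x \<in> G" "nf m = nf l @ [x]" "x # c \<in> chains (Suc k)" "l \<otimes> x = m"
        using not_essential less.prems(1,2) by blast
      obtain r where r: "r \<in> carrier (P k)" "D (sing z l (x # c)) = (\<lambda>j y. sing z m c j y + r j y)"
        "keys k r \<subseteq> {..<key (nf m @ c)}" using leading_sing[OF D l(4,1), of z] l(3,5) by auto
      \<comment> \<open>The term is the boundary minus \<open>r\<close>, and all terms of
        \<open>r\<close> have smaller keys.\<close>
      have "Dec (\<lambda>j x. - r j x)"
        using uminus_closed[OF r(1)]
      proof (induction rule: P_induct)
        case (sing m' c' z')
        have "key (nf m' @ c') < key (nf m @ c)" using keysI[OF sing(1,2), of r] sing(3) r(3) by auto
        then show ?case using less.hyps sing B[OF less.prems(3)] by blast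
      qed (use Dec_zero Dec_add in auto)
      moreover have "Dec (D (sing z l (x # c)))"
        unfolding Dec_def
      proof (intro bexI conjI)
        show "D (sing z l (x # c)) = (\<lambda>j y. D (sing z l (x # c)) j y + (\<lambda>_ _. 0) j y)" by simp
        have "key (nf l @ x # c) = key (nf m @ c)" using l(3) by simp
        then show "keys (Suc k) (sing z l (x # c)) \<subseteq> B" using keys_sing[OF l(4), of z l] less.prems(3) by auto
      qed (use l(1,4) zero in \<open>simp_all add: ess_supp_def\<close>)
      ultimately have "Dec (\<lambda>j y. D (sing z l (x # c)) j y + - r j y)" by (intro Dec_add)
      then show ?thesis by (simp add: r(2))
    qed
  qed
  have "Dec \<phi>"
    using \<phi>(1)
  proof (induction rule: P_induct)
    case (sing m c z)
    then show ?case using \<phi>(2) keysI[OF sing(1,2), of \<phi>] by (intro Dec_sing) auto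
  qed (use Dec_zero Dec_add in auto)
  then show ?thesis by (rule DecE) (rule that)
qed

text \<open>For essential terms \<open>m [x # c]\<close> the product \<open>m \<otimes> x\<close>
  has the normal form \<open>nf m @ [x]\<close>, so \<open>m\<close>, \<open>x\<close> and
  \<open>c\<close> can be recovered from the leading term. Hence the image of a term of largest key
  is not cancelled, even if other terms share that key.\<close>

lemma leading_injective:
  assumes D: "leading k D" and q: "q \<in> carrier (P (Suc k))" "ess_supp (Suc k) q" "D q = (\<lambda>_ _. 0)"
  shows "q = (\<lambda>_ _. 0)"
proof (rule ccontr)
  assume ne: "q \<noteq> (\<lambda>_ _. 0)"
  have hom: "D \<in> left_module_hom ZM (P (Suc k)) (P k)" using D by (simp add: leading_def)
  define S where "S = {(m, c). m \<in> carrier M \<and> c \<in> chains (Suc k) \<and> q (enc c) m \<noteq> 0}"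
  have "finite S"
  proof (rule finite_subset)
    show "S \<subseteq> (\<Union>c\<in>chains (Suc k). {m. q (enc c) m \<noteq> 0} \<times> {c})" by (auto simp: S_def)
    show "finite (\<Union>c\<in>chains (Suc k). {m. q (enc c) m \<noteq> 0} \<times> {c})"
      using finite_chains q(1) by (auto simp: P_carrier carrier_ZM)
  qed
  moreover have "S \<noteq> {}"
  proof -
    obtain j x where jx: "q j x \<noteq> 0" using ne by (auto simp: fun_eq_iff)
    then have "j \<in> enc ` chains (Suc k)" "x \<in> carrier M" using q(1) by (auto simp: P_carrier carrier_ZM)
    then show ?thesis using jx by (auto simp: S_def)
  qed
  ultimately have "Max ((\<lambda>(m, c). key (nf m @ c)) ` S) \<in> (\<lambda>(m, c). key (nf m @ c)) ` S" by (intro Max_in) auto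
  then obtain m0 c0 where mc0: "(m0, c0) \<in> S" "key (nf m0 @ c0) = Max ((\<lambda>(m, c). key (nf m @ c)) ` S)" by auto
  have max: "key (nf m @ c) \<le> key (nf m0 @ c0)" if "(m, c) \<in> S" for m c
    unfolding mc0(2) using that \<open>finite S\<close> by (intro Max_ge) auto
  have m0: "m0 \<in> carrier M" "c0 \<in> chains (Suc k)" "q (enc c0) m0 \<noteq> 0" using mc0(1) by (auto simp: S_def)
  obtain x d where c0: "c0 = x # d" "x \<in> G" "d \<in> chains k" using m0(2) by (rule chains_SucE)
  have ess0: "essential m0 c0" using q(2) m0 by (auto simp: ess_supp_def)
  have x: "x \<in> carrier M" using c0 G_carrier by auto
  \<comment> \<open>The element \<open>q\<close> without the chosen term of largest key; its image
    will have coefficient \<open>0\<close> at the leading term of that term's image.\<close>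
  define q' where "q' = (\<lambda>j y. q j y + sing (- q (enc c0) m0) m0 c0 j y)"
  have q': "q' \<in> carrier (P (Suc k))"
    using P.M.a_closed[OF q(1) sing_closed[OF m0(1,2)]] by (simp add: q'_def P_add)
  have "D q' (enc d) (m0 \<otimes> x) = 0"
    using q'
  proof (induction rule: P_induct)
    case zero
    then show ?case by (simp add: hom_P[OF hom])
  next
    case (add \<phi> \<psi>)
    then show ?case by (simp add: hom_P[OF hom])
  next
    case (sing m c z)
    have ne: "(m, c) \<noteq> (m0, c0)" using sing(3) by (auto simp: q'_def sing_def)
    have S: "(m, c) \<in> S"
      using sing ne m0(2) by (auto simp: S_def q'_def sing_def split: if_splits)
    obtain y e where c: "c = y # e" "y \<in> G" "e \<in> chains k" using sing(2) by (rule chains_SucE)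
    have ess: "essential m c" using q(2) S by (auto simp: ess_supp_def S_def)
    have y: "y \<in> carrier M" using c G_carrier by auto
    obtain r where r: "r \<in> carrier (P k)" "D (sing z m c) = (\<lambda>j a. sing z (m \<otimes> y) e j a + r j a)"
      "keys k r \<subseteq> {..<key (nf m @ c)}" using leading_sing[OF D, of y e m z] sing c by auto
    have "r (enc d) (m0 \<otimes> x) = 0"
    proof (rule ccontr)
      assume "r (enc d) (m0 \<otimes> x) \<noteq> 0"
      then have "key (nf (m0 \<otimes> x) @ d) < key (nf m @ c)"
        using keysI[of "m0 \<otimes> x" d k r] m0 x c0 r(3) by auto
      moreover have "nf (m0 \<otimes> x) = nf m0 @ [x]" using essential_nf m0 c0 ess0 by blast
      ultimately show False using max[OF S] c0 by simp
    qed
    moreover have "sing z (m \<otimes> y) e (enc d) (m0 \<otimes> x) = 0"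
    proof (rule ccontr)
      assume "sing z (m \<otimes> y) e (enc d) (m0 \<otimes> x) \<noteq> 0"
      then have eq: "d = e" "m0 \<otimes> x = m \<otimes> y" using c0(3) c(3) by (auto simp: sing_def split: if_splits)
      have "nf m0 @ [x] = nf m @ [y]"
        using essential_nf[of m0 x d] essential_nf[of m y e] m0 c0 ess0 ess c sing(1) eq(2) by auto
      then have "nf m0 = nf m" "x = y" by auto
      then have "m0 = m" using wprod_nf m0(1) sing(1) by metis
      then show False using ne eq \<open>x = y\<close> c0 c by simp
    qed
    ultimately show ?case by (simp add: r(2))
  qed
  moreover have "D q' = (\<lambda>j y. D q j y + D (sing (- q (enc c0) m0) m0 c0) j y)"
    unfolding q'_def using q(1) m0 by (intro hom_P(2)[OF hom]) auto
  moreover obtain r where r: "r \<in> carrier (P k)"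
      "D (sing (- q (enc c0) m0) m0 c0) = (\<lambda>j a. sing (- q (enc c0) m0) (m0 \<otimes> x) d j a + r j a)"
      "keys k r \<subseteq> {..<key (nf m0 @ c0)}" using leading_sing[OF D, of x d m0 "- q (enc c0) m0"] m0 c0 by auto
  moreover have "r (enc d) (m0 \<otimes> x) = 0"
  proof (rule ccontr)
    assume "r (enc d) (m0 \<otimes> x) \<noteq> 0"
    then have "key (nf (m0 \<otimes> x) @ d) < key (nf m0 @ c0)"
      using keysI[of "m0 \<otimes> x" d k r] m0 x c0 r(3) by auto
    moreover have "nf (m0 \<otimes> x) = nf m0 @ [x]" using essential_nf m0 c0 ess0 by blast
    ultimately show False using c0 by simp
  qed
  ultimately show False using m0(3) q(3) by (simp add: sing_def)
qed

text \<open>By the second condition the image meets the span of the essential terms only in zero.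
  Together with division with remainder this makes the span a complement of the image.\<close>

definition good :: "nat \<Rightarrow> ((nat \<Rightarrow> 'm \<Rightarrow> int) \<Rightarrow> nat \<Rightarrow> 'm \<Rightarrow> int) \<Rightarrow> bool" where
  "good k D \<longleftrightarrow> leading k D \<and>
    (\<forall>p\<in>carrier (P (Suc k)). ess_supp k (D p) \<longrightarrow> D p = (\<lambda>_ _. 0))"

text \<open>The basis element of \<open>x # c\<close> is sent to \<open>x [c]\<close> corrected to a
  cycle: dividing the boundary of \<open>x [c]\<close> leaves a remainder that is again a boundary,
  with essential support, hence zero. The second condition passes on because the new boundaries are
  cycles and \<open>D\<close> is injective on essential support.\<close>

lemma good_step:
  assumes "good k D"
  shows "\<exists>D'. good (Suc k) D' \<and> (\<forall>p\<in>carrier (P (Suc (Suc k))). D (D' p) = (\<lambda>_ _. 0))"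
proof -
  have D: "leading k D" and im: "\<And>p. p \<in> carrier (P (Suc k)) \<Longrightarrow> ess_supp k (D p) \<Longrightarrow> D p = (\<lambda>_ _. 0)"
    using assms by (auto simp: good_def)
  have hom: "D \<in> left_module_hom ZM (P (Suc k)) (P k)" using D by (simp add: leading_def)
  have closed: "(\<lambda>j x. \<phi> j x + \<psi> j x) \<in> carrier (P l)" if "\<phi> \<in> carrier (P l)" "\<psi> \<in> carrier (P l)" for \<phi> \<psi> l
    using P.M.a_closed[OF that] by (simp add: P_add)
  have "\<exists>v\<in>carrier (P (Suc k)). D v = (\<lambda>_ _. 0) \<and> (\<exists>r\<in>carrier (P (Suc k)).
      v = (\<lambda>j y. sing 1 x c j y + r j y) \<and> keys (Suc k) r \<subseteq> {..<key (x # c)})"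
    if xc: "x # c \<in> chains (Suc (Suc k))" for x c
  proof -
    have c: "c \<in> chains (Suc k)" "x \<in> G" "x \<in> carrier M" using xc G_carrier by (auto simp: chains_Cons)
    obtain y d where d: "c = y # d" "y \<in> G" "d \<in> chains k" using c(1) by (rule chains_SucE)
    have xy: "\<not> nrm x y" "y \<in> carrier M" using xc d G_carrier by (auto simp: chains_Cons)
    let ?s = "sing 1 x c"
    have s: "?s \<in> carrier (P (Suc k))" using c by simp
    obtain r where r: "r \<in> carrier (P k)" "D ?s = (\<lambda>j a. sing 1 (x \<otimes> y) d j a + r j a)"
      "keys k r \<subseteq> {..<key (nf x @ c)}" using leading_sing[OF D, of y d x 1] c d by auto
    have dl: "d \<in> lists G" using d chains_lists by blast
    \<comment> \<open>In a chain the pair \<open>[x, y]\<close> is not normal, so even the first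
      term of the boundary lies strictly below \<open>x # c\<close>. This keeps the correction below
      \<open>x [c]\<close>.\<close>
    have "key (nf (wprod M [x, y])) < key [x, y]" using xy c d by (intro key_nf) auto
    then have "key ([] @ nf (wprod M [x, y]) @ d) < key ([] @ [x, y] @ d)"
      using c d xy dl by (intro key_mono) auto
    then have "key (nf (x \<otimes> y) @ d) < key (x # c)" using xy c d by simp
    then have K: "keys k (D ?s) \<subseteq> {..<key (x # c)}"
      using keys_add[of k "sing 1 (x \<otimes> y) d" r] keys_sing[OF d(3), of 1 "x \<otimes> y"] r(3) c
      unfolding r(2) by (auto simp: nf_letter)
    have down: "\<kappa>' \<in> {..<key (x # c)}" if "\<kappa> \<in> {..<key (x # c)}" "\<kappa>' < \<kappa>" for \<kappa> \<kappa>'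
      using that by auto
    obtain p q where pq: "p \<in> carrier (P (Suc k))" "q \<in> carrier (P k)" "D ?s = (\<lambda>j x. D p j x + q j x)"
      "ess_supp k q" "keys (Suc k) p \<subseteq> {..<key (x # c)}"
      by (rule leading_decompose[OF D down hom_P(1)[OF hom s] K])
    let ?v = "\<lambda>j a. ?s j a + - p j a"
    have v: "?v \<in> carrier (P (Suc k))" using closed[OF s uminus_closed[OF pq(1)]] .
    have "D (\<lambda>j a. ?v j a + p j a) = (\<lambda>j a. D ?v j a + D p j a)" by (rule hom_P(2)[OF hom v pq(1)])
    then have "D ?s = (\<lambda>j a. D ?v j a + D p j a)" by simp
    then have "D ?v = q" using pq(3) by (simp add: fun_eq_iff)
    then have "D ?v = (\<lambda>_ _. 0)" using im[OF v] pq(4) by simp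
    then show ?thesis using v uminus_closed[OF pq(1)] pq(5)
      by (intro bexI[of _ ?v] conjI bexI[of _ "\<lambda>j a. - p j a"]) (auto simp: keys_uminus)
  qed
  note step = this
  define Q where "Q e v \<longleftrightarrow> v \<in> carrier (P (Suc k)) \<and> D v = (\<lambda>_ _. 0) \<and> (\<exists>r\<in>carrier (P (Suc k)).
      v = (\<lambda>j y. sing 1 (hd e) (tl e) j y + r j y) \<and> keys (Suc k) r \<subseteq> {..<key e})" for e v
  define C where "C e = (SOME v. Q e v)" for e
  have QC: "Q e (C e)" if e: "e \<in> chains (Suc (Suc k))" for e
  proof -
    obtain x c where xc: "e = x # c" using e by (rule chains_SucE)
    then have "x # c \<in> chains (Suc (Suc k))" using e by simp
    from step[OF this] have "\<exists>v. Q e v"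
      unfolding Q_def xc list.sel by (elim bexE) (intro exI conjI; (elim conjE; assumption)?)
    then show ?thesis unfolding C_def by (rule someI_ex)
  qed
  have C: "C e \<in> carrier (P (Suc k))" "D (C e) = (\<lambda>_ _. 0)" "\<exists>r\<in>carrier (P (Suc k)).
      C e = (\<lambda>j y. sing 1 (hd e) (tl e) j y + r j y) \<and> keys (Suc k) r \<subseteq> {..<key e}"
    if e: "e \<in> chains (Suc (Suc k))" for e
  proof -
    note q = QC[OF e, unfolded Q_def]
    show "C e \<in> carrier (P (Suc k))" by (rule conjunct1[OF q])
    show "D (C e) = (\<lambda>_ _. 0)" by (rule conjunct1[OF conjunct2[OF q]])
    show "\<exists>r\<in>carrier (P (Suc k)). C e = (\<lambda>j y. sing 1 (hd e) (tl e) j y + r j y) \<and> keys (Suc k) r \<subseteq> {..<key e}"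
      by (rule conjunct2[OF conjunct2[OF q]])
  qed
  define C' where "C' j = C (inv_into (chains (Suc (Suc k))) enc j)" for j
  have inj: "inj_on enc (chains (Suc (Suc k)))" by (intro inj_onI) (metis enc_chains)
  have C'_enc: "C' (enc e) = C e" if "e \<in> chains (Suc (Suc k))" for e
    using that inj by (simp add: C'_def)
  then have C': "C' \<in> enc ` chains (Suc (Suc k)) \<rightarrow> carrier (P (Suc k))" using C by auto
  define D' where "D' = free_ext ZM (P (Suc k)) C'"
  have hom': "D' \<in> left_module_hom ZM (P (Suc (Suc k))) (P (Suc k))"
    unfolding D'_def P_def[of "Suc (Suc k)"] by (rule P.free_ext_hom[OF C'])
  have D'_basis: "D' (sing 1 \<one> e) = C e" if "e \<in> chains (Suc (Suc k))" for e
    using P.free_ext_basis(2)[OF C', of "enc e"] that unfolding basis_sing D'_def by (simp add: C'_enc)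
  have "leading (Suc k) D'"
    unfolding leading_def
  proof (intro conjI allI impI hom')
    fix x c assume xc: "x # c \<in> chains (Suc (Suc k))"
    show "\<exists>r\<in>carrier (P (Suc k)). D' (sing 1 \<one> (x # c)) = (\<lambda>j y. sing 1 x c j y + r j y) \<and> keys (Suc k) r \<subseteq> {..<key (x # c)}"
      using C(3)[OF xc] unfolding D'_basis[OF xc] list.sel .
  qed
  moreover have zero: "D (D' p) = (\<lambda>_ _. 0)" if "p \<in> carrier (P (Suc (Suc k)))" for p
    using that
  proof (induction rule: P_induct)
    case zero
    then show ?case by (simp add: hom_P[OF hom] hom_P[OF hom'])
  next
    case (add \<phi> \<psi>)
    then show ?case by (simp add: hom_P[OF hom] hom_P[OF hom'])
  next
    case (sing m e z)
    have "D (D' (sing z m e)) = delta z m \<odot>\<^bsub>P k\<^esub> D (C e)"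
      using sing(1,2) C(1)[OF sing(2)] by (simp add: sing_smult_basis[OF sing(1), of z e "Suc (Suc k)"] hom_P(3)[OF hom] hom_P(3)[OF hom'] D'_basis)
    also have "\<dots> = \<zero>\<^bsub>P k\<^esub>"
      using C(2)[OF sing(2)] P.smult_r_null[of "delta z m" k] sing(1) by (simp add: P_zero)
    finally show ?case by (simp add: P_zero)
  qed
  moreover have "D' p = (\<lambda>_ _. 0)" if p: "p \<in> carrier (P (Suc (Suc k)))" and e: "ess_supp (Suc k) (D' p)" for p
    by (rule leading_injective[OF D hom_P(1)[OF hom' p] e zero[OF p]])
  ultimately have "good (Suc k) D'" unfolding good_def by (intro conjI ballI impI)
  then show ?thesis using zero by (intro exI[of _ D'] conjI ballI)
qed

section \<open>The augmentation and the start of the resolution\<close>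

definition aug :: "(nat \<Rightarrow> 'm \<Rightarrow> int) \<Rightarrow> int" where
  "aug = free_ext ZM trivial_module (\<lambda>_. 1)"

lemma aug_hom: "aug \<in> left_module_hom ZM (P 0) trivial_module"
proof -
  interpret T: left_module ZM trivial_module by (rule left_module_trivial) (rule monoid_axioms)
  show ?thesis unfolding aug_def P_def by (rule T.free_ext_hom) (simp add: trivial_module_def)
qed

lemma aug_sing: "m \<in> carrier M \<Longrightarrow> aug (sing z m []) = z"
proof -
  assume m: "m \<in> carrier M"
  interpret T: left_module ZM trivial_module by (rule left_module_trivial) (rule monoid_axioms)
  have nil: "[] \<in> chains 0" by (simp add: chains_0)
  have "aug (sing z m []) = delta z m \<odot>\<^bsub>trivial_module\<^esub> aug (sing 1 \<one> [])"
    using aug_hom m nil by (simp add: sing_smult_basis[OF m, of z "[]" 0] left_module_hom_def)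
  also have "aug (sing 1 \<one> []) = 1"
    unfolding aug_def basis_sing[symmetric]
    by (rule T.free_ext_basis(2)[of _ "enc ` chains 0"]) (auto simp: trivial_module_def chains_0)
  also have "delta z m \<odot>\<^bsub>trivial_module\<^esub> 1 = z"
    using ev_single[of m z "\<lambda>_. 1"] by (simp add: trivial_module_def delta_def ev_def)
  finally show ?thesis .
qed

lemma aug_simps:
  "\<phi> \<in> carrier (P 0) \<Longrightarrow> \<psi> \<in> carrier (P 0) \<Longrightarrow> aug (\<lambda>j x. \<phi> j x + \<psi> j x) = aug \<phi> + aug \<psi>"
  "aug (\<lambda>_ _. 0) = 0"
proof -
  show "\<phi> \<in> carrier (P 0) \<Longrightarrow> \<psi> \<in> carrier (P 0) \<Longrightarrow> aug (\<lambda>j x. \<phi> j x + \<psi> j x) = aug \<phi> + aug \<psi>"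
    using aug_hom by (auto simp: left_module_hom_def P_add trivial_module_def)
  show "aug (\<lambda>_ _. 0) = 0"
    using left_module_hom_zero[OF left_module_P left_module_trivial[OF monoid_axioms] aug_hom]
    by (simp add: P_zero trivial_module_def)
qed

text \<open>The only essential term in degree \<open>0\<close> is \<open>\<one> []\<close>, and on
  its multiples the augmentation is the coefficient.\<close>

lemma aug_injective:
  assumes "q \<in> carrier (P 0)" "ess_supp 0 q" "aug q = 0"
  shows "q = (\<lambda>_ _. 0)"
proof -
  have z: "q j x = 0" if "(j, x) \<noteq> (enc [], \<one>)" for j x
  proof (rule ccontr)
    assume "q j x \<noteq> 0"
    moreover from this have "j = enc []" "x \<in> carrier M" using assms(1) by (auto simp: P_carrier carrier_ZM chains_0)
    ultimately have "essential x []" using assms(2) by (auto simp: ess_supp_def chains_0)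
    then show False using that \<open>j = enc []\<close> by (simp add: essential_def)
  qed
  have q: "q = sing (q (enc []) \<one>) \<one> []" using z by (auto simp: sing_def fun_eq_iff)
  have "q (enc []) \<one> = aug q" by (subst (2) q) (simp add: aug_sing)
  then show ?thesis using q assms(3) by (simp add: sing_def)
qed

text \<open>The first map sends the basis element of \<open>[x]\<close> to
  \<open>x [] - \<one> []\<close>; by \<open>key_Nil\<close> the first term leads.\<close>

lemma good_0: "\<exists>D. good 0 D \<and> (\<forall>p\<in>carrier (P 1). aug (D p) = 0)"
proof -
  have closed: "(\<lambda>j x. \<phi> j x + \<psi> j x) \<in> carrier (P l)" if "\<phi> \<in> carrier (P l)" "\<psi> \<in> carrier (P l)" for \<phi> \<psi> l
    using P.M.a_closed[OF that] by (simp add: P_add)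
  have nil: "[] \<in> chains 0" by (simp add: chains_0)
  define C where "C e = (\<lambda>j y. sing 1 (hd e) [] j y + sing (-1) \<one> [] j y)" for e
  define C' where "C' j = C (inv_into (chains 1) enc j)" for j
  have inj: "inj_on enc (chains 1)" by (intro inj_onI) (metis enc_chains)
  have C'_enc: "C' (enc e) = C e" if "e \<in> chains 1" for e
    using that inj by (simp add: C'_def)
  have C: "C e \<in> carrier (P 0)" "aug (C e) = 0" if "e \<in> chains 1" for e
  proof -
    have "hd e \<in> carrier M" using that G_carrier by (cases e) (auto simp: chains_def)
    then show "C e \<in> carrier (P 0)" "aug (C e) = 0"
      unfolding C_def using nil by (auto intro!: closed simp: aug_simps aug_sing)
  qed
  then have C': "C' \<in> enc ` chains 1 \<rightarrow> carrier (P 0)" using C'_enc by auto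
  define D where "D = free_ext ZM (P 0) C'"
  have hom: "D \<in> left_module_hom ZM (P (Suc 0)) (P 0)"
    using P.free_ext_hom[OF C'] by (simp add: D_def P_def)
  have D_basis: "D (sing 1 \<one> e) = C e" if "e \<in> chains 1" for e
    using P.free_ext_basis(2)[OF C', of "enc e"] that unfolding basis_sing D_def by (simp add: C'_enc)
  have "leading 0 D"
    unfolding leading_def
  proof (intro conjI allI impI)
    fix x c assume xc: "x # c \<in> chains (Suc 0)"
    then have c: "c = []" "x \<in> G" by (auto simp: chains_Cons chains_0)
    have "keys 0 (sing (-1) \<one> []) \<subseteq> {..<key (x # c)}"
      using keys_sing[OF nil, of "-1" \<one>] key_Nil[OF c(2)] c by (auto simp: nf_one)
    then show "\<exists>r\<in>carrier (P 0). D (sing 1 \<one> (x # c)) = (\<lambda>j y. sing 1 x c j y + r j y) \<and> keys 0 r \<subseteq> {..<key (x # c)}"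
      using D_basis xc c nil by (intro bexI[of _ "sing (-1) \<one> []"]) (auto simp: C_def)
  qed (use hom in simp)
  moreover have zero: "aug (D p) = 0" if "p \<in> carrier (P 1)" for p
    using that
  proof (induction rule: P_induct)
    case zero
    then show ?case by (simp add: hom_P[OF hom] aug_simps)
  next
    case (add \<phi> \<psi>)
    then show ?case by (simp add: hom_P[OF hom] aug_simps)
  next
    case (sing m e z)
    have "aug (D (sing z m e)) = delta z m \<odot>\<^bsub>trivial_module\<^esub> aug (C e)"
      using sing C[OF sing(2)] aug_hom
      by (simp add: sing_smult_basis[OF sing(1), of z e "Suc 0"] hom_P(3)[OF hom] D_basis) (simp add: left_module_hom_def)
    then show ?case using C[OF sing(2)] by (simp add: trivial_module_def)
  qed
  moreover have "D p = (\<lambda>_ _. 0)" if p: "p \<in> carrier (P (Suc 0))" and e: "ess_supp 0 (D p)" for p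
    by (rule aug_injective[OF hom_P(1)[OF hom p] e]) (use zero p in simp)
  ultimately have "good 0 D" unfolding good_def by (intro conjI ballI impI)
  then show ?thesis using zero by (intro exI[of _ D] conjI ballI)
qed

theorem FP_infinity_quadratic: "FP_infinity M"
proof -
  obtain D0 where D0: "good 0 D0" "\<And>p. p \<in> carrier (P 1) \<Longrightarrow> aug (D0 p) = 0" using good_0 by blast
  \<comment> \<open>Each map is built from the previous one, so dependent choice is applied.\<close>
  have "\<exists>d. d 0 = D0 \<and> (\<forall>k. good k (d k) \<and> (\<forall>p\<in>carrier (P (Suc (Suc k))). d k (d (Suc k) p) = (\<lambda>_ _. 0)))"
  proof -
    have "\<exists>d. \<forall>k. (good k (d k) \<and> (k = 0 \<longrightarrow> d k = D0)) \<and>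
        (\<forall>p\<in>carrier (P (Suc (Suc k))). d k (d (Suc k) p) = (\<lambda>_ _. 0))"
      by (rule dependent_nat_choice) (use D0 good_step in auto)
    then show ?thesis by metis
  qed
  then obtain d where d: "d 0 = D0" "\<And>k. good k (d k)"
    "\<And>k p. p \<in> carrier (P (Suc (Suc k))) \<Longrightarrow> d k (d (Suc k) p) = (\<lambda>_ _. 0)" by blast
  have hom: "d k \<in> left_module_hom ZM (P (Suc k)) (P k)" for k using d(2) by (simp add: good_def leading_def)
  have lead: "leading k (d k)" for k using d(2) by (simp add: good_def)
  \<comment> \<open>Division leaves a cycle with essential support, which vanishes by
    injectivity.\<close>
  have exact: "\<phi> \<in> d (Suc k) ` carrier (P (Suc (Suc k)))" if \<phi>: "\<phi> \<in> carrier (P (Suc k))" "d k \<phi> = (\<lambda>_ _. 0)" for k \<phi>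
  proof -
    obtain p q where pq: "p \<in> carrier (P (Suc (Suc k)))" "q \<in> carrier (P (Suc k))" "\<phi> = (\<lambda>j x. d (Suc k) p j x + q j x)"
      "ess_supp (Suc k) q" by (rule leading_decompose[OF lead _ \<phi>(1) subset_UNIV]) simp
    have "d k \<phi> = (\<lambda>j x. d k (d (Suc k) p) j x + d k q j x)"
      unfolding pq(3) by (rule hom_P(2)[OF hom hom_P(1)[OF hom pq(1)] pq(2)])
    then have "d k q = (\<lambda>_ _. 0)" using \<phi>(2) d(3)[OF pq(1)] by (simp add: fun_eq_iff)
    then have "q = (\<lambda>_ _. 0)" by (rule leading_injective[OF lead pq(2,4)])
    then have "\<phi> = d (Suc k) p" using pq(3) by simp
    then show ?thesis using pq(1) by (rule image_eqI)
  qed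
  have exact0: "\<phi> \<in> d 0 ` carrier (P 1)" if \<phi>: "\<phi> \<in> carrier (P 0)" "aug \<phi> = 0" for \<phi>
  proof -
    obtain p q where pq: "p \<in> carrier (P 1)" "q \<in> carrier (P 0)" "\<phi> = (\<lambda>j x. d 0 p j x + q j x)"
      "ess_supp 0 q" unfolding One_nat_def by (rule leading_decompose[OF lead _ \<phi>(1) subset_UNIV]) simp
    have "d 0 p \<in> carrier (P 0)" using hom_P(1)[OF hom, of p 0] pq(1) by simp
    then have "aug \<phi> = aug (d 0 p) + aug q"
      unfolding pq(3) by (rule aug_simps(1)[OF _ pq(2)])
    then have "aug q = 0" using \<phi>(2) D0(2)[OF pq(1)] d(1) by simp
    then have "q = (\<lambda>_ _. 0)" by (rule aug_injective[OF pq(2,4)])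
    then have "\<phi> = d 0 p" using pq(3) by simp
    then show ?thesis using pq(1) by (rule image_eqI)
  qed
  have "projective_resolution_fg ZM trivial_module P d aug"
    unfolding projective_resolution_fg_def
  proof (intro conjI allI)
    show "left_module ZM (trivial_module :: ('m \<Rightarrow> int, int) module)" by (rule left_module_trivial) (rule monoid_axioms)
    show "projective_module ZM (P k)" "fin_gen_module ZM (P k)" for k
      unfolding P_def using projective_free_module fin_gen_free_module ring_ZM finite_chains by blast+
    show "aug \<in> left_module_hom ZM (P 0) trivial_module" by (rule aug_hom)
    have "z \<in> aug ` carrier (P 0)" for z
      by (rule image_eqI[of _ _ "sing z \<one> []"]) (simp_all add: aug_sing chains_0)
    then show "aug ` carrier (P 0) = carrier trivial_module" by (auto simp: trivial_module_def)
    show "d 0 ` carrier (P 1) = a_kernel (P 0) trivial_module aug"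
    proof
      show "d 0 ` carrier (P 1) \<subseteq> a_kernel (P 0) trivial_module aug"
        using D0(2) d(1) hom_P(1)[OF hom, of _ 0] by (auto simp: a_kernel_def' trivial_module_def)
      show "a_kernel (P 0) trivial_module aug \<subseteq> d 0 ` carrier (P 1)"
        using exact0 by (simp add: a_kernel_def' trivial_module_def subset_iff)
    qed
    show "d (Suc k) ` carrier (P (Suc (Suc k))) = a_kernel (P (Suc k)) (P k) (d k)" for k
    proof
      show "d (Suc k) ` carrier (P (Suc (Suc k))) \<subseteq> a_kernel (P (Suc k)) (P k) (d k)"
        using d(3)[of _ k] hom_P(1)[OF hom, of _ "Suc k"] by (auto simp: a_kernel_def' P_zero)
      show "a_kernel (P (Suc k)) (P k) (d k) \<subseteq> d (Suc k) ` carrier (P (Suc (Suc k)))"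
        using exact[of _ k] by (simp add: a_kernel_def' P_zero subset_iff)
    qed
  qed (use hom in auto)
  then show ?thesis unfolding FP_infinity_def by blast
qed

end

section \<open>Normal forms from unique factorisation along weights\<close>

text \<open>\<open>ht_le\<close> and \<open>ht_eq\<close> stand in for the dominance order on the
  weights in a tensor product; \<open>local\<close> is what makes normality a condition on
  neighbours.\<close>

locale factorial_weight = monoid M for M :: "'m monoid" (structure) +
  fixes I :: "nat set" and coef :: "nat \<Rightarrow> nat" and wt :: "'m \<Rightarrow> nat \<Rightarrow> nat"
  assumes finite_I: "finite I" and coef_pos: "i \<in> I \<Longrightarrow> 0 < coef i"
    and wt_outside: "m \<in> carrier M \<Longrightarrow> i \<notin> I \<Longrightarrow> wt m i = 0"
    and wt_one: "wt \<one> = (\<lambda>_. 0)"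
    and finite_fibre: "finite {m \<in> carrier M. wt m = l}"
    and ht_le: "a \<in> carrier M \<Longrightarrow> b \<in> carrier M \<Longrightarrow>
      (\<Sum>i\<in>I. coef i * wt (a \<otimes> b) i) \<le> (\<Sum>i\<in>I. coef i * wt a i) + (\<Sum>i\<in>I. coef i * wt b i)"
    and ht_eq: "a \<in> carrier M \<Longrightarrow> b \<in> carrier M \<Longrightarrow>
      (\<Sum>i\<in>I. coef i * wt (a \<otimes> b) i) = (\<Sum>i\<in>I. coef i * wt a i) + (\<Sum>i\<in>I. coef i * wt b i) \<Longrightarrow>
      wt (a \<otimes> b) = (\<lambda>i. wt a i + wt b i)"
    and factor: "m \<in> carrier M \<Longrightarrow> wt m = (\<lambda>i. l i + l' i) \<Longrightarrow>
      \<exists>a\<in>carrier M. \<exists>b\<in>carrier M. m = a \<otimes> b \<and> wt a = l \<and> wt b = l'"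
    and factor_unique: "a \<in> carrier M \<Longrightarrow> b \<in> carrier M \<Longrightarrow> a' \<in> carrier M \<Longrightarrow> b' \<in> carrier M \<Longrightarrow>
      a \<otimes> b = a' \<otimes> b' \<Longrightarrow> wt a = wt a' \<Longrightarrow> wt b = wt b' \<Longrightarrow> wt (a \<otimes> b) = (\<lambda>i. wt a i + wt b i) \<Longrightarrow>
      a = a' \<and> b = b'"
    and local: "a \<in> carrier M \<Longrightarrow> b \<in> carrier M \<Longrightarrow> c \<in> carrier M \<Longrightarrow>
      wt (a \<otimes> b) = (\<lambda>i. wt a i + wt b i) \<Longrightarrow> wt (b \<otimes> c) = (\<lambda>i. wt b i + wt c i) \<Longrightarrow>
      (\<And>i. wt c i \<noteq> 0 \<Longrightarrow> wt b i \<noteq> 0) \<Longrightarrow> wt (a \<otimes> b \<otimes> c) = (\<lambda>i. wt (a \<otimes> b) i + wt c i)"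
begin

definition ht :: "'m \<Rightarrow> nat" where "ht m = (\<Sum>i\<in>I. coef i * wt m i)"

text \<open>The product lies in the component of largest weight of the tensor product, the Cartan
  component.\<close>

definition cartan :: "'m \<Rightarrow> 'm \<Rightarrow> bool" where
  "cartan a b \<longleftrightarrow> wt (a \<otimes> b) = (\<lambda>i. wt a i + wt b i)"

definition gens :: "'m set" where
  "gens = {m \<in> carrier M. wt m \<noteq> (\<lambda>_. 0) \<and> (\<forall>i. wt m i \<le> 1)}"

text \<open>For generators the condition on supports says that \<open>a\<close> carries the largest
  multiplicity-free part of the sum of the two weights.\<close>

definition nrm :: "'m \<Rightarrow> 'm \<Rightarrow> bool" where
  "nrm a b \<longleftrightarrow> (\<forall>i. wt b i \<noteq> 0 \<longrightarrow> wt a i \<noteq> 0) \<and> cartan a b"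

lemma gens_carrier: "x \<in> gens \<Longrightarrow> x \<in> carrier M"
  by (simp add: gens_def)

lemma finite_gens: "finite gens"
proof (rule finite_subset)
  show "gens \<subseteq> (\<Union>S\<in>Pow I. {m \<in> carrier M. wt m = (\<lambda>i. if i \<in> S then 1 else 0)})"
  proof
    fix m assume m: "m \<in> gens"
    have e: "wt m i = (if wt m i = 1 then 1 else 0)" for i
      using m by (auto simp: gens_def le_Suc_eq)
    have "wt m = (\<lambda>i. if i \<in> {i. wt m i = 1} then 1 else 0)"
      unfolding mem_Collect_eq by (rule ext, rule e)
    moreover have "{i. wt m i = 1} \<in> Pow I"
    proof -
      have "i \<in> I" if "wt m i = 1" for i
        using wt_outside[OF gens_carrier[OF m], of i] that by (cases "i \<in> I") simp_all
      then show ?thesis by blast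
    qed
    ultimately show "m \<in> (\<Union>S\<in>Pow I. {m \<in> carrier M. wt m = (\<lambda>i. if i \<in> S then 1 else 0)})"
      using gens_carrier[OF m] by blast
  qed
  show "finite (\<Union>S\<in>Pow I. {m \<in> carrier M. wt m = (\<lambda>i. if i \<in> S then 1 else 0)})"
    using finite_I finite_fibre by blast
qed

lemma ht_strict:
  assumes "a \<in> carrier M" "b \<in> carrier M" "\<And>i. wt a i \<le> wt b i" "wt a j < wt b j"
  shows "ht a < ht b"
proof -
  have j: "j \<in> I" using wt_outside[OF assms(2), of j] assms(4) by (cases "j \<in> I") auto
  show ?thesis unfolding ht_def
    by (rule sum_strict_mono_ex1[OF finite_I]) (use assms j coef_pos in auto)
qed

lemma cartan_iff:
  assumes "a \<in> carrier M" "b \<in> carrier M"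
  shows "cartan a b \<longleftrightarrow> ht (a \<otimes> b) = ht a + ht b"
proof
  assume "cartan a b"
  then show "ht (a \<otimes> b) = ht a + ht b" by (simp add: cartan_def ht_def sum.distrib distrib_left)
qed (use ht_eq[OF assms] in \<open>auto simp: cartan_def ht_def\<close>)

lemma ht_mult_le: "a \<in> carrier M \<Longrightarrow> b \<in> carrier M \<Longrightarrow> ht (a \<otimes> b) \<le> ht a + ht b"
  using ht_le by (simp add: ht_def)

lemma wt_zero:
  assumes "m \<in> carrier M" "wt m = (\<lambda>_. 0)"
  shows "m = \<one>"
proof -
  \<comment> \<open>The products \<open>m \<otimes> \<one>\<close> and
    \<open>\<one> \<otimes> m\<close> are two factorisations with the same weights.\<close>
  have "m = \<one> \<and> \<one> = m" by (rule factor_unique) (simp_all add: assms wt_one)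
  then show ?thesis by (rule conjunct1)
qed

section \<open>Existence and uniqueness of normal forms\<close>

definition wtw :: "'m list \<Rightarrow> nat \<Rightarrow> nat" where
  "wtw w i = sum_list (map (\<lambda>x. wt x i) w)"

lemma wtw_simps [simp]: "wtw [] = (\<lambda>_. 0)" "wtw (x # w) = (\<lambda>i. wt x i + wtw w i)"
  by (auto simp: wtw_def)

lemma wprod_closed: "w \<in> lists gens \<Longrightarrow> wprod M w \<in> carrier M"
  by (induction w) (auto simp: gens_carrier)

lemma wprod_append: "u \<in> lists gens \<Longrightarrow> v \<in> lists gens \<Longrightarrow> wprod M (u @ v) = wprod M u \<otimes> wprod M v"
proof (induction u)
  case (Cons x u)
  then have "x \<in> carrier M" "wprod M u \<in> carrier M" "wprod M v \<in> carrier M"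
    using gens_carrier wprod_closed by auto
  then show ?case using Cons by (simp add: m_assoc)
qed (simp add: wprod_closed)

lemma normal_supp: "successively nrm (x # w) \<Longrightarrow> wtw w i \<noteq> 0 \<Longrightarrow> wt x i \<noteq> 0"
proof (induction w arbitrary: x)
  case (Cons y w)
  then have "wt y i \<noteq> 0" by auto
  then show ?case using Cons.prems by (auto simp: nrm_def)
qed simp

text \<open>\<open>local\<close> is applied to the first letter, the second letter and the product
  of the rest, whose support lies in that of the second letter; so the induction removes two
  letters.\<close>

lemma wt_wprod:
  "w \<in> lists gens \<Longrightarrow> successively nrm w \<Longrightarrow> wt (wprod M w) = wtw w"
proof (induction w rule: induct_list012)
  case 1
  then show ?case by (simp add: wt_one)
next
  case (2 x)
  then show ?case by (simp add: gens_carrier)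
next
  case (3 x y w)
  have c: "x \<in> carrier M" "y \<in> carrier M" "wprod M w \<in> carrier M"
    using 3(3) gens_carrier wprod_closed by auto
  have yw: "successively nrm (y # w)" "nrm x y" using 3(4) by auto
  then have "successively nrm w" by (auto simp: successively_Cons)
  then have w: "wt (wprod M w) = wtw w" using 3(1,3) by simp
  have "wt (y \<otimes> wprod M w) = (\<lambda>i. wt y i + wt (wprod M w) i)" using 3(2,3) yw(1) w by simp
  moreover have xy: "wt (x \<otimes> y) = (\<lambda>i. wt x i + wt y i)" using yw(2) by (simp add: nrm_def cartan_def)
  moreover have "wt y i \<noteq> 0" if "wt (wprod M w) i \<noteq> 0" for i using normal_supp[OF yw(1)] that w by simp
  ultimately have "wt (x \<otimes> y \<otimes> wprod M w) = (\<lambda>i. wt (x \<otimes> y) i + wt (wprod M w) i)"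
    using c by (intro local)
  then show ?case using c by (simp add: m_assoc xy w add.assoc)
qed

text \<open>Supports decrease along a normal word, so the first letter meets every index of the
  total weight, once.\<close>

lemma wt_hd:
  assumes "x \<in> gens" "successively nrm (x # w)"
  shows "wt x i = min 1 (wtw (x # w) i)"
proof -
  have "wt x i = 0 \<or> wt x i = 1" using assms(1) by (auto simp: gens_def le_Suc_eq)
  then show ?thesis using normal_supp[OF assms(2), of i] by (cases "wtw w i = 0") auto
qed

text \<open>The total weight fixes the weight of the first letter and so that of the rest; unique
  factorisation then identifies both.\<close>

lemma normal_unique:
  "w \<in> lists gens \<Longrightarrow> w' \<in> lists gens \<Longrightarrow> successively nrm w \<Longrightarrow> successively nrm w' \<Longrightarrow>
    wprod M w = wprod M w' \<Longrightarrow> w = w'"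
proof (induction w arbitrary: w')
  case Nil
  have "wtw w' = (\<lambda>_. 0)" using wt_wprod[of w'] Nil by (simp add: wt_one[symmetric])
  then show ?case using Nil.prems(2) by (cases w') (auto simp: gens_def fun_eq_iff)
next
  case (Cons x w)
  have e: "wtw (x # w) = wtw w'" using wt_wprod[of "x # w"] wt_wprod[of w'] Cons.prems by simp
  have "w' \<noteq> []"
  proof
    assume "w' = []"
    then have "wt x i = 0" for i using fun_cong[OF e, of i] by simp
    then show False using Cons.prems(1) by (auto simp: gens_def)
  qed
  then obtain x' v where w': "w' = x' # v" by (cases w') auto
  have g: "x \<in> gens" "x' \<in> gens" "w \<in> lists gens" "v \<in> lists gens" using Cons.prems w' by auto
  have n: "successively nrm w" "successively nrm v" using Cons.prems w' by (auto simp: successively_Cons)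
  have x: "wt x = wt x'"
    using wt_hd[OF g(1) Cons.prems(3)] wt_hd[of x' v] g(2) Cons.prems(4) e w' by (auto simp: fun_eq_iff)
  then have "wtw w = wtw v" using e w' by (simp add: fun_eq_iff)
  then have "wt (wprod M w) = wt (wprod M v)" using wt_wprod g n by simp
  moreover have "wt (x \<otimes> wprod M w) = (\<lambda>i. wt x i + wt (wprod M w) i)"
    using wt_wprod[of "x # w"] wt_wprod[OF g(3) n(1)] Cons.prems by simp
  moreover have "x \<otimes> wprod M w = x' \<otimes> wprod M v" using Cons.prems(5) w' by simp
  ultimately have "x = x' \<and> wprod M w = wprod M v"
    using x g gens_carrier wprod_closed by (intro factor_unique) auto
  then show ?case using Cons.IH[OF g(3,4) n] w' by simp
qed

lemma ex_normal:
  "m \<in> carrier M \<Longrightarrow> \<exists>w\<in>lists gens. successively nrm w \<and> wprod M w = m"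
proof (induction "ht m" arbitrary: m rule: less_induct)
  case less
  show ?case
  proof (cases "wt m = (\<lambda>_. 0)")
    case True
    then show ?thesis using wt_zero[OF less.prems] by (intro bexI[of _ "[]"]) auto
  next
    case False
    obtain a b where ab: "a \<in> carrier M" "b \<in> carrier M" "m = a \<otimes> b"
      "wt a = (\<lambda>i. min 1 (wt m i))" "wt b = (\<lambda>i. wt m i - min 1 (wt m i))"
      using factor[OF less.prems, of "\<lambda>i. min 1 (wt m i)" "\<lambda>i. wt m i - min 1 (wt m i)"] by auto
    obtain j where "wt m j \<noteq> 0" using False by auto
    then have "ht b < ht m" using ab less.prems by (intro ht_strict[of b m j]) auto
    then obtain w where w: "w \<in> lists gens" "successively nrm w" "wprod M w = b" using less.hyps ab(2) by blast
    have wb: "wt b = wtw w" using wt_wprod[OF w(1,2)] by (simp only: w(3))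
    have a: "a \<in> gens" using ab False by (auto simp: gens_def fun_eq_iff)
    \<comment> \<open>The height of \<open>m\<close> is the sum of the heights of \<open>a\<close>,
      \<open>y\<close> and the remaining product, while subadditivity bounds it by that of
      \<open>a \<otimes> y\<close> plus that of the rest. So the height is additive on
      \<open>a \<otimes> y\<close>.\<close>
    have "nrm a (hd w)" if ne: "w \<noteq> []"
    proof -
      obtain y v where v: "w = y # v" using ne by (cases w) auto
      have c: "y \<in> carrier M" "wprod M v \<in> carrier M" using w(1) v gens_carrier wprod_closed by auto
      have "successively nrm v" using w(2) v by (auto simp: successively_Cons)
      then have "wt b = (\<lambda>i. wt y i + wt (wprod M v) i)" using wt_wprod[of v] w(1) wb v by simp
      then have "ht b = ht y + ht (wprod M v)" by (simp add: ht_def sum.distrib distrib_left)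
      moreover have "wt m = (\<lambda>i. wt a i + wt b i)" using ab(4,5) by (auto simp: min_def)
      then have "ht m = ht a + ht b" by (simp add: ht_def sum.distrib distrib_left)
      moreover have "m = a \<otimes> y \<otimes> wprod M v" using ab w(3) v c by (simp add: m_assoc)
      then have "ht m \<le> ht (a \<otimes> y) + ht (wprod M v)" using ht_mult_le ab c by simp
      moreover have "ht (a \<otimes> y) \<le> ht a + ht y" using ht_mult_le ab c by simp
      ultimately have "cartan a y" using cartan_iff ab c by simp
      moreover have "wt a i \<noteq> 0" if "wt y i \<noteq> 0" for i
      proof -
        have "wt b i \<noteq> 0" using that wb v by simp
        then show ?thesis by (simp add: ab(4,5))
      qed
      ultimately show ?thesis by (simp add: nrm_def v)
    qed
    then show ?thesis using w a ab(3) by (intro bexI[of _ "a # w"]) (auto simp: successively_Cons)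
  qed
qed

definition nf :: "'m \<Rightarrow> 'm list" where
  "nf m = (THE w. w \<in> lists gens \<and> successively nrm w \<and> wprod M w = m)"

lemma nf_wprod: "w \<in> lists gens \<Longrightarrow> successively nrm w \<Longrightarrow> nf (wprod M w) = w"
  unfolding nf_def using normal_unique by (intro the_equality) auto

lemma nf: "m \<in> carrier M \<Longrightarrow> nf m \<in> lists gens \<and> wprod M (nf m) = m \<and> successively nrm (nf m)"
  using ex_normal[of m] nf_wprod by fastforce

section \<open>Termination of normalisation\<close>

definition htw :: "'m list \<Rightarrow> nat" where "htw w = sum_list (map ht w)"

text \<open>Each letter contributes its height times its position counted from one, so moving height
  to the front lowers the value.\<close>

fun moment :: "'m list \<Rightarrow> nat" where
  "moment [] = 0"
| "moment (x # w) = moment w + (ht x + htw w)"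

lemma htw_simps [simp]: "htw [] = 0" "htw (x # w) = ht x + htw w" "htw (u @ v) = htw u + htw v"
  by (auto simp: htw_def)

lemma moment_append: "moment (u @ v) = moment u + moment v + length u * htw v"
  by (induction u) auto

text \<open>Normalising a pair either lowers the total height, or lowers the length, or moves height from
  the second letter to the first.\<close>

definition key :: "'m list \<Rightarrow> nat \<times> nat \<times> nat" where
  "key w = (htw w, length w, moment w)"

text \<open>Words of equal length and total height receive equal contributions to the moment from
  their surroundings.\<close>

lemma key_mono: "key u < key v \<Longrightarrow> key (a @ u @ b) < key (a @ v @ b)"
  by (auto simp: key_def less_prod_def' moment_append)

lemma htw_nf:
  assumes "m \<in> carrier M"
  shows "htw (nf m) = ht m"
proof -
  have "htw w = (\<Sum>i\<in>I. coef i * wtw w i)" for w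
    by (induction w) (simp_all add: ht_def sum.distrib distrib_left)
  then show ?thesis using wt_wprod[of "nf m"] nf[OF assms] by (simp add: ht_def)
qed

text \<open>If the heights add up and the supports are \<open>S\<close> and \<open>T\<close>, the
  normal form consists of letters with supports \<open>S \<union> T\<close> and
  \<open>S \<inter> T\<close>, the second missing if empty. As the pair is not normal, some index of
  \<open>T\<close> is outside \<open>S\<close>, so the second letter loses height.\<close>

lemma key_pair:
  assumes xy: "x \<in> gens" "y \<in> gens" and n: "\<not> nrm x y"
  shows "key (nf (x \<otimes> y)) < key [x, y]"
proof (cases "cartan x y")
  case False
  then have "ht (x \<otimes> y) < ht x + ht y"
    using cartan_iff[of x y] ht_mult_le[of x y] xy gens_carrier by fastforce
  then show ?thesis using htw_nf[of "x \<otimes> y"] xy gens_carrier by (simp add: key_def less_prod_def')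
next
  case True
  then obtain j where j: "wt y j \<noteq> 0" "wt x j = 0" using n by (auto simp: nrm_def)
  have c: "x \<in> carrier M" "y \<in> carrier M" "x \<otimes> y \<in> carrier M" using xy gens_carrier by auto
  have le: "wt x i \<le> 1" "wt y i \<le> 1" for i using xy by (auto simp: gens_def)
  obtain v where v: "nf (x \<otimes> y) = v" "v \<in> lists gens" "successively nrm v" "wprod M v = x \<otimes> y"
    using nf[OF c(3)] by blast
  have wtv: "wtw v = (\<lambda>i. wt x i + wt y i)"
    using wt_wprod[OF v(2,3)] True by (simp add: v(4) cartan_def)
  obtain z r where z: "v = z # r" using wtv j(1) by (cases v) (auto simp: fun_eq_iff)
  have zr: "z \<in> gens" "r \<in> lists gens" "successively nrm r" using v z by (auto simp: successively_Cons)
  have wz: "wt z i = min 1 (wt x i + wt y i)" for i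
  proof -
    have "wtw (z # r) i = wt x i + wt y i" using fun_cong[OF wtv, of i] unfolding z .
    then show ?thesis using wt_hd[OF zr(1) v(3)[unfolded z], of i] by (simp only:)
  qed
  have r: "wtw r i = min (wt x i) (wt y i)" for i
    using fun_cong[OF wtv, of i] wz[of i] le[of i] by (auto simp: z min_def le_Suc_eq)
  have htv: "htw v = ht x + ht y" using htw_nf[OF c(3)] v(1) cartan_iff[OF c(1,2)] True by simp
  show ?thesis
  proof (cases r)
    case Nil
    then show ?thesis using htv v(1) z by (simp add: key_def less_prod_def')
  next
    case (Cons z' r')
    have z': "z' \<in> gens" "z' \<in> carrier M" using zr Cons gens_carrier by auto
    have wz': "wt z' i = wtw r i" for i
    proof -
      have "wtw (z' # r') i \<le> 1" using r[of i] le[of i] unfolding Cons by linarith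
      then show ?thesis using wt_hd[OF z'(1) zr(3)[unfolded Cons], of i] unfolding Cons by linarith
    qed
    have "r' = []"
    proof (cases r')
      case (Cons z'' r'')
      then have "wt z'' i = 0" for i using wz'[of i] \<open>r = z' # r'\<close> by simp
      moreover have "z'' \<in> gens" using zr \<open>r = z' # r'\<close> Cons by simp
      ultimately show ?thesis by (auto simp: gens_def fun_eq_iff)
    qed
    have "ht z' < ht y" using z' c j by (intro ht_strict[of z' y j]) (auto simp: wz' r)
    then show ?thesis using htv v(1) z Cons \<open>r' = []\<close> by (simp add: key_def less_prod_def')
  qed
qed

text \<open>One pair of neighbours is normalised, and well-founded induction on the key treats the
  resulting word.\<close>

lemma key_nf: "w \<in> lists gens \<Longrightarrow> \<not> successively nrm w \<Longrightarrow> key (nf (wprod M w)) < key w"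
proof (induction "key w" arbitrary: w rule: less_induct)
  case less
  have "\<not> successively nrm w \<Longrightarrow> \<exists>a x y b. w = a @ [x, y] @ b \<and> \<not> nrm x y" for w
  proof (induction w rule: induct_list012)
    case (3 x y w)
    show ?case
    proof (cases "nrm x y")
      case True
      then obtain a x' y' b where "y # w = a @ [x', y'] @ b" "\<not> nrm x' y'" using 3 by auto
      then show ?thesis by (metis append_Cons)
    next
      case False
      then show ?thesis by (metis append_Cons append_Nil)
    qed
  qed auto
  then obtain a x y b where w: "w = a @ [x, y] @ b" "\<not> nrm x y" using less.prems by blast
  have g: "a \<in> lists gens" "b \<in> lists gens" "x \<in> gens" "y \<in> gens" using less.prems w by auto
  have c: "x \<otimes> y \<in> carrier M" "x \<in> carrier M" "y \<in> carrier M" using g gens_carrier by auto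
  let ?v = "nf (x \<otimes> y)"
  have v: "?v \<in> lists gens" "wprod M ?v = x \<otimes> y" using nf[OF c(1)] by auto
  let ?w = "a @ ?v @ b"
  have k: "key ?w < key w" unfolding w(1) by (rule key_mono) (rule key_pair[OF g(3,4) w(2)])
  have "wprod M ([x, y] @ b) = x \<otimes> y \<otimes> wprod M b"
    using c wprod_closed[OF g(2)] by (simp add: m_assoc)
  then have e: "wprod M ?w = wprod M w"
    using g v unfolding w(1) by (simp add: wprod_append del: append_Cons)
  have "key (nf (wprod M ?w)) \<le> key ?w"
    using less.hyps[OF k] nf_wprod[of ?w] g v by (cases "successively nrm ?w") auto
  then show ?case using k e by simp
qed

lemma FP_infinity_factorial: "FP_infinity M"
proof -
  interpret quadratic_normal_form M gens nrm nf key
  proof unfold_locales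
    show "finite gens" "gens \<subseteq> carrier M" using finite_gens gens_carrier by auto
    show "key [] < key [x]" for x by (auto simp: key_def less_prod_def')
  qed (use nf nf_wprod key_nf key_mono in auto)
  show ?thesis by (rule FP_infinity_quadratic)
qed

end

section \<open>The plactic monoid\<close>

abbreviation cls :: "nat \<Rightarrow> letter list \<Rightarrow> letter list set" where
  "cls n u \<equiv> plactic_rel n `` {u}"

lemma cls_eq: "u \<in> words n \<Longrightarrow> cls n u = {v \<in> words n. bisC n u v}"
  by (auto simp: plactic_rel_eq)

lemma cls_eq_iff:
  assumes "u \<in> words n" "v \<in> words n"
  shows "cls n u = cls n v \<longleftrightarrow> bisC n u v"
proof
  assume *: "cls n u = cls n v"
  have "v \<in> cls n v" using assms(2) by (simp add: cls_eq)
  then have "v \<in> cls n u" by (simp only: *)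
  then show "bisC n u v" using assms(1) by (simp add: cls_eq)
next
  assume "bisC n u v"
  then have "bisC n u w \<longleftrightarrow> bisC n v w" for w using C.bis_trans C.bis_sym by metis
  then show "cls n u = cls n v" using assms by (simp add: cls_eq)
qed

lemma plactic_carrier: "A \<in> carrier (plactic_monoid_C n) \<longleftrightarrow> (\<exists>u\<in>words n. A = cls n u)"
  by (auto simp: plactic_monoid_C_def quotient_def)

lemma plactic_one: "\<one>\<^bsub>plactic_monoid_C n\<^esub> = cls n []"
  by (simp add: plactic_monoid_C_def)

lemma plactic_mult:
  assumes "u \<in> words n" "v \<in> words n"
  shows "cls n u \<otimes>\<^bsub>plactic_monoid_C n\<^esub> cls n v = cls n (u @ v)"
proof -
  have "cls n (u' @ v') = cls n (u @ v)" if "u' \<in> cls n u" "v' \<in> cls n v" for u' v'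
    using that assms C.bis_sym[OF C.bis_append[of n "{1..n}" u u' v v']] by (subst cls_eq_iff) (auto simp: cls_eq)
  moreover have "u \<in> cls n u" "v \<in> cls n v" using assms by (auto simp: cls_eq)
  ultimately have "(\<Union>u'\<in>cls n u. \<Union>v'\<in>cls n v. cls n (u' @ v')) = cls n (u @ v)" by blast
  then show ?thesis by (simp add: plactic_monoid_C_def)
qed

lemma monoid_plactic: "monoid (plactic_monoid_C n)"
proof (rule monoidI)
  let ?M = "plactic_monoid_C n"
  fix A B D assume "A \<in> carrier ?M" "B \<in> carrier ?M" "D \<in> carrier ?M"
  then obtain u v w where w: "u \<in> words n" "v \<in> words n" "w \<in> words n" "A = cls n u" "B = cls n v" "D = cls n w"
    unfolding plactic_carrier by blast
  then show "A \<otimes>\<^bsub>?M\<^esub> B \<otimes>\<^bsub>?M\<^esub> D = A \<otimes>\<^bsub>?M\<^esub> (B \<otimes>\<^bsub>?M\<^esub> D)" by (simp add: plactic_mult)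
next
  let ?M = "plactic_monoid_C n"
  fix A B assume "A \<in> carrier ?M" "B \<in> carrier ?M"
  then obtain u v where w: "u \<in> words n" "v \<in> words n" "A = cls n u" "B = cls n v"
    unfolding plactic_carrier by blast
  then have "A \<otimes>\<^bsub>?M\<^esub> B = cls n (u @ v)" "u @ v \<in> words n" by (simp_all add: plactic_mult)
  then show "A \<otimes>\<^bsub>?M\<^esub> B \<in> carrier ?M" unfolding plactic_carrier by blast
next
  let ?M = "plactic_monoid_C n"
  show "\<one>\<^bsub>?M\<^esub> \<in> carrier ?M" unfolding plactic_carrier plactic_one by (rule bexI[of _ "[]"]) auto
  fix A assume "A \<in> carrier ?M"
  then obtain u where u: "u \<in> words n" "A = cls n u" unfolding plactic_carrier by blast
  then show "\<one>\<^bsub>?M\<^esub> \<otimes>\<^bsub>?M\<^esub> A = A" "A \<otimes>\<^bsub>?M\<^esub> \<one>\<^bsub>?M\<^esub> = A"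
    using plactic_mult[of "[]" n u] plactic_mult[of u n "[]"] by (simp_all add: plactic_one)
qed

definition cls_wt :: "nat \<Rightarrow> letter list set \<Rightarrow> nat \<Rightarrow> nat" where
  "cls_wt n A = hw_wt n (SOME u. u \<in> A)"

lemma cls_wt:
  assumes "u \<in> words n"
  shows "cls_wt n (cls n u) = hw_wt n u"
proof -
  have "u \<in> cls n u" using assms by (simp add: cls_eq)
  then have "(SOME v. v \<in> cls n u) \<in> cls n u" by (rule someI)
  then have "hw_wt n u = hw_wt n (SOME v. v \<in> cls n u)" using assms by (intro bis_hw_wt) (simp_all add: cls_eq)
  then show ?thesis unfolding cls_wt_def by (rule sym)
qed

text \<open>There are finitely many classes of a given weight because each has a representative in
  the component of one fixed highest weight word, and words of a component have equal
  length.\<close>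

lemma factorial_weight_plactic:
  "factorial_weight (plactic_monoid_C n) {1..n} (ht_coeff n) (cls_wt n)"
proof (intro factorial_weight.intro monoid_plactic factorial_weight_axioms.intro)
  let ?M = "plactic_monoid_C n"
  show "finite {1..n}" by simp
  show "0 < ht_coeff n i" if "i \<in> {1..n}" for i
    unfolding ht_coeff_def using that by (intro sum_pos2[of _ 1]) auto
  show "cls_wt n A i = 0" if "A \<in> carrier ?M" "i \<notin> {1..n}" for A i
    using that by (auto simp: plactic_carrier cls_wt hw_wt_def)
  show "cls_wt n \<one>\<^bsub>?M\<^esub> = (\<lambda>_. 0)"
    using hwof_hw[of "[]" n] by (simp add: plactic_one cls_wt hw_wt_def C.hw_def fun_eq_iff)
  show "finite {A \<in> carrier ?M. cls_wt n A = l}" for l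
  proof (cases "\<exists>u\<in>words n. hw_wt n u = l")
    case True
    then obtain u where u: "u \<in> words n" "hw_wt n u = l" by blast
    have "{A \<in> carrier ?M. cls_wt n A = l} \<subseteq> cls n ` {z. connC n (hwof n u) z}"
    proof
      fix A assume "A \<in> {A \<in> carrier ?M. cls_wt n A = l}"
      then obtain v where v: "v \<in> words n" "A = cls n v" "hw_wt n v = hw_wt n u"
        using u by (auto simp: plactic_carrier cls_wt)
      then obtain z where z: "connC n (hwof n u) z" "bisC n v z" using hw_wt_transport u by blast
      have "z \<in> words n" using conn_words[OF z(1)] hwof(3)[OF u(1)] by simp
      then have "A = cls n z" using v z(2) cls_eq_iff by simp
      then show "A \<in> cls n ` {z. connC n (hwof n u) z}" using z(1) by blast
    qed
    then show ?thesis using finite_conn[OF hwof(3)[OF u(1)]] finite_subset by blast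
  next
    case False
    then have "{A \<in> carrier ?M. cls_wt n A = l} = {}" by (auto simp: plactic_carrier cls_wt)
    then show ?thesis by (simp only: finite.emptyI)
  qed
next
  let ?M = "plactic_monoid_C n"
  fix A B assume "A \<in> carrier ?M" "B \<in> carrier ?M"
  then obtain u v where w: "u \<in> words n" "v \<in> words n" "A = cls n u" "B = cls n v"
    unfolding plactic_carrier by blast
  have uv: "u @ v \<in> words n" using w by simp
  have m: "cls_wt n (A \<otimes>\<^bsub>?M\<^esub> B) = hw_wt n (u @ v)" "cls_wt n A = hw_wt n u" "cls_wt n B = hw_wt n v"
    using w uv by (simp_all add: plactic_mult cls_wt)
  note h = height_hw_wt[OF w(1)] height_hw_wt[OF w(2)] height_hw_wt[OF uv]
  show "(\<Sum>i = 1..n. ht_coeff n i * cls_wt n (A \<otimes>\<^bsub>?M\<^esub> B) i) \<le>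
      (\<Sum>i = 1..n. ht_coeff n i * cls_wt n A i) + (\<Sum>i = 1..n. ht_coeff n i * cls_wt n B i)"
    using height_hwof_append(1)[OF w(1,2)] h unfolding m by linarith
  show "cls_wt n (A \<otimes>\<^bsub>?M\<^esub> B) = (\<lambda>i. cls_wt n A i + cls_wt n B i)"
    if "(\<Sum>i = 1..n. ht_coeff n i * cls_wt n (A \<otimes>\<^bsub>?M\<^esub> B) i) =
      (\<Sum>i = 1..n. ht_coeff n i * cls_wt n A i) + (\<Sum>i = 1..n. ht_coeff n i * cls_wt n B i)"
  proof -
    have "height n (hwof n (u @ v)) = height n (hwof n u) + height n (hwof n v)"
      using that h unfolding m by linarith
    then show ?thesis
      unfolding m using height_hwof_append(2)[OF w(1,2)] hwof_append_iff[OF w(1,2)] by simp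
  qed
next
  let ?M = "plactic_monoid_C n"
  fix A l l' assume A: "A \<in> carrier ?M" "cls_wt n A = (\<lambda>i. l i + l' i)"
  then obtain w where w: "w \<in> words n" "A = cls n w" unfolding plactic_carrier by blast
  have "hw_wt n w = (\<lambda>i. l i + l' i)" using A(2) unfolding w(2) cls_wt[OF w(1)] .
  from ex_factor[OF w(1) this]
  obtain u v where uv: "u \<in> words n" "v \<in> words n" "bisC n w (u @ v)" "hw_wt n u = l" "hw_wt n v = l'"
    by (elim exE conjE)
  have "A = cls n u \<otimes>\<^bsub>?M\<^esub> cls n v" using uv w cls_eq_iff[of w n "u @ v"] by (simp add: plactic_mult)
  then show "\<exists>B\<in>carrier ?M. \<exists>D\<in>carrier ?M. A = B \<otimes>\<^bsub>?M\<^esub> D \<and> cls_wt n B = l \<and> cls_wt n D = l'"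
    using uv(1,2,4,5) by (intro bexI[of _ "cls n u"] bexI[of _ "cls n v"] conjI)
      (simp_all only: cls_wt plactic_carrier, blast+)
next
  let ?M = "plactic_monoid_C n"
  fix A B A' B' assume "A \<in> carrier ?M" "B \<in> carrier ?M" "A' \<in> carrier ?M" "B' \<in> carrier ?M"
    and e: "A \<otimes>\<^bsub>?M\<^esub> B = A' \<otimes>\<^bsub>?M\<^esub> B'" "cls_wt n A = cls_wt n A'" "cls_wt n B = cls_wt n B'"
      "cls_wt n (A \<otimes>\<^bsub>?M\<^esub> B) = (\<lambda>i. cls_wt n A i + cls_wt n B i)"
  then obtain u v u' v' where w: "u \<in> words n" "v \<in> words n" "u' \<in> words n" "v' \<in> words n"
    "A = cls n u" "B = cls n v" "A' = cls n u'" "B' = cls n v'"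
    unfolding plactic_carrier by blast
  have uv: "u @ v \<in> words n" "u' @ v' \<in> words n" using w by simp_all
  have b: "bisC n (u @ v) (u' @ v')" using e(1) w cls_eq_iff[OF uv] by (simp add: plactic_mult)
  have l: "hw_wt n u = hw_wt n u'" "hw_wt n v = hw_wt n v'"
    using e(2,3) unfolding w(5-8) cls_wt[OF w(1)] cls_wt[OF w(2)] cls_wt[OF w(3)] cls_wt[OF w(4)] .
  have "hw_wt n (u @ v) = (\<lambda>i. hw_wt n u i + hw_wt n v i)"
    using e(4) unfolding w(5,6) plactic_mult[OF w(1,2)] cls_wt[OF w(1)] cls_wt[OF w(2)] cls_wt[OF uv(1)] .
  from factor_unique[OF w(1-4) b l this] have "bisC n u u'" "bisC n v v'" .
  then show "A = A' \<and> B = B'" using w cls_eq_iff by simp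
next
  let ?M = "plactic_monoid_C n"
  fix A B D assume "A \<in> carrier ?M" "B \<in> carrier ?M" "D \<in> carrier ?M"
    and e: "cls_wt n (A \<otimes>\<^bsub>?M\<^esub> B) = (\<lambda>i. cls_wt n A i + cls_wt n B i)"
      "cls_wt n (B \<otimes>\<^bsub>?M\<^esub> D) = (\<lambda>i. cls_wt n B i + cls_wt n D i)"
      "\<And>i. cls_wt n D i \<noteq> 0 \<Longrightarrow> cls_wt n B i \<noteq> 0"
  then obtain a b c where w: "a \<in> words n" "b \<in> words n" "c \<in> words n" "A = cls n a" "B = cls n b" "D = cls n c"
    unfolding plactic_carrier by blast
  have ww: "a @ b \<in> words n" "b @ c \<in> words n" using w by simp_all
  have "hwof n ((a @ b) @ c) = hwof n (a @ b) @ hwof n c"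
  proof (rule hwof_append3[OF w(1-3)])
    show "hwof n (a @ b) = hwof n a @ hwof n b" "hwof n (b @ c) = hwof n b @ hwof n c"
      unfolding hwof_append_iff[OF w(1,2)] hwof_append_iff[OF w(2,3)]
      using e(1,2) w ww by (simp_all add: plactic_mult cls_wt)
    show "hw_wt n b i \<noteq> 0" if "hw_wt n c i \<noteq> 0" for i using e(3)[of i] that w by (simp add: cls_wt)
  qed
  then show "cls_wt n (A \<otimes>\<^bsub>?M\<^esub> B \<otimes>\<^bsub>?M\<^esub> D) = (\<lambda>i. cls_wt n (A \<otimes>\<^bsub>?M\<^esub> B) i + cls_wt n D i)"
    using hwof_append_iff[OF ww(1) w(3)] w ww by (simp add: plactic_mult cls_wt del: append_assoc)
qed

theorem proposition4p3p2:
  fixes n :: nat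
  assumes "n \<ge> 1"
  shows "FP_infinity (plactic_monoid_C n)"
  by (rule factorial_weight.FP_infinity_factorial[OF factorial_weight_plactic])

end
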